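(* Let $k$ be an algebraically closed field of characteristic $p \ge 0$ with $p \ne 2$. Then each of the following holds. (1) If moreover $p \neq 3$, there exists a morphism $\varphi: \mathbb{P}^1 \rightarrow \mathbb{P}^2$, birational onto its image, with $\deg \varphi(\mathbb{P}^1)=5$, for which there exist two (distinct) Galois points $\varphi(P_1), \varphi(P_2) \in \varphi(\mathbb{P}^1)$ such that $G_{\varphi(P_i)} \cong \mathbb{Z}/4\mathbb{Z}$ for $i=1,2$. (2) There exists a morphism $\varphi: \mathbb{P}^1 \rightarrow \mathbb{P}^2$, birational onto its image, with $\deg \varphi(\mathbb{P}^1)=5$, for which there exist two (distinct) Galois points $\varphi(P_1), \varphi(P_2) \in \varphi(\mathbb{P}^1)$ such that $G_{\varphi(P_i)} \cong (\mathbb{Z}/2\mathbb{Z})^{\oplus 2}$ for $i=1,2$. (3) There exists a morphism $\varphi: \mathbb{P}^1 \rightarrow \mathbb{P}^2$, birational onto its image, with $\deg \varphi(\mathbb{P}^1)=5$, for which there exist two (distinct) Galois points $\varphi(P_1), \varphi(P_2) \in \varphi(\mathbb{P}^1)$ such that $G_{\varphi(P_1)} \cong \mathbb{Z}/4\mathbb{Z}$ and $G_{\varphi(P_2)} \cong (\mathbb{Z}/2\mathbb{Z})^{\oplus 2}$. (4) There exists a morphism $\varphi: \mathbb{P}^1 \rightarrow \mathbb{P}^2$, birational onto its image, with $\deg \varphi(\mathbb{P}^1)=6$, for which there exist two (distinct) Galois points $\varphi(P_1), \varphi(P_2) \in \varphi(\mathbb{P}^1)$ such that $G_{\varphi(P_i)}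 \cong \mathbb{Z}/5\mathbb{Z}$ for $i=1,2$.
   Context: Everything is over the algebraically closed field $k$. Let $C$ be a smooth projective curve (here $C=\mathbb{P}^1$) and let $\varphi: C \to \mathbb{P}^2$ be birational onto its image $\varphi(C)$. For a point $P \in \mathbb{P}^2$, let $\pi_P$ denote the projection from $P$, which sends a point $Q\neq P$ to the line $\overline{PQ}$, regarded as a point of $\mathbb{P}^1$. The point $P$ is called a Galois point for $\varphi(C)$ if the function field extension $k(\varphi(C))/\pi_P^*k(\mathbb{P}^1)$ induced by $\pi_P$ (restricted to $\varphi(C)$) is Galois; the associated Galois group is denoted $G_P$. Here $\deg\varphi(C)$ is the degree of the plane curve $\varphi(C)$. *)

theory Defs
  imports
    "HOL-Analysis.Cartesian_Space"
    "HOL-Computational_Algebra.Computational_Algebra"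
    "HOL-Algebra.Algebra"
begin

section \<open>Projective spaces\<close>

definition proj_rel :: "('a::field)^'n \<Rightarrow> 'a^'n \<Rightarrow> bool" where
  "proj_rel v w \<longleftrightarrow> v \<noteq> 0 \<and> w \<noteq> 0 \<and> (\<exists>c. c \<noteq> 0 \<and> w = c *s v)"

text \<open>The index type \<open>'n\<close> numbers the homogeneous coordinates, so this is the projective space
  of dimension \<open>CARD('n) - 1\<close>. The class of a vector \<open>v \<noteq> 0\<close> is \<^term>\<open>abs_proj v\<close>, and
  \<^term>\<open>rep_proj p\<close> is some choice of homogeneous coordinates of \<open>p\<close>.\<close>

quotient_type (overloaded) ('a, 'n) proj = "('a::field)^('n::finite)" / partial: proj_rel
proof (rule part_equivpI)
  have "proj_rel (axis undefined 1) (axis undefined 1 :: 'a^'n)"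
    unfolding proj_rel_def by (auto simp: axis_eq_0_iff intro: exI[of _ 1])
  then show "\<exists>v :: 'a^'n. proj_rel v v" ..
  show "symp (proj_rel :: 'a^'n \<Rightarrow> _)"
  proof (rule sympI)
    fix v w :: "'a^'n"
    assume "proj_rel v w"
    then obtain c where c: "v \<noteq> 0" "w \<noteq> 0" "c \<noteq> 0" "w = c *s v"
      unfolding proj_rel_def by blast
    then have "v = inverse c *s w" by (simp add: vec_eq_iff)
    with c show "proj_rel w v"
      unfolding proj_rel_def by (metis inverse_nonzero_iff_nonzero)
  qed
  show "transp (proj_rel :: 'a^'n \<Rightarrow> _)"
  proof (rule transpI)
    fix u v w :: "'a^'n"
    assume "proj_rel u v" "proj_rel v w"
    then obtain c d where c: "u \<noteq> 0" "w \<noteq> 0" "c \<noteq> 0" "d \<noteq> 0" "v = c *s u" "w = d *s v"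
      unfolding proj_rel_def by blast
    then have "w = (d * c) *s u" by (simp add: vec_eq_iff)
    with c show "proj_rel u w" unfolding proj_rel_def by (metis no_zero_divisors)
  qed
qed

type_synonym 'a P1 = "('a, 2) proj"
type_synonym 'a P2 = "('a, 3) proj"


section \<open>Forms in two and three variables\<close>

text \<open>\<open>k[x\<^sub>1, x\<^sub>2]\<close> and \<open>k[x\<^sub>1, x\<^sub>2, x\<^sub>3]\<close> are represented as iterated polynomial rings; the
  innermost polynomials are those in \<open>x\<^sub>1\<close>.\<close>

type_synonym 'a poly2 = "'a poly poly"
type_synonym 'a poly3 = "'a poly poly poly"

definition eval2 :: "'a::field poly2 \<Rightarrow> 'a^2 \<Rightarrow> 'a" where
  "eval2 F v = poly (poly F [:v$2:]) (v$1)"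

definition eval3 :: "'a::field poly3 \<Rightarrow> 'a^3 \<Rightarrow> 'a" where
  "eval3 F v = poly (poly (poly F [:[:v$3:]:]) [:v$2:]) (v$1)"

definition form2 :: "nat \<Rightarrow> 'a::field poly2 \<Rightarrow> bool" where
  "form2 d F \<longleftrightarrow>
    (\<forall>i j. Polynomial.coeff (Polynomial.coeff F j) i \<noteq> 0 \<longrightarrow> i + j = d)"

definition form3 :: "nat \<Rightarrow> 'a::field poly3 \<Rightarrow> bool" where
  "form3 d F \<longleftrightarrow>
    (\<forall>i j l. Polynomial.coeff (Polynomial.coeff (Polynomial.coeff F l) j) i \<noteq> 0
      \<longrightarrow> i + j + l = d)"

text \<open>For a form, vanishing at a point does not depend on the chosen homogeneous coordinates.\<close>

definition vanishes2 :: "'a::field poly2 \<Rightarrow> 'a P1 \<Rightarrow> bool" where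
  "vanishes2 F p \<longleftrightarrow> eval2 F (rep_proj p) = 0"

definition vanishes3 :: "'a::field poly3 \<Rightarrow> 'a P2 \<Rightarrow> bool" where
  "vanishes3 F p \<longleftrightarrow> eval3 F (rep_proj p) = 0"


section \<open>Morphisms from the projective line to the plane, and plane curves\<close>

text \<open>Around every point, here on a principal open set \<open>g \<noteq> 0\<close>, the map is given by three
  forms of equal degree without common zeros.\<close>

definition morphism_P1_P2 :: "('a::field P1 \<Rightarrow> 'a P2) \<Rightarrow> bool" where
  "morphism_P1_P2 f \<longleftrightarrow>
    (\<forall>p. \<exists>d e g. \<exists>h :: ('a poly2)^3.
      form2 e g \<and> \<not> vanishes2 g p \<and> (\<forall>i. form2 d (h$i)) \<and>
      (\<forall>q. \<not> vanishes2 g q \<longrightarrow>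
        (\<chi> i. eval2 (h$i) (rep_proj q)) \<noteq> 0 \<and>
        f q = abs_proj (\<chi> i. eval2 (h$i) (rep_proj q))))"

text \<open>\<open>f\<close> has an inverse as a rational map from its image to the line, given by two forms \<open>h\<close>
  of equal degree that are not both identically zero on the image.\<close>

definition birational_onto_image :: "('a::field P1 \<Rightarrow> 'a P2) \<Rightarrow> bool" where
  "birational_onto_image f \<longleftrightarrow>
    (\<exists>d. \<exists>h :: ('a poly3)^2.
      let U = {q \<in> range f. (\<chi> i. eval3 (h$i) (rep_proj q)) \<noteq> 0};
          g = (\<lambda>q. abs_proj (\<chi> i. eval3 (h$i) (rep_proj q)))
      in (\<forall>i. form3 d (h$i)) \<and> U \<noteq> {} \<and>
         (\<forall>p. f p \<in> U \<longrightarrow> g (f p) = p) \<and> (\<forall>q\<in>U. f (g q) = q))"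

definition plane_curve_of_degree :: "'a::field P2 set \<Rightarrow> nat \<Rightarrow> bool" where
  "plane_curve_of_degree C d \<longleftrightarrow>
    (\<exists>F :: 'a poly3. form3 d F \<and> Factorial_Ring.irreducible F \<and> C = {q. vanishes3 F q})"


section \<open>Function fields of plane curves\<close>

text \<open>A rational function on an irreducible \<open>C \<subseteq> P\<^sup>2\<close> is the class of a fraction \<open>F/G\<close> of
  forms of equal degree, \<open>G\<close> not identically zero on \<open>C\<close>, where \<open>F/G\<close> and \<open>F'/G'\<close> are
  identified if \<open>F G' - F' G\<close> vanishes on \<open>C\<close>.\<close>

definition fractions :: "'a::field P2 set \<Rightarrow> ('a poly3 \<times> 'a poly3) set" where
  "fractions C =
    {(F, G). (\<exists>d. form3 d F \<and> form3 d G) \<and> (\<exists>p\<in>C. \<not> vanishes3 G p)}"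

definition fraction_rel ::
  "'a::field P2 set \<Rightarrow> (('a poly3 \<times> 'a poly3) \<times> ('a poly3 \<times> 'a poly3)) set" where
  "fraction_rel C =
    {((F, G), (F', G')). (F, G) \<in> fractions C \<and> (F', G') \<in> fractions C \<and>
       (\<forall>p\<in>C. vanishes3 (F * G' - F' * G) p)}"

abbreviation fraction_class ::
  "'a::field P2 set \<Rightarrow> 'a poly3 \<Rightarrow> 'a poly3 \<Rightarrow> ('a poly3 \<times> 'a poly3) set" where
  "fraction_class C F G \<equiv> fraction_rel C `` {(F, G)}"

definition function_field :: "'a::field P2 set \<Rightarrow> ('a poly3 \<times> 'a poly3) set ring" where
  "function_field C =
    \<lparr>carrier = fractions C // fraction_rel C,
     monoid.mult = (\<lambda>a b. \<Union>(F, G)\<in>a. \<Union>(F', G')\<in>b. fraction_class C (F * F') (G * G')),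
     monoid.one = fraction_class C 1 1,
     ring.zero = fraction_class C 0 1,
     ring.add = (\<lambda>a b. \<Union>(F, G)\<in>a. \<Union>(F', G')\<in>b. fraction_class C (F * G' + F' * G) (G * G'))\<rparr>"


section \<open>Galois extensions\<close>

definition galois_group :: "'b set \<Rightarrow> ('b, 'm) ring_scheme \<Rightarrow> ('b \<Rightarrow> 'b) monoid" where
  "galois_group K L =
    BijGroup (carrier L)
      \<lparr>carrier := {\<sigma> \<in> ring_hom L L \<inter> Bij (carrier L). \<forall>x\<in>K. \<sigma> x = x}\<rparr>"

definition galois_extension :: "'b set \<Rightarrow> ('b, 'm) ring_scheme \<Rightarrow> bool" where
  "galois_extension K L \<longleftrightarrow>
    field L \<and> subfield K L \<and> (\<forall>x\<in>carrier L. ring.algebraic L K x) \<and>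
    {x \<in> carrier L. \<forall>\<sigma>\<in>carrier (galois_group K L). \<sigma> x = x} = K"


section \<open>Projection from a point, and Galois points\<close>

text \<open>The line joining two distinct points with coordinates \<open>v\<close> and \<open>w\<close> is
  \<open>\<ell>\<^sub>1 x\<^sub>1 + \<ell>\<^sub>2 x\<^sub>2 + \<ell>\<^sub>3 x\<^sub>3 = 0\<close> with \<open>\<ell> = join_coords v w\<close>, the cross product. So in the dual
  plane the projection from \<open>P\<close> is \<open>Q \<mapsto> [P \<times> Q]\<close>, with values in the pencil of lines
  through \<open>P\<close>, which is itself a line (a copy of the projective line) in the dual plane.\<close>

definition join_coords :: "'a::field^3 \<Rightarrow> 'a^3 \<Rightarrow> 'a^3" where
  "join_coords v w =
    vector [v$2 * w$3 - v$3 * w$2, v$3 * w$1 - v$1 * w$3, v$1 * w$2 - v$2 * w$1]"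

definition pencil :: "'a::field P2 \<Rightarrow> 'a P2 set" where
  "pencil P = {l. (\<Sum>i\<in>UNIV. rep_proj l $ i * rep_proj P $ i) = 0}"

text \<open>The functions on \<open>C\<close> obtained by pulling back rational functions \<open>A/B\<close> on the pencil along
  the projection. The two equations determine the forms \<open>F\<close> and \<open>G\<close> when the field is
  infinite.\<close>

definition projection_field :: "'a::field P2 set \<Rightarrow> 'a P2 \<Rightarrow> ('a poly3 \<times> 'a poly3) set set" where
  "projection_field C P =
    {fraction_class C F G | F G A B.
       (A, B) \<in> fractions (pencil P) \<and> (F, G) \<in> fractions C \<and>
       (\<forall>v. eval3 F v = eval3 A (join_coords (rep_proj P) v)) \<and>
       (\<forall>v. eval3 G v = eval3 B (join_coords (rep_proj P) v))}"

definition galois_point :: "'a::field P2 set \<Rightarrow> 'a P2 \<Rightarrow> bool" where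
  "galois_point C P \<longleftrightarrow> galois_extension (projection_field C P) (function_field C)"

definition galois_group_at ::
  "'a::field P2 set \<Rightarrow> 'a P2 \<Rightarrow>
    (('a poly3 \<times> 'a poly3) set \<Rightarrow> ('a poly3 \<times> 'a poly3) set) monoid" where
  "galois_group_at C P = galois_group (projection_field C P) (function_field C)"

end

theory Submission
  imports Defs "HOL-Algebra.Algebraic_Closure_Type"
begin


text \<open>Each curve comes from two groups G1, G2 of Moebius transformations of P^1, both of order
  n = 4 or n = 5, and two parameters Q1, Q2 such that, as divisors, Q1 plus the G1-orbit of Q2
  equals Q2 plus the G2-orbit of Q1. Let U/V be a G1-invariant function of degree n with zeros the
  orbit of Q1 and poles the orbit of Q2, and let W/V' be a G2-invariant function of degree n with
  poles the G2-orbit of Q1. If l and l' are linear forms vanishing at Q1 and Q2, the divisor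
  condition reads V l = V' l' after scaling, and the parametrization is (U l : V l : W l'). It sends
  Q1 to (0:0:1) and Q2 to (1:0:0). In the projection from (0:0:1) the factor l cancels and U/V
  remains; in the projection from (1:0:0) the factor l' cancels and W/V' remains. This is
  \<open>has_galois_points_galois_curve\<close>.

  Galois property: with f = U/V, the element t is a root of U(X) - f V(X), a polynomial of degree at
  most n over k(f). The n transforms M(t) are distinct roots, so they are all of them
  (\<open>roots_P\<close>), the automorphisms over k(f) are exactly the n substitutions
  (\<open>Gal_eq\<close>), and a comparison of polynomials of degree less than n shows that nothing
  outside k(f) is fixed (\<open>fixed_in_K\<close>). An explicit rational inverse (H1 : H2) of the
  parametrization identifies the function field of the curve with k(t) (\<open>\<Theta>_iso\<close>)
  and the projection field with k(f) (\<open>projection_field_eq\<close>);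
  \<open>galois_transport\<close> carries the Galois property and the group across. The group is
  then recognized from its order and from whether its elements are involutions.

  Degree: an explicit form F of degree n + 1 vanishes on the curve, with leading term
  \<open>c\<^sub>0\<close> x_1 x_3^n in x_3. Above a point (U : V) the n conjugate parameters M(t)
  give n values of x_3, so F splits there into n linear factors (\<open>F_prod\<close>). Hence F
  cuts out exactly the curve (\<open>zero_set\<close>). A factor of F vanishing on the curve has all
  n conjugate roots, hence full degree in x_3, which gives irreducibility
  (\<open>irreducible_F\<close>).\<close>

no_notation fps_nth (infixl "$" 75)

section \<open>Polynomials over an infinite field as functions, and density of their nonvanishing
  loci\<close>

section \<open>Polynomial functions\<close>

text \<open>If the field were finite, one plus the product of all X - x would have no root.\<close>

lemma infinite_alg_closed: "infinite (UNIV :: 'a::alg_closed_field set)"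
proof
  assume fin: "finite (UNIV :: 'a set)"
  define q :: "'a poly" where "q = (\<Prod>x\<in>UNIV. [:-x, 1:])"
  have "Polynomial.degree q = card (UNIV :: 'a set)"
    unfolding q_def by (subst degree_prod_sum_eq) auto
  moreover have "card (UNIV :: 'a set) > 0" using fin by (simp add: card_gt_0_iff)
  ultimately have "Polynomial.degree (q + 1) > 0"
    by (simp add: degree_add_eq_left)
  then obtain x where "poly (q + 1) x = 0" using alg_closed_imp_poly_has_root by blast
  moreover have "poly q x = 0" unfolding q_def poly_prod using fin by (intro prod_zero) auto
  ultimately show False by simp
qed

lemma poly_eqI_cofinite:
  fixes p q :: "'a::alg_closed_field poly"
  assumes "finite S" "\<And>x. x \<notin> S \<Longrightarrow> poly p x = poly q x"
  shows "p = q"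
proof (rule ccontr)
  assume "p \<noteq> q"
  then have "finite {x. poly (p - q) x = 0}" by (intro poly_roots_finite) simp
  moreover have "UNIV \<subseteq> S \<union> {x. poly (p - q) x = 0}" using assms(2) by auto
  ultimately have "finite (UNIV :: 'a set)" using assms(1) finite_subset by blast
  with infinite_alg_closed show False by blast
qed

lemma poly_eqI_all: "(\<And>x. poly p x = poly q x) \<Longrightarrow> p = q" for p q :: "'a::alg_closed_field poly"
  by (rule poly_eqI_cofinite[of "{}"]) auto

lemma poly_two_pow:
  fixes P :: "'a::comm_ring_1 poly poly"
  shows "poly (poly P [:w:]) u
    = (\<Sum>j\<le>Polynomial.degree P. poly (Polynomial.coeff P j) u * w ^ j)"
  by (simp add: poly_altdef[of P] poly_sum)

lemma poly_three_pow:
  fixes P :: "'a::comm_ring_1 poly poly poly"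
  shows "poly (poly (poly P [:[:z:]:]) [:y:]) x
    = (\<Sum>l\<le>Polynomial.degree P. poly (poly (Polynomial.coeff P l) [:y:]) x * z ^ l)"
  by (simp add: poly_altdef[of P] poly_sum)

text \<open>Over an infinite field a polynomial is determined by its values; this is applied one
  variable at a time. It allows identities between polynomials to be proved pointwise from here
  on.\<close>

lemma poly2_eq_0I:
  fixes P :: "'a::alg_closed_field poly poly"
  assumes "\<And>u w. poly (poly P [:w:]) u = 0"
  shows "P = 0"
proof (rule Polynomial.poly_eqI, rule poly_eqI_all)
  fix j u
  define p where "p = (\<Sum>j\<le>Polynomial.degree P. Polynomial.monom (poly (Polynomial.coeff P j) u) j)"
  have "p = 0"
  proof (rule poly_eqI_all)
    show "poly p w = poly 0 w" for w
      using assms[of w u] unfolding p_def by (simp add: poly_sum poly_monom poly_two_pow)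
  qed
  moreover have "Polynomial.coeff p j = poly (Polynomial.coeff P j) u"
    unfolding p_def by (simp add: coeff_sum coeff_eq_0 if_distrib cong: if_cong)
  ultimately show "poly (Polynomial.coeff P j) u = poly (Polynomial.coeff 0 j) u" by simp
qed

lemma poly3_eq_0I:
  fixes P :: "'a::alg_closed_field poly3"
  assumes "\<And>v. eval3 P v = 0"
  shows "P = 0"
proof (rule Polynomial.poly_eqI)
  fix l
  have "Polynomial.coeff P l = 0"
  proof (rule poly2_eq_0I)
    fix x y
    define p where
      "p = (\<Sum>l\<le>Polynomial.degree P. Polynomial.monom (poly (poly (Polynomial.coeff P l) [:y:]) x) l)"
    have "p = 0"
    proof (rule poly_eqI_all)
      show "poly p z = poly 0 z" for z
        using assms[of "vector [x, y, z]"] unfolding p_def eval3_def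
        by (simp add: poly_sum poly_monom poly_three_pow)
    qed
    moreover have "Polynomial.coeff p l = poly (poly (Polynomial.coeff P l) [:y:]) x"
      unfolding p_def by (simp add: coeff_sum coeff_eq_0 if_distrib cong: if_cong)
    ultimately show "poly (poly (Polynomial.coeff P l) [:y:]) x = 0" by simp
  qed
  then show "Polynomial.coeff P l = Polynomial.coeff 0 l" by simp
qed

lemma eval3_simps [simp]:
  "eval3 (F + G) v = eval3 F v + eval3 G v" "eval3 (F * G) v = eval3 F v * eval3 G v"
  "eval3 (F - G) v = eval3 F v - eval3 G v" "eval3 (- F) v = - eval3 F v"
  "eval3 0 v = 0" "eval3 1 v = 1" "eval3 (F ^ k) v = eval3 F v ^ k"
  by (simp_all add: eval3_def)

lemma eval3_sum: "eval3 (sum f A) v = (\<Sum>i\<in>A. eval3 (f i) v)"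
  by (induction A rule: infinite_finite_induct) auto

definition const3 :: "'a::field \<Rightarrow> 'a poly3" where "const3 c = [:[:[:c:]:]:]"

definition var3 :: "3 \<Rightarrow> 'a::field poly3" where
  "var3 i = (if i = 1 then [:[:[:0, 1:]:]:] else if i = 2 then [:[:0, 1:]:] else [:0, 1:])"

lemma eval3_const3 [simp]: "eval3 (const3 c) v = c"
  by (simp add: const3_def eval3_def)

lemma eval3_var3 [simp]: "eval3 (var3 i) v = v $ i"
  using exhaust_3[of i] by (auto simp: var3_def eval3_def)

text \<open>Polynomials in (u, w) are handled through their functions, so that products,
  compositions with Moebius maps and evaluations of ternary forms need no coefficient
  computation.\<close>

definition polyfun :: "('a::field \<Rightarrow> 'a \<Rightarrow> 'a) \<Rightarrow> bool" where
  "polyfun f \<longleftrightarrow> (\<exists>P. \<forall>u w. f u w = poly (poly P [:w:]) u)"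

lemma polyfun_add: "polyfun f \<Longrightarrow> polyfun g \<Longrightarrow> polyfun (\<lambda>u w. f u w + g u w)"
  unfolding polyfun_def by (metis poly_add)

lemma polyfun_diff: "polyfun f \<Longrightarrow> polyfun g \<Longrightarrow> polyfun (\<lambda>u w. f u w - g u w)"
  unfolding polyfun_def by (metis poly_diff)

lemma polyfun_mult: "polyfun f \<Longrightarrow> polyfun g \<Longrightarrow> polyfun (\<lambda>u w. f u w * g u w)"
  unfolding polyfun_def by (metis poly_mult)

lemma polyfun_const: "polyfun (\<lambda>u w. c)"
  unfolding polyfun_def by (rule exI[of _ "[:[:c:]:]"]) simp

lemma polyfun_fst: "polyfun (\<lambda>u w. u)"
  unfolding polyfun_def by (rule exI[of _ "[:[:0, 1:]:]"]) simp

lemma polyfun_snd: "polyfun (\<lambda>u w. w)"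
  unfolding polyfun_def by (rule exI[of _ "[:0, 1:]"]) simp

lemma polyfun_power: "polyfun f \<Longrightarrow> polyfun (\<lambda>u w. f u w ^ k)"
  by (induction k) (auto intro: polyfun_const polyfun_mult)

lemma polyfun_sum: "(\<And>i. i \<in> I \<Longrightarrow> polyfun (f i)) \<Longrightarrow> polyfun (\<lambda>u w. \<Sum>i\<in>I. f i u w)"
  by (induction I rule: infinite_finite_induct) (auto intro: polyfun_const polyfun_add)

lemma polyfun_prod: "(\<And>i. i \<in> I \<Longrightarrow> polyfun (f i)) \<Longrightarrow> polyfun (\<lambda>u w. \<Prod>i\<in>I. f i u w)"
  by (induction I rule: infinite_finite_induct) (auto intro: polyfun_const polyfun_mult)

lemma polyfun_poly: "polyfun f \<Longrightarrow> polyfun (\<lambda>u w. poly p (f u w))"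
  unfolding poly_altdef by (intro polyfun_sum polyfun_mult polyfun_const polyfun_power)

lemma polyfun_poly2:
  "polyfun f \<Longrightarrow> polyfun g \<Longrightarrow> polyfun (\<lambda>u w. poly (poly P [:g u w:]) (f u w))"
  unfolding poly_two_pow by (intro polyfun_sum polyfun_mult polyfun_poly polyfun_power)

lemma polyfun_eval3:
  fixes g :: "'a::field \<Rightarrow> 'a \<Rightarrow> 'a^3"
  assumes "\<And>i. polyfun (\<lambda>u w. g u w $ i)"
  shows "polyfun (\<lambda>u w. eval3 F (g u w))"
  unfolding eval3_def poly_three_pow
  by (intro polyfun_sum polyfun_mult polyfun_poly2 polyfun_power assms)

lemmas polyfun_intros = polyfun_add polyfun_diff polyfun_mult polyfun_const polyfun_power
  polyfun_sum polyfun_prod polyfun_poly polyfun_poly2 polyfun_eval3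

lemma polyfun_mult_eq_0:
  fixes f g :: "'a::alg_closed_field \<Rightarrow> 'a \<Rightarrow> 'a"
  assumes "polyfun f" "polyfun g" "\<And>u w. f u w * g u w = 0"
  shows "(\<forall>u w. f u w = 0) \<or> (\<forall>u w. g u w = 0)"
proof -
  obtain P Q where PQ: "\<And>u w. f u w = poly (poly P [:w:]) u" "\<And>u w. g u w = poly (poly Q [:w:]) u"
    using assms(1,2) unfolding polyfun_def by blast
  have "P * Q = 0" by (rule poly2_eq_0I) (use assms(3) PQ in simp)
  then show ?thesis using PQ by auto
qed

text \<open>Zariski density: the locus where finitely many nonzero polynomials are all nonzero is
  dense in the plane. Multiplying g by them one after another reduces this to the absence of zero
  divisors. It justifies every division by a form that may vanish somewhere.\<close>

lemma polyfun_generic_eq_0: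
  fixes f :: "'i \<Rightarrow> 'a::alg_closed_field \<Rightarrow> 'a \<Rightarrow> 'a"
  assumes "finite I" "\<And>i. i \<in> I \<Longrightarrow> polyfun (f i)" "\<And>i. i \<in> I \<Longrightarrow> \<exists>u w. f i u w \<noteq> 0"
    and "polyfun g" "\<And>u w. (\<And>i. i \<in> I \<Longrightarrow> f i u w \<noteq> 0) \<Longrightarrow> g u w = 0"
  shows "g u w = 0"
  using assms
proof (induction I arbitrary: g u w rule: finite_induct)
  case (insert j I)
  have "f j u w * g u w = 0" for u w
  proof (rule insert.IH[of "\<lambda>u w. f j u w * g u w"])
    show "polyfun (\<lambda>u w. f j u w * g u w)" using insert.prems by (intro polyfun_mult) auto
    show "f j u w * g u w = 0" if "\<And>i. i \<in> I \<Longrightarrow> f i u w \<noteq> 0" for u w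
      using that insert.prems(4)[of u w] by (cases "f j u w = 0") auto
  qed (use insert.prems in auto)
  then show ?case using polyfun_mult_eq_0[of "f j" g] insert.prems by blast
qed auto


section \<open>Homogeneity, Euler scaling, and substitution of binary forms into ternary
  ones\<close>

section \<open>Forms\<close>

lemma form2_add: "form2 d P \<Longrightarrow> form2 d Q \<Longrightarrow> form2 d (P + Q)"
  unfolding form2_def by (metis add.right_neutral coeff_add)

lemma form2_mult:
  assumes "form2 d P" "form2 e Q" shows "form2 (d + e) (P * Q)"
  unfolding form2_def
proof (intro allI impI)
  fix i j assume "Polynomial.coeff (Polynomial.coeff (P * Q) j) i \<noteq> 0"
  then have "(\<Sum>k\<le>j. \<Sum>l\<le>i. Polynomial.coeff (Polynomial.coeff P k) l
      * Polynomial.coeff (Polynomial.coeff Q (j - k)) (i - l)) \<noteq> 0"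
    by (simp add: coeff_mult coeff_sum)
  then obtain k where k: "k \<in> {..j}" "(\<Sum>l\<le>i. Polynomial.coeff (Polynomial.coeff P k) l
      * Polynomial.coeff (Polynomial.coeff Q (j - k)) (i - l)) \<noteq> 0"
    by (rule sum.not_neutral_contains_not_neutral)
  from k(2) obtain l where l: "l \<in> {..i}" "Polynomial.coeff (Polynomial.coeff P k) l
      * Polynomial.coeff (Polynomial.coeff Q (j - k)) (i - l) \<noteq> 0"
    by (rule sum.not_neutral_contains_not_neutral)
  then have "l + k = d" "(i - l) + (j - k) = e" using assms unfolding form2_def by auto
  with k l show "i + j = d + e" by auto
qed

lemma form3_add: "form3 d P \<Longrightarrow> form3 d Q \<Longrightarrow> form3 d (P + Q)"
  unfolding form3_def by (metis add.right_neutral coeff_add)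

lemma form3_uminus: "form3 d P \<Longrightarrow> form3 d (- P)"
  unfolding form3_def by simp

lemma form3_diff: "form3 d P \<Longrightarrow> form3 d Q \<Longrightarrow> form3 d (P - Q)"
  using form3_add[of d P "- Q"] form3_uminus[of d Q] by simp

lemma form3_0: "form3 d 0"
  by (simp add: form3_def)

text \<open>Slicing by the power of the third variable reduces statements about ternary forms to
  binary ones.\<close>

lemma form3_alt: "form3 d P \<longleftrightarrow> (\<forall>l. if l \<le> d then form2 (d - l) (Polynomial.coeff P l)
    else Polynomial.coeff P l = 0)"
  unfolding form3_def form2_def by (auto simp: poly_eq_iff) (metis add.commute le_add2 nle_le le_add_diff_inverse2 add_diff_cancel_right' not_add_less2 not_le)+

lemma form3_mult:
  assumes "form3 d P" "form3 e Q" shows "form3 (d + e) (P * Q)"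
  unfolding form3_def
proof (intro allI impI)
  fix i j l assume "Polynomial.coeff (Polynomial.coeff (Polynomial.coeff (P * Q) l) j) i \<noteq> 0"
  then have "(\<Sum>k\<le>l. Polynomial.coeff (Polynomial.coeff (Polynomial.coeff P k
      * Polynomial.coeff Q (l - k)) j) i) \<noteq> 0"
    by (simp add: coeff_mult[of P] coeff_sum)
  then obtain k where k: "k \<in> {..l}" "Polynomial.coeff (Polynomial.coeff (Polynomial.coeff P k
      * Polynomial.coeff Q (l - k)) j) i \<noteq> 0"
    by (rule sum.not_neutral_contains_not_neutral)
  then have nz: "Polynomial.coeff P k \<noteq> 0" "Polynomial.coeff Q (l - k) \<noteq> 0" by auto
  with assms have le: "k \<le> d" "l - k \<le> e" unfolding form3_alt by metis+
  then have "form2 (d - k) (Polynomial.coeff P k)" "form2 (e - (l - k)) (Polynomial.coeff Q (l - k))"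
    using assms unfolding form3_alt by metis+
  from form2_mult[OF this] k(2) have "i + j = (d - k) + (e - (l - k))"
    unfolding form2_def by blast
  with k(1) le show "i + j + l = d + e" by auto
qed

lemma form3_const3: "form3 0 (const3 c)"
  by (auto simp: form3_def const3_def coeff_pCons split: nat.splits)

lemma form3_1: "form3 0 1"
  using form3_const3[of 1] by (simp add: const3_def one_pCons)

lemma form3_var3: "form3 1 (var3 i)"
  by (auto simp: form3_def var3_def coeff_pCons one_pCons split: nat.splits)

lemma form3_power: "form3 d P \<Longrightarrow> form3 (k * d) (P ^ k)"
  by (induction k) (auto intro: form3_1 form3_mult)

lemma form3_sum: "(\<And>i. i \<in> I \<Longrightarrow> form3 d (f i)) \<Longrightarrow> form3 d (sum f I)"
  by (induction I rule: infinite_finite_induct) (auto intro: form3_add form3_0)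

lemma form2_eval:
  assumes "form2 d P"
  shows "poly (poly P [:w:]) u
    = (\<Sum>i\<le>d. Polynomial.coeff (Polynomial.coeff P (d - i)) i * u ^ i * w ^ (d - i))"
proof -
  have c: "Polynomial.coeff P j = (if j \<le> d
    then Polynomial.monom (Polynomial.coeff (Polynomial.coeff P j) (d - j)) (d - j) else 0)" for j
    using assms unfolding form2_def by (auto simp: poly_eq_iff) (metis diff_add_inverse2, metis le_add2)
  have "Polynomial.degree P \<le> d" by (intro degree_le allI impI) (metis c linorder_not_le)
  have "poly (poly P [:w:]) u
      = (\<Sum>j\<le>Polynomial.degree P. poly (Polynomial.coeff P j) u * w ^ j)"
    by (rule poly_two_pow)
  also have "\<dots> = (\<Sum>j\<le>d. poly (Polynomial.coeff P j) u * w ^ j)"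
    using \<open>Polynomial.degree P \<le> d\<close> by (intro sum.mono_neutral_left) (auto simp: coeff_eq_0)
  also have "\<dots> = (\<Sum>j\<le>d. Polynomial.coeff (Polynomial.coeff P j) (d - j) * u ^ (d - j) * w ^ j)"
    by (intro sum.cong refl, subst c) (simp add: poly_monom)
  also have "\<dots> = (\<Sum>i\<le>d. Polynomial.coeff (Polynomial.coeff P (d - i)) i * u ^ i * w ^ (d - i))"
    by (rule sum.reindex_bij_witness[of _ "\<lambda>i. d - i" "\<lambda>i. d - i"]) auto
  finally show ?thesis .
qed

lemma form2_scale:
  assumes "form2 d P"
  shows "poly (poly P [:c * w:]) (c * u) = c ^ d * poly (poly P [:w:]) u"
  unfolding form2_eval[OF assms] sum_distrib_left
  by (intro sum.cong refl) (simp add: power_mult_distrib power_add[symmetric] ac_simps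
    mult.assoc[symmetric, of "c ^ _" "c ^ _"])

lemma form3_scale:
  assumes "form3 d F"
  shows "eval3 F (c *s v) = c ^ d * eval3 F v"
proof -
  have "poly (poly (Polynomial.coeff F l) [:c * v$2:]) (c * v$1) * (c * v$3) ^ l
      = c ^ d * (poly (poly (Polynomial.coeff F l) [:v$2:]) (v$1) * v$3 ^ l)" for l
  proof (cases "l \<le> d")
    case True
    then have "form2 (d - l) (Polynomial.coeff F l)" using assms unfolding form3_alt by metis
    moreover have "c ^ d = c ^ (d - l) * c ^ l" using True by (simp add: power_add[symmetric])
    ultimately show ?thesis by (simp add: form2_scale power_mult_distrib)
  next
    case False
    then have "Polynomial.coeff F l = 0" using assms unfolding form3_alt by metis
    then show ?thesis by simp
  qed
  then show ?thesis
    unfolding eval3_def poly_three_pow by (simp add: sum_distrib_left)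
qed

text \<open>The functional counterpart of \<open>form2\<close>: the examples give their forms as
  factored expressions in u and w, and the underlying coefficients are only asserted to
  exist.\<close>

definition binary_form :: "nat \<Rightarrow> ('a::field \<Rightarrow> 'a \<Rightarrow> 'a) \<Rightarrow> bool" where
  "binary_form d f \<longleftrightarrow> (\<exists>P. form2 d P \<and> (\<forall>u w. f u w = poly (poly P [:w:]) u))"

lemma binary_form_add:
  "binary_form d f \<Longrightarrow> binary_form d g \<Longrightarrow> binary_form d (\<lambda>u w. f u w + g u w)"
  unfolding binary_form_def by (metis poly_add form2_add)

lemma binary_form_mult:
  "binary_form d f \<Longrightarrow> binary_form e g \<Longrightarrow> binary_form (d + e) (\<lambda>u w. f u w * g u w)"
  unfolding binary_form_def by (metis poly_mult form2_mult)

lemma binary_form_const: "binary_form 0 (\<lambda>u w. c)"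
  unfolding binary_form_def
  by (rule exI[of _ "[:[:c:]:]"]) (auto simp: form2_def coeff_pCons split: nat.splits)

lemma binary_form_fst: "binary_form 1 (\<lambda>u w. u)"
  unfolding binary_form_def
  by (rule exI[of _ "[:[:0, 1:]:]"]) (auto simp: form2_def coeff_pCons one_pCons split: nat.splits)

lemma binary_form_snd: "binary_form 1 (\<lambda>u w. w)"
  unfolding binary_form_def
  by (rule exI[of _ "[:0, 1:]"]) (auto simp: form2_def coeff_pCons one_pCons split: nat.splits)

lemma binary_form_scale: "binary_form d f \<Longrightarrow> binary_form d (\<lambda>u w. c * f u w)"
  using binary_form_mult[OF binary_form_const] by fastforce

lemma binary_form_diff:
  "binary_form d f \<Longrightarrow> binary_form d g \<Longrightarrow> binary_form d (\<lambda>u w. f u w - g u w)"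
  using binary_form_add[of d f "\<lambda>u w. (-1) * g u w"] binary_form_scale[of d g "-1"] by simp

lemma binary_form_power: "binary_form d f \<Longrightarrow> binary_form (k * d) (\<lambda>u w. f u w ^ k)"
  by (induction k) (auto intro: binary_form_const binary_form_mult)

lemma binary_form_0: "binary_form d (\<lambda>u w. 0)"
  unfolding binary_form_def by (rule exI[of _ 0]) (simp add: form2_def)

lemma binary_form_sum:
  "(\<And>i. i \<in> I \<Longrightarrow> binary_form d (f i)) \<Longrightarrow> binary_form d (\<lambda>u w. \<Sum>i\<in>I. f i u w)"
  by (induction I rule: infinite_finite_induct) (auto intro: binary_form_add binary_form_0)

lemma binary_form_polyfun: "binary_form d f \<Longrightarrow> polyfun f"
  unfolding binary_form_def polyfun_def by blast

lemma binary_form_homogeneous: "binary_form d f \<Longrightarrow> f (c * u) (c * w) = c ^ d * f u w"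
  unfolding binary_form_def using form2_scale by metis

lemma binary_form_poly:
  assumes "binary_form d f"
  obtains p where "Polynomial.degree p \<le> d"
    "\<And>u w. f u w = (\<Sum>i\<le>d. Polynomial.coeff p i * u ^ i * w ^ (d - i))"
proof -
  obtain P where P: "form2 d P" "\<And>u w. f u w = poly (poly P [:w:]) u"
    using assms unfolding binary_form_def by blast
  define p where "p = (\<Sum>i\<le>d. Polynomial.monom (Polynomial.coeff (Polynomial.coeff P (d - i)) i) i)"
  have c: "Polynomial.coeff p i = (if i \<le> d then Polynomial.coeff (Polynomial.coeff P (d - i)) i else 0)" for i
    unfolding p_def by (simp add: coeff_sum if_distrib cong: if_cong)
  show ?thesis
  proof
    show "Polynomial.degree p \<le> d" by (rule degree_le) (simp add: c)
    show "f u w = (\<Sum>i\<le>d. Polynomial.coeff p i * u ^ i * w ^ (d - i))" for u w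
      unfolding P(2) form2_eval[OF P(1)] by (simp add: c)
  qed
qed

text \<open>If the coefficient of u^d vanishes, the point at infinity (1, 0) is a zero. Otherwise
  the dehomogenized polynomial has positive degree d and a root t, giving (t, 1).\<close>

lemma binary_form_nontrivial_zero:
  fixes f :: "'a::alg_closed_field \<Rightarrow> 'a \<Rightarrow> 'a"
  assumes "binary_form d f" "d > 0"
  obtains u w where "u \<noteq> 0 \<or> w \<noteq> 0" "f u w = 0"
proof -
  obtain p where p: "Polynomial.degree p \<le> d"
    "\<And>u w. f u w = (\<Sum>i\<le>d. Polynomial.coeff p i * u ^ i * w ^ (d - i))"
    using binary_form_poly[OF assms(1)] by blast
  show ?thesis
  proof (cases "Polynomial.coeff p d = 0")
    case True
    have "f 1 0 = (\<Sum>i\<le>d. if i = d then Polynomial.coeff p i else 0)"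
      unfolding p(2) by (intro sum.cong) (auto simp: power_0_left)
    with True have "f 1 0 = 0" by simp
    then show ?thesis using that[of 1 0] by simp
  next
    case False
    with p(1) have deg: "Polynomial.degree p = d" by (simp add: le_degree le_antisym)
    with assms(2) obtain t where "poly p t = 0" using alg_closed_imp_poly_has_root by metis
    then have "f t 1 = 0" unfolding p(2) using deg by (simp add: poly_altdef)
    then show ?thesis using that[of t 1] by simp
  qed
qed

lemma binary_form_eval3:
  fixes g :: "'a::field \<Rightarrow> 'a \<Rightarrow> 'a^3"
  assumes "form3 e F" "\<And>i. binary_form d (\<lambda>u w. g u w $ i)"
  shows "binary_form (e * d) (\<lambda>u w. eval3 F (g u w))"
proof -
  have tm: "binary_form (e * d) (\<lambda>u w. poly (poly (Polynomial.coeff F l) [:g u w $ 2:]) (g u w $ 1) * g u w $ 3 ^ l)"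
    for l
  proof (cases "l \<le> e")
    case True
    then have f2: "form2 (e - l) (Polynomial.coeff F l)" using assms(1) unfolding form3_alt by metis
    have t: "binary_form ((e - l) * d) (\<lambda>u w. c * (g u w $ 1 ^ i * g u w $ 2 ^ (e - l - i)))"
      if "i \<le> e - l" for c i
    proof -
      have "i * d + (e - l - i) * d = (e - l) * d" using that by (metis add_mult_distrib le_add_diff_inverse)
      with binary_form_scale[OF binary_form_mult[OF binary_form_power[OF assms(2), of i 1]
        binary_form_power[OF assms(2), of "e - l - i" 2]], of c] show ?thesis by simp
    qed
    have "binary_form ((e - l) * d) (\<lambda>u w. poly (poly (Polynomial.coeff F l) [:g u w $ 2:]) (g u w $ 1))"
      unfolding form2_eval[OF f2] mult.assoc by (intro binary_form_sum t) auto
    from binary_form_mult[OF this binary_form_power[OF assms(2), of l]] True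
    show ?thesis by (simp add: add_mult_distrib[symmetric])
  next
    case False
    then have "Polynomial.coeff F l = 0" using assms(1) unfolding form3_alt by metis
    then show ?thesis by (simp add: binary_form_0)
  qed
  show ?thesis unfolding eval3_def poly_three_pow by (intro binary_form_sum tm)
qed

section \<open>Projective points, and morphism and birationality of a parametrized curve\<close>

section \<open>Parametrized plane curves\<close>

lemma rep_proj_nonzero [simp]: "rep_proj p \<noteq> 0"
  using Quotient3_rep_reflp[OF Quotient3_proj] unfolding proj_rel_def by blast

lemma abs_rep_proj: "abs_proj (rep_proj p) = p"
  by (rule Quotient3_abs_rep[OF Quotient3_proj])

lemma rep_abs_proj:
  assumes "v \<noteq> 0"
  obtains c where "c \<noteq> 0" "rep_proj (abs_proj v) = c *s v"
proof -
  have "proj_rel v v" using assms unfolding proj_rel_def by (auto intro: exI[of _ 1])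
  then have "proj_rel v (rep_proj (abs_proj v))"
    using Quotient3_rel[OF Quotient3_proj] Quotient3_abs_rep[OF Quotient3_proj]
      Quotient3_rep_reflp[OF Quotient3_proj] by metis
  then show ?thesis using that unfolding proj_rel_def by blast
qed

lemma abs_proj_scale:
  assumes "c \<noteq> 0" "v \<noteq> 0"
  shows "abs_proj (c *s v) = abs_proj v"
proof -
  have "proj_rel v (c *s v)" using assms unfolding proj_rel_def by auto
  then show ?thesis using Quotient3_rel[OF Quotient3_proj] by metis
qed

lemma vanishes3_abs_proj:
  assumes "form3 d F" "v \<noteq> 0"
  shows "vanishes3 F (abs_proj v) \<longleftrightarrow> eval3 F v = 0"
proof -
  obtain c where "c \<noteq> 0" "rep_proj (abs_proj v) = c *s v" using rep_abs_proj[OF assms(2)] .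
  then show ?thesis unfolding vanishes3_def using form3_scale[OF assms(1)] by simp
qed

lemma vec2_nonzero_iff: "(v :: 'a::zero^2) \<noteq> 0 \<longleftrightarrow> v $ 1 \<noteq> 0 \<or> v $ 2 \<noteq> 0"
  by (simp add: vec_eq_iff forall_2)

lemma vec3_nonzero_iff: "(v :: 'a::zero^3) \<noteq> 0 \<longleftrightarrow> v $ 1 \<noteq> 0 \<or> v $ 2 \<noteq> 0 \<or> v $ 3 \<noteq> 0"
  by (simp add: vec_eq_iff forall_3)

definition param_map :: "('a::field \<Rightarrow> 'a \<Rightarrow> 'a^3) \<Rightarrow> 'a P1 \<Rightarrow> 'a P2" where
  "param_map \<phi> p = abs_proj (\<phi> (rep_proj p $ 1) (rep_proj p $ 2))"

text \<open>The relation w H1 = u H2 along \<phi> says that (H1 : H2) recovers the parameter (u : w)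
  wherever H1 and H2 do not both vanish; nonvanishing of H2 somewhere makes this locus nonempty.
  This certificate yields birationality here and the surjectivity of pullback onto k(t)
  later.\<close>

locale plane_param =
  fixes \<phi> :: "'a::alg_closed_field \<Rightarrow> 'a \<Rightarrow> 'a^3" and N :: nat
    and H1 H2 :: "'a poly3" and e :: nat
  assumes form: "\<And>i. binary_form N (\<lambda>u w. \<phi> u w $ i)"
    and nonzero: "\<And>u w. u \<noteq> 0 \<or> w \<noteq> 0 \<Longrightarrow> \<phi> u w \<noteq> 0"
    and form_H: "form3 e H1" "form3 e H2"
    and inverse_H: "\<And>u w. w * eval3 H1 (\<phi> u w) = u * eval3 H2 (\<phi> u w)"
    and H2_nonzero: "\<exists>u w. eval3 H2 (\<phi> u w) \<noteq> 0"
begin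

abbreviation curve :: "'a P2 set" where "curve \<equiv> range (param_map \<phi>)"

lemma param_scale: "\<phi> (c * u) (c * w) = c ^ N *s \<phi> u w"
  using binary_form_homogeneous[OF form] by (simp add: vec_eq_iff)

lemma param_map_abs_proj:
  assumes "u \<noteq> 0 \<or> w \<noteq> 0"
  shows "param_map \<phi> (abs_proj (vector [u, w])) = abs_proj (\<phi> u w)"
proof -
  have "vector [u, w] \<noteq> (0 :: 'a^2)" using assms by (simp add: vec2_nonzero_iff)
  then obtain c where "c \<noteq> 0" "rep_proj (abs_proj (vector [u, w])) = c *s (vector [u, w] :: 'a^2)"
    using rep_abs_proj by blast
  then show ?thesis
    unfolding param_map_def using nonzero[OF assms] by (simp add: param_scale abs_proj_scale)
qed

lemma curve_cases:
  assumes "q \<in> curve"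
  obtains u w where "u \<noteq> 0 \<or> w \<noteq> 0" "q = abs_proj (\<phi> u w)"
proof -
  from assms obtain p where "q = param_map \<phi> p" by blast
  moreover have "rep_proj p $ 1 \<noteq> 0 \<or> rep_proj p $ 2 \<noteq> 0"
    using rep_proj_nonzero[of p] vec2_nonzero_iff by blast
  ultimately show ?thesis using that unfolding param_map_def by blast
qed

lemma abs_proj_in_curve: "u \<noteq> 0 \<or> w \<noteq> 0 \<Longrightarrow> abs_proj (\<phi> u w) \<in> curve"
  using param_map_abs_proj by (metis rangeI)

lemma vanishes3_on_curve_iff:
  assumes "form3 d F"
  shows "(\<forall>q\<in>curve. vanishes3 F q) \<longleftrightarrow> (\<forall>u w. u \<noteq> 0 \<or> w \<noteq> 0 \<longrightarrow> eval3 F (\<phi> u w) = 0)"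
  by (metis assms abs_proj_in_curve curve_cases nonzero vanishes3_abs_proj)

lemma polyfun_param: "polyfun (\<lambda>u w. eval3 F (\<phi> u w))"
  by (intro polyfun_eval3) (rule binary_form_polyfun[OF form])

lemma morphism: "morphism_P1_P2 (param_map \<phi>)"
proof -
  have "\<forall>i. \<exists>P. form2 N P \<and> (\<forall>u w. \<phi> u w $ i = poly (poly P [:w:]) u)"
    using form unfolding binary_form_def by blast
  then obtain P where P: "\<And>i. form2 N (P i)" "\<And>i u w. \<phi> u w $ i = poly (poly (P i) [:w:]) u"
    by metis
  have eq: "(\<chi> i. eval2 ((\<chi> i. P i) $ i) v) = \<phi> (v $ 1) (v $ 2)" for v :: "'a^2"
    by (simp add: vec_eq_iff eval2_def P)
  have "form2 0 (1 :: 'a poly2)"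
    by (auto simp: form2_def one_pCons coeff_pCons split: nat.splits)
  moreover have "\<not> vanishes2 1 p" for p :: "'a P1" by (simp add: vanishes2_def eval2_def)
  moreover have "\<phi> (rep_proj q $ 1) (rep_proj q $ 2) \<noteq> 0" for q :: "'a P1"
    by (intro nonzero) (use rep_proj_nonzero[of q] vec2_nonzero_iff in blast)
  \<comment> \<open>The same three forms work on the whole line, so the principal open set is given
    by g = 1, a form of degree 0.\<close>
  ultimately show ?thesis
    unfolding morphism_P1_P2_def param_map_def
    by (intro allI exI[of _ N] exI[of _ 0] exI[of _ 1] exI[of _ "\<chi> i. P i"]) (simp only: eq, simp add: P)
qed

lemma birational: "birational_onto_image (param_map \<phi>)"
proof -
  define h :: "('a poly3)^2" where "h = vector [H1, H2]"
  have h: "h $ 1 = H1" "h $ 2 = H2" by (simp_all add: h_def)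
  define hv where "hv = (\<lambda>q :: 'a P2. (\<chi> i. eval3 (h$i) (rep_proj q)) :: 'a^2)"
  define U where "U = {q \<in> curve. hv q \<noteq> 0}"
  have inv: "abs_proj (hv (param_map \<phi> p)) = p" if "hv (param_map \<phi> p) \<noteq> 0" for p
  proof -
    define u w where "u = rep_proj p $ 1" and "w = rep_proj p $ 2"
    have nz: "u \<noteq> 0 \<or> w \<noteq> 0"
      using rep_proj_nonzero[of p] vec2_nonzero_iff unfolding u_def w_def by blast
    obtain c where c: "c \<noteq> 0" "rep_proj (param_map \<phi> p) = c *s \<phi> u w"
      using rep_abs_proj[OF nonzero[OF nz]] unfolding param_map_def u_def w_def by blast
    define x y where "x = eval3 H1 (rep_proj (param_map \<phi> p))"
      and "y = eval3 H2 (rep_proj (param_map \<phi> p))"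
    have xy: "x = c ^ e * eval3 H1 (\<phi> u w)" "y = c ^ e * eval3 H2 (\<phi> u w)"
      unfolding x_def y_def c(2) using form_H form3_scale by blast+
    have wx: "w * x = u * y" unfolding xy using inverse_H[of w u] by (simp add: mult.left_commute)
    have hv: "hv (param_map \<phi> p) = vector [x, y]"
      unfolding hv_def x_def y_def by (simp add: vec_eq_iff forall_2 h)
    \<comment> \<open>Since w x = u y with (u, w) nonzero, (x, y) is a multiple of (u, w); the
      factor is read off from a nonzero coordinate.\<close>
    obtain k where k: "vector [x, y] = k *s rep_proj p"
    proof (cases "w = 0")
      case True
      then have "vector [x, y] = (x / u) *s rep_proj p"
        using nz wx by (simp add: vec_eq_iff forall_2 u_def w_def)
      then show ?thesis using that by blast
    next
      case False
      then have "vector [x, y] = (y / w) *s rep_proj p"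
        using wx by (simp add: vec_eq_iff forall_2 u_def[symmetric] w_def[symmetric] field_simps)
      then show ?thesis using that by blast
    qed
    with that hv have "k \<noteq> 0" by auto
    then show ?thesis unfolding hv k by (simp add: abs_proj_scale abs_rep_proj)
  qed
  \<comment> \<open>The witness of \<open>H2_nonzero\<close> could be the origin, which is not a
    point of P^1; density provides a witness elsewhere.\<close>
  obtain u w where uw: "eval3 H2 (\<phi> u w) \<noteq> 0" "u \<noteq> 0 \<or> w \<noteq> 0"
  proof (cases "\<exists>u w. eval3 H2 (\<phi> u w) \<noteq> 0 \<and> (u \<noteq> 0 \<or> w \<noteq> 0)")
    case False
    have "eval3 H2 (\<phi> u w) = 0" for u w
    proof (rule polyfun_generic_eq_0[where I = "{()}" and f = "\<lambda>_ u w. u"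
          and g = "\<lambda>u w. eval3 H2 (\<phi> u w)"])
      show "polyfun (\<lambda>u w. eval3 H2 (\<phi> u w))" by (rule polyfun_param)
      show "\<exists>u w. (u::'a) \<noteq> 0" by (rule exI[of _ 1]) simp
    qed (use False in \<open>auto intro: polyfun_fst\<close>)
    with H2_nonzero show ?thesis by blast
  qed (use that in blast)
  have "abs_proj (\<phi> u w) \<in> U"
  proof -
    obtain c where c: "c \<noteq> 0" "rep_proj (abs_proj (\<phi> u w)) = c *s \<phi> u w"
      using rep_abs_proj[OF nonzero[OF uw(2)]] .
    have "hv (abs_proj (\<phi> u w)) $ 2 \<noteq> 0"
      unfolding hv_def using uw(1) c by (simp add: h form3_scale[OF form_H(2)])
    then show ?thesis unfolding U_def using abs_proj_in_curve[OF uw(2)] by auto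
  qed
  then have "U \<noteq> {}" by blast
  moreover have "\<forall>i. form3 e (h$i)" by (simp add: forall_2 h form_H)
  ultimately show ?thesis
    unfolding birational_onto_image_def Let_def
    by (intro exI[of _ e] exI[of _ h]) (use inv in \<open>auto simp: U_def hv_def\<close>)
qed

end

section \<open>Moebius-invariant pairs of forms, and the irreducible equation of the image
  curve\<close>

section \<open>The defining equation\<close>

text \<open>A quadruple \<open>(a, b, c, d)\<close> stands for the Moebius transformation \<open>(a t + b) / (c t + d)\<close>.\<close>

type_synonym 'a moebius = "'a \<times> 'a \<times> 'a \<times> 'a"

fun mob_num :: "'a::field moebius \<Rightarrow> 'a \<Rightarrow> 'a \<Rightarrow> 'a" where
  "mob_num (a, b, c, d) u w = a * u + b * w"

fun mob_den :: "'a::field moebius \<Rightarrow> 'a \<Rightarrow> 'a \<Rightarrow> 'a" where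
  "mob_den (a, b, c, d) u w = c * u + d * w"

fun mob_det :: "'a::field moebius \<Rightarrow> 'a" where
  "mob_det (a, b, c, d) = a * d - b * c"

text \<open>The coefficients of u^2, u w and w^2 in the cross-multiplied equation between two
  transformations; for nonzero determinants this is equality of the transformations, that is,
  proportionality of the matrices.\<close>

fun mob_eq :: "'a::field moebius \<Rightarrow> 'a moebius \<Rightarrow> bool" where
  "mob_eq (a, b, c, d) (a', b', c', d') \<longleftrightarrow>
    a * c' = a' * c \<and> a * d' + b * c' = a' * d + b' * c \<and> b * d' = b' * d"

lemma mob_eqI:
  assumes "\<And>u w. mob_num M u w * mob_den M' u w = mob_num M' u w * mob_den M u w"
  shows "mob_eq M M'"
proof -
  obtain a b c d a' b' c' d' where M: "M = (a, b, c, d)" "M' = (a', b', c', d')"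
    by (metis prod_cases4)
  show ?thesis
    using assms[of 1 0] assms[of 0 1] assms[of 1 1] by (simp add: M algebra_simps)
qed

lemma mob_eq_refl: "mob_eq M M"
  by (cases M) simp

lemma mob_eq_sym: "mob_eq M M' \<Longrightarrow> mob_eq M' M"
  by (cases M; cases M') (simp add: algebra_simps)

lemma binary_form_mob: "binary_form 1 (mob_num M)" "binary_form 1 (mob_den M)"
proof -
  obtain a b c d where "M = (a, b, c, d)" by (metis prod_cases4)
  then have "mob_num M = (\<lambda>u w. a * u + b * w)" "mob_den M = (\<lambda>u w. c * u + d * w)"
    by (auto simp: fun_eq_iff)
  then show "binary_form 1 (mob_num M)" "binary_form 1 (mob_den M)"
    using binary_form_add[OF binary_form_scale[OF binary_form_fst] binary_form_scale[OF binary_form_snd]]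
    by auto
qed

lemma polyfun_comp:
  assumes "polyfun f" "polyfun g" "polyfun h"
  shows "polyfun (\<lambda>u w. f (g u w) (h u w))"
proof -
  obtain P where "\<And>u w. f u w = poly (poly P [:w:]) u"
    using assms(1) unfolding polyfun_def by blast
  then show ?thesis using polyfun_poly2[OF assms(2,3)] by simp
qed

lemma mob_zero:
  assumes "mob_det M \<noteq> 0" "mob_num M u w = 0" "mob_den M u w = 0"
  shows "u = 0 \<and> w = 0"
proof -
  obtain a b c d where M: "M = (a, b, c, d)" by (metis prod_cases4)
  have e: "a * u + b * w = 0" "c * u + d * w = 0" using assms(2,3) by (simp_all add: M)
  have "(a * d - b * c) * u = d * (a * u + b * w) - b * (c * u + d * w)"
    "(a * d - b * c) * w = a * (c * u + d * w) - c * (a * u + b * w)"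
    by (simp_all add: algebra_simps)
  then show ?thesis using assms(1) unfolding e by (simp add: M)
qed

lemma mob_surj:
  assumes "mob_det M \<noteq> 0"
  obtains u w where "mob_num M u w = x" "mob_den M u w = y"
proof -
  obtain a b c d where M: "M = (a, b, c, d)" by (metis prod_cases4)
  have "mob_num M ((d * x - b * y) / (a * d - b * c)) ((a * y - c * x) / (a * d - b * c)) = x"
    "mob_den M ((d * x - b * y) / (a * d - b * c)) ((a * y - c * x) / (a * d - b * c)) = y"
    using assms by (simp_all add: M divide_simps) (simp_all add: algebra_simps)
  then show ?thesis using that by blast
qed

text \<open>The agreement of the coefficients of index n lowers the degree of the difference below
  n, so that n common values suffice instead of n + 1. The curve supplies exactly n
  conjugates.\<close>

lemma poly_eq_by_roots:
  fixes p q :: "'a::idom poly"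
  assumes "Polynomial.degree p \<le> n" "Polynomial.degree q \<le> n"
    "Polynomial.coeff p n = Polynomial.coeff q n" "finite S" "n \<le> card S"
    "\<And>x. x \<in> S \<Longrightarrow> poly p x = poly q x"
  shows "p = q"
proof (rule ccontr)
  assume "p \<noteq> q"
  define r where "r = p - q"
  have r: "r \<noteq> 0" "Polynomial.coeff r n = 0" "Polynomial.degree r \<le> n"
    using \<open>p \<noteq> q\<close> assms(1-3) degree_diff_le[of p n q] unfolding r_def by auto
  then have "Polynomial.degree r < n" by (metis le_neq_implies_less leading_coeff_0_iff)
  moreover have "card S \<le> card {x. poly r x = 0}"
    using assms(6) r(1) by (intro card_mono poly_roots_finite) (auto simp: r_def)
  ultimately show False using card_poly_roots_bound[OF r(1)] assms(5) by linarith
qed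

text \<open>The factor \<rho> is common to U and V, so U/V is an invariant function of degree n. The
  list consists of n pairwise different transformations; that they exhaust the automorphism group,
  and so form a group up to scalars, comes out in \<open>Gal_eq\<close>.\<close>

locale moebius_invariant =
  fixes n :: nat and U V :: "'a::alg_closed_field \<Rightarrow> 'a \<Rightarrow> 'a" and Ms :: "'a moebius list"
  assumes n_pos: "n > 0" and length_Ms: "length Ms = n"
    and form_U: "binary_form n U" and form_V: "binary_form n V"
    and no_common_zero: "\<And>u w. U u w = 0 \<Longrightarrow> V u w = 0 \<Longrightarrow> u = 0 \<and> w = 0"
    and det_nonzero: "\<And>M. M \<in> set Ms \<Longrightarrow> mob_det M \<noteq> 0"
    and invariant: "\<And>M. M \<in> set Ms \<Longrightarrow> \<exists>\<rho>. \<forall>u w.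
      U (mob_num M u w) (mob_den M u w) = \<rho> * U u w \<and>
      V (mob_num M u w) (mob_den M u w) = \<rho> * V u w"
    and not_mob_eq: "sorted_wrt (\<lambda>M M'. \<not> mob_eq M M') Ms"
begin

lemma nth_not_mob_eq:
  assumes "i < n" "j < n" "i \<noteq> j"
  shows "\<not> mob_eq (Ms ! i) (Ms ! j)"
proof (cases "i < j")
  case True
  then show ?thesis using sorted_wrt_nth_less[OF not_mob_eq] assms length_Ms by simp
next
  case False
  then have "\<not> mob_eq (Ms ! j) (Ms ! i)"
    using sorted_wrt_nth_less[OF not_mob_eq, of j i] assms length_Ms by simp
  then show ?thesis using mob_eq_sym by blast
qed

lemma distinct_Ms: "distinct Ms"
  unfolding distinct_conv_nth
proof (intro allI impI notI)
  fix i j assume "i < length Ms" "j < length Ms" "i \<noteq> j" "Ms ! i = Ms ! j"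
  then show False using nth_not_mob_eq[of i j] mob_eq_refl[of "Ms ! j"] length_Ms by simp
qed

lemma card_Ms: "card (set Ms) = n"
  using distinct_card[OF distinct_Ms] length_Ms by simp

lemma not_mob_eq':
  assumes "M \<in> set Ms" "M' \<in> set Ms" "M \<noteq> M'"
  shows "\<not> mob_eq M M'"
proof -
  obtain i j where "i < n" "j < n" "M = Ms ! i" "M' = Ms ! j"
    using assms(1,2) length_Ms by (auto simp: in_set_conv_nth)
  moreover from this assms(3) have "i \<noteq> j" by blast
  ultimately show ?thesis using nth_not_mob_eq by simp
qed

lemma invariant_factor_nonzero:
  assumes "M \<in> set Ms" "\<And>u w. U (mob_num M u w) (mob_den M u w) = \<rho> * U u w \<and>
      V (mob_num M u w) (mob_den M u w) = \<rho> * V u w"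
  shows "\<rho> \<noteq> 0"
proof
  assume "\<rho> = 0"
  then have "mob_num M 1 0 = 0 \<and> mob_den M 1 0 = 0" using assms(2)[of 1 0] no_common_zero[of "mob_num M 1 0" "mob_den M 1 0"] by simp
  then show False using mob_zero[OF det_nonzero[OF assms(1)], of 1 0] by simp
qed

lemma UV_0: "U 0 0 = 0" "V 0 0 = 0"
  using binary_form_homogeneous[OF form_U, of 0 0 0] binary_form_homogeneous[OF form_V, of 0 0 0] n_pos
  by (simp_all add: zero_power)

text \<open>A nontrivial zero of z U - x V makes (U, V) a nonzero multiple of (x, z), because U and
  V do not vanish together. Scaling (u, w) by an n-th root turns proportionality into
  equality.\<close>

lemma UV_surj: "\<exists>u w. U u w = x \<and> V u w = z"
proof (cases "x = 0 \<and> z = 0")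
  case True
  then show ?thesis using UV_0 by blast
next
  case False
  have "binary_form n (\<lambda>u w. z * U u w - x * V u w)"
    by (intro binary_form_diff binary_form_scale form_U form_V)
  then obtain u w where uw: "u \<noteq> 0 \<or> w \<noteq> 0" "z * U u w - x * V u w = 0"
    using binary_form_nontrivial_zero[OF _ n_pos] by blast
  then have uw: "u \<noteq> 0 \<or> w \<noteq> 0" "z * U u w = x * V u w" by simp_all
  then have "U u w \<noteq> 0 \<or> V u w \<noteq> 0" using no_common_zero by blast
  with False uw(2) obtain \<mu> where \<mu>: "\<mu> \<noteq> 0" "U u w = \<mu> * x" "V u w = \<mu> * z"
  proof (cases "x = 0")
    case True
    then show ?thesis using False uw \<open>U u w \<noteq> 0 \<or> V u w \<noteq> 0\<close> that[of "V u w / z"] by auto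
  next
    case x: False
    have "U u w \<noteq> 0" using x uw(2) \<open>U u w \<noteq> 0 \<or> V u w \<noteq> 0\<close> by auto
    then show ?thesis using x uw that[of "U u w / x"] by (auto simp: field_simps)
  qed
  obtain c where c: "c ^ n = 1 / \<mu>" using nth_root_exists[OF n_pos] by blast
  then have "U (c * u) (c * w) = x \<and> V (c * u) (c * w) = z"
    using \<mu> by (simp add: binary_form_homogeneous[OF form_U] binary_form_homogeneous[OF form_V])
  then show ?thesis by blast
qed

text \<open>Rescaling by an \<open>n\<close>-th root makes \<open>U\<close> and \<open>V\<close> strictly invariant.\<close>

lemma normalized:
  "\<exists>c. \<forall>M\<in>set Ms. c M \<noteq> 0 \<and> (\<forall>u w.
    U (c M * mob_num M u w) (c M * mob_den M u w) = U u w \<and>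
    V (c M * mob_num M u w) (c M * mob_den M u w) = V u w)"
proof -
  have "\<exists>c. c \<noteq> 0 \<and> (\<forall>u w.
    U (c * mob_num M u w) (c * mob_den M u w) = U u w \<and>
    V (c * mob_num M u w) (c * mob_den M u w) = V u w)" if "M \<in> set Ms" for M
  proof -
    obtain \<rho> where \<rho>: "\<And>u w. U (mob_num M u w) (mob_den M u w) = \<rho> * U u w \<and>
      V (mob_num M u w) (mob_den M u w) = \<rho> * V u w" using invariant[OF \<open>M \<in> set Ms\<close>] by blast
    have "\<rho> \<noteq> 0" using invariant_factor_nonzero[OF that] \<rho> by blast
    obtain c where c: "c ^ n = 1 / \<rho>" using nth_root_exists[OF n_pos] by blast
    have "c ^ n \<noteq> 0" unfolding c using \<open>\<rho> \<noteq> 0\<close> by simp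
    with n_pos have "c \<noteq> 0" by auto
    moreover have "U (c * mob_num M u w) (c * mob_den M u w) = U u w"
      "V (c * mob_num M u w) (c * mob_den M u w) = V u w" for u w
      unfolding binary_form_homogeneous[OF form_U] binary_form_homogeneous[OF form_V] c
      using \<rho>[of u w] \<open>\<rho> \<noteq> 0\<close> by simp_all
    ultimately show ?thesis by blast
  qed
  then show ?thesis by (intro bchoice ballI)
qed

end

text \<open>The condition on U says that its zeros are the orbit of the zero of l. The leading
  coefficient of F in x_3 is \<open>c\<^sub>0\<close> x_1; together with the total degree n + 1 this
  reflects that projection from (0:0:1) has degree n, one less than the curve. The last assumption
  keeps the line x_1 = 0 from being a component of F = 0.\<close>

locale galois_curve =
  moebius_invariant n U V Ms +
  plane_param "\<lambda>u w. vector [U u w * l u w, V u w * l u w, m u w]" "Suc n" H1 H2 e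
  for n :: nat and U V l m :: "'a::alg_closed_field \<Rightarrow> 'a \<Rightarrow> 'a" and Ms H1 H2 e +
  fixes F :: "'a poly3" and \<kappa> c\<^sub>0 :: 'a
  assumes form_l: "binary_form 1 l"
    and U_prod: "\<And>u w. U u w = \<kappa> * (\<Prod>M\<leftarrow>Ms. l (mob_num M u w) (mob_den M u w))"
    and form_F: "form3 (Suc n) F" and degree_F: "Polynomial.degree F = n"
    and lead_F: "Polynomial.coeff F n = [:[:0, c\<^sub>0:]:]"
    and F_param: "\<And>u w. eval3 F (vector [U u w * l u w, V u w * l u w, m u w]) = 0"
    and F_nonzero: "\<exists>y z. eval3 F (vector [0, z, y]) \<noteq> 0"
begin

definition cf where "cf = (SOME c. \<forall>M\<in>set Ms. c M \<noteq> 0 \<and> (\<forall>u w.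
    U (c M * mob_num M u w) (c M * mob_den M u w) = U u w \<and>
    V (c M * mob_num M u w) (c M * mob_den M u w) = V u w))"

definition t\<^sub>1 where "t\<^sub>1 M u w = cf M * mob_num M u w"
definition t\<^sub>2 where "t\<^sub>2 M u w = cf M * mob_den M u w"
text \<open>With (\<open>t\<^sub>1\<close>, \<open>t\<^sub>2\<close>) the normalized coordinates of
  M(t), the point of the curve at M(t) is (U L : V L : Y). Its first two coordinates have the same
  ratio for all M, so the values Y/L are the third coordinates of the n points in one fibre of the
  projection.\<close>

definition L where "L M u w = l (t\<^sub>1 M u w) (t\<^sub>2 M u w)"
definition Y where "Y M u w = m (t\<^sub>1 M u w) (t\<^sub>2 M u w)"

lemma cf_nonzero: "M \<in> set Ms \<Longrightarrow> cf M \<noteq> 0"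
  and UV_t: "M \<in> set Ms \<Longrightarrow> U (t\<^sub>1 M u w) (t\<^sub>2 M u w) = U u w" "M \<in> set Ms \<Longrightarrow> V (t\<^sub>1 M u w) (t\<^sub>2 M u w) = V u w"
proof -
  have "\<forall>M\<in>set Ms. cf M \<noteq> 0 \<and> (\<forall>u w.
    U (cf M * mob_num M u w) (cf M * mob_den M u w) = U u w \<and>
    V (cf M * mob_num M u w) (cf M * mob_den M u w) = V u w)"
    unfolding cf_def by (rule someI_ex[OF normalized])
  then show "M \<in> set Ms \<Longrightarrow> cf M \<noteq> 0"
    "M \<in> set Ms \<Longrightarrow> U (t\<^sub>1 M u w) (t\<^sub>2 M u w) = U u w" "M \<in> set Ms \<Longrightarrow> V (t\<^sub>1 M u w) (t\<^sub>2 M u w) = V u w"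
    unfolding t\<^sub>1_def t\<^sub>2_def by simp_all
qed

lemma polyfuns:
  "polyfun U" "polyfun V" "polyfun l" "polyfun m" "polyfun (t\<^sub>1 M)" "polyfun (t\<^sub>2 M)" "polyfun (L M)" "polyfun (Y M)"
proof -
  show "polyfun U" "polyfun V" "polyfun l"
    using binary_form_polyfun form_U form_V form_l by blast+
  show m: "polyfun m" using binary_form_polyfun[OF form[of 3]] by simp
  have "polyfun (mob_num M)" "polyfun (mob_den M)"
    by (rule binary_form_polyfun[OF binary_form_mob(1)] binary_form_polyfun[OF binary_form_mob(2)])+
  from polyfun_mult[OF polyfun_const this(1)] polyfun_mult[OF polyfun_const this(2)]
  show t: "polyfun (t\<^sub>1 M)" "polyfun (t\<^sub>2 M)" unfolding t\<^sub>1_def[abs_def] t\<^sub>2_def[abs_def] .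
  have "L M = (\<lambda>u w. l (t\<^sub>1 M u w) (t\<^sub>2 M u w))" "Y M = (\<lambda>u w. m (t\<^sub>1 M u w) (t\<^sub>2 M u w))"
    by (simp_all add: fun_eq_iff L_def Y_def)
  then show "polyfun (L M)" "polyfun (Y M)"
    using polyfun_comp[OF \<open>polyfun l\<close> t] polyfun_comp[OF m t] by simp_all
qed

lemma param_t:
  assumes "M \<in> set Ms"
  shows "vector [U (t\<^sub>1 M u w) (t\<^sub>2 M u w) * l (t\<^sub>1 M u w) (t\<^sub>2 M u w),
      V (t\<^sub>1 M u w) (t\<^sub>2 M u w) * l (t\<^sub>1 M u w) (t\<^sub>2 M u w), m (t\<^sub>1 M u w) (t\<^sub>2 M u w)]
    = (vector [U u w * L M u w, V u w * L M u w, Y M u w] :: 'a^3)"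
  using UV_t[OF assms] by (simp add: L_def Y_def)

lemma t_surj:
  assumes "M \<in> set Ms"
  obtains u w where "t\<^sub>1 M u w = x" "t\<^sub>2 M u w = y"
proof -
  obtain u w where "mob_num M u w = x / cf M" "mob_den M u w = y / cf M"
    using mob_surj[OF det_nonzero[OF assms]] .
  then have "t\<^sub>1 M u w = x" "t\<^sub>2 M u w = y" using cf_nonzero[OF assms] by (simp_all add: t\<^sub>1_def t\<^sub>2_def)
  then show ?thesis using that by blast
qed

lemma t_nonzero:
  assumes "M \<in> set Ms" "u \<noteq> 0 \<or> w \<noteq> 0"
  shows "t\<^sub>1 M u w \<noteq> 0 \<or> t\<^sub>2 M u w \<noteq> 0"
  using mob_zero[OF det_nonzero[OF assms(1)], of u w] assms(2) cf_nonzero[OF assms(1)]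
  unfolding t\<^sub>1_def t\<^sub>2_def by auto

lemma U_nonzero: "\<exists>u w. U u w \<noteq> 0"
proof -
  obtain u w where "U u w = 1" using UV_surj[of 1 1] by blast
  then have "U u w \<noteq> 0" by simp
  then show ?thesis by blast
qed

lemma U_prod_L: "\<exists>k. k \<noteq> 0 \<and> (\<forall>u w. U u w = k * (\<Prod>M\<in>set Ms. L M u w))"
proof -
  have L: "L M u w = cf M * l (mob_num M u w) (mob_den M u w)" for M u w
    unfolding L_def t\<^sub>1_def t\<^sub>2_def binary_form_homogeneous[OF form_l] by simp
  define k where "k = \<kappa> / (\<Prod>M\<in>set Ms. cf M)"
  have nz: "(\<Prod>M\<in>set Ms. cf M) \<noteq> 0" using cf_nonzero by simp
  have "U u w = k * (\<Prod>M\<in>set Ms. L M u w)" for u w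
    unfolding U_prod[of u w] L prod.distrib k_def prod.distinct_set_conv_list[OF distinct_Ms, symmetric]
    using nz by simp
  moreover from this U_nonzero have "k \<noteq> 0" by auto
  ultimately show ?thesis by blast
qed

lemma L_nonzero:
  assumes "M \<in> set Ms"
  shows "\<exists>u w. L M u w \<noteq> 0"
proof (rule ccontr)
  assume "\<not> ?thesis"
  then have "(\<Prod>M\<in>set Ms. L M u w) = 0" for u w using assms by (intro prod_zero) auto
  then show False using U_prod_L U_nonzero by auto
qed

text \<open>Otherwise the points of the curve at M(t) and M'(t) would coincide for general t. The
  inverse (H1 : H2) would then give M(t) = M'(t), against the pairwise inequivalence of the list.
  This is where birationality enters the degree computation.\<close>

lemma YL_distinct:
  assumes "M \<in> set Ms" "M' \<in> set Ms" "M \<noteq> M'"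
  shows "\<exists>u w. Y M u w * L M' u w - Y M' u w * L M u w \<noteq> 0"
proof (rule ccontr)
  assume "\<not> ?thesis"
  then have eq: "Y M u w * L M' u w = Y M' u w * L M u w" for u w by simp
  define P where "P M u w = (vector [U u w * L M u w, V u w * L M u w, Y M u w] :: 'a^3)" for M u w
  have P: "L M' u w *s P M u w = L M u w *s P M' u w" for u w
    unfolding P_def using eq[of u w] by (simp add: vec_eq_iff forall_3 algebra_simps)
  have inv: "t\<^sub>2 M u w * eval3 H1 (P M u w) = t\<^sub>1 M u w * eval3 H2 (P M u w)" if "M \<in> set Ms" for M u w
    using inverse_H[of "t\<^sub>2 M u w" "t\<^sub>1 M u w"] unfolding param_t[OF that] P_def .
  have h2: "\<exists>u w. eval3 H2 (P M u w) \<noteq> 0" if M: "M \<in> set Ms" for M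
  proof -
    from H2_nonzero obtain x y where
      "eval3 H2 (vector [U x y * l x y, V x y * l x y, m x y]) \<noteq> 0" by blast
    moreover obtain u w where "t\<^sub>1 M u w = x" "t\<^sub>2 M u w = y" using t_surj[OF M] .
    ultimately have "eval3 H2 (P M u w) \<noteq> 0" unfolding P_def using param_t[OF M, of u w] by simp
    then show ?thesis by blast
  qed
  have pf: "polyfun (\<lambda>u w. eval3 H2 (P M u w))" for M
  proof (rule polyfun_eval3)
    show "polyfun (\<lambda>u w. P M u w $ i)" for i
      using exhaust_3[of i] polyfuns(1,2) polyfuns(7,8)[of M] unfolding P_def by (auto intro: polyfun_mult)
  qed
  \<comment> \<open>Where these do not vanish, the two coordinate vectors are nonzero multiples of
    each other and the inverse map is defined at both.\<close>
  define I where "I = {L M, L M', (\<lambda>u w. eval3 H2 (P M u w)), (\<lambda>u w. eval3 H2 (P M' u w))}"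
  define D where "D u w = t\<^sub>1 M u w * t\<^sub>2 M' u w - t\<^sub>1 M' u w * t\<^sub>2 M u w" for u w
  have "D u w = 0" for u w
  proof (rule polyfun_generic_eq_0[where I = I and f = "\<lambda>i. i" and g = D])
    show "finite I" by (simp add: I_def)
    show "polyfun f" if "f \<in> I" for f using that polyfuns(7) pf unfolding I_def by blast
    show "\<exists>u w. f u w \<noteq> 0" if "f \<in> I" for f
      using that L_nonzero[OF assms(1)] L_nonzero[OF assms(2)] h2[OF assms(1)] h2[OF assms(2)]
      unfolding I_def by blast
    show "polyfun D" unfolding D_def[abs_def] by (intro polyfun_diff polyfun_mult polyfuns)
    show "D u w = 0" if "\<And>i. i \<in> I \<Longrightarrow> i u w \<noteq> 0" for u w
    proof -
      define a b a' b' where "a = eval3 H1 (P M u w)" and "b = eval3 H2 (P M u w)"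
        and "a' = eval3 H1 (P M' u w)" and "b' = eval3 H2 (P M' u w)"
      have nz: "L M u w \<noteq> 0" "L M' u w \<noteq> 0" "b \<noteq> 0" "b' \<noteq> 0"
        using that unfolding I_def b_def b'_def by auto
      have sc: "L M' u w ^ e * a = L M u w ^ e * a'" "L M' u w ^ e * b = L M u w ^ e * b'"
        using P[of u w] form3_scale[OF form_H(1)] form3_scale[OF form_H(2)]
        unfolding a_def b_def a'_def b'_def by metis+
      have i1: "t\<^sub>2 M u w * a = t\<^sub>1 M u w * b" and i2: "t\<^sub>2 M' u w * a' = t\<^sub>1 M' u w * b'"
        using inv assms unfolding a_def b_def a'_def b'_def by auto
      have "L M' u w ^ e * (a * b') = L M u w ^ e * (a' * b')" using sc(1) by (simp add: mult.assoc[symmetric])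
      also have "\<dots> = L M' u w ^ e * (a' * b)" using sc(2) by (simp add: mult.left_commute mult.commute)
      finally have ab: "a * b' = a' * b" using nz by simp
      have "(b * b') * D u w = (t\<^sub>1 M u w * b) * (t\<^sub>2 M' u w * b') - (t\<^sub>1 M' u w * b') * (t\<^sub>2 M u w * b)"
        unfolding D_def by (simp add: algebra_simps)
      also have "\<dots> = t\<^sub>2 M u w * t\<^sub>2 M' u w * (a * b' - a' * b)"
        unfolding i1[symmetric] i2[symmetric] by (simp add: algebra_simps)
      finally show ?thesis using ab nz by simp
    qed
  qed
  then have "cf M * cf M' * (mob_num M u w * mob_den M' u w - mob_num M' u w * mob_den M u w) = 0" for u w
    unfolding D_def t\<^sub>1_def t\<^sub>2_def by (simp add: algebra_simps)
  then have "mob_num M u w * mob_den M' u w = mob_num M' u w * mob_den M u w" for u w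
    using cf_nonzero[OF assms(1)] cf_nonzero[OF assms(2)] by simp
  then show False using mob_eqI not_mob_eq' assms by blast
qed

text \<open>Density for the open set on which all n points of the fibre have finite and distinct
  third coordinates Y/L.\<close>

lemma generic_eq_0:
  assumes "polyfun g" "\<And>u w. (\<And>M. M \<in> set Ms \<Longrightarrow> L M u w \<noteq> 0) \<Longrightarrow>
      inj_on (\<lambda>M. Y M u w / L M u w) (set Ms) \<Longrightarrow> g u w = 0"
  shows "g u w = 0"
proof -
  define D where "D M M' u w = Y M u w * L M' u w - Y M' u w * L M u w" for M M' u w
  define I where "I = L ` set Ms \<union> (\<Union>M\<in>set Ms. D M ` (set Ms - {M}))"
  show ?thesis
  proof (rule polyfun_generic_eq_0[where I = I and f = "\<lambda>i. i" and g = g])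
    show "finite I" unfolding I_def by simp
    have "polyfun (D M M')" for M M'
      unfolding D_def[abs_def] by (intro polyfun_diff polyfun_mult polyfuns)
    then show "polyfun f" if "f \<in> I" for f using that polyfuns(7) unfolding I_def by blast
    have "\<exists>u w. D M M' u w \<noteq> 0" if "M \<in> set Ms" "M' \<in> set Ms - {M}" for M M'
      using YL_distinct[of M M'] that unfolding D_def by blast
    then show "\<exists>u w. f u w \<noteq> 0" if "f \<in> I" for f using that L_nonzero unfolding I_def by blast
    show "g u w = 0" if nz: "\<And>i. i \<in> I \<Longrightarrow> i u w \<noteq> 0" for u w
    proof (rule assms(2))
      show L: "L M u w \<noteq> 0" if "M \<in> set Ms" for M using nz that unfolding I_def by blast
      show "inj_on (\<lambda>M. Y M u w / L M u w) (set Ms)"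
      proof (rule inj_onI, rule ccontr)
        fix M M' assume M: "M \<in> set Ms" "M' \<in> set Ms" "Y M u w / L M u w = Y M' u w / L M' u w" "M \<noteq> M'"
        then have "D M M' \<in> I" unfolding I_def by blast
        from nz[OF this] M(3) L[OF M(1)] L[OF M(2)] show False by (simp add: D_def field_simps)
      qed
    qed
  qed (use assms in auto)
qed

lemma F_root: "M \<in> set Ms \<Longrightarrow> eval3 F (vector [U u w * L M u w, V u w * L M u w, Y M u w]) = 0"
  using F_param[of "t\<^sub>1 M u w" "t\<^sub>2 M u w"] param_t by metis

lemma eval3_last_sum:
  "eval3 G (vector [x, z, y]) = (\<Sum>i\<le>Polynomial.degree G. poly (poly (Polynomial.coeff G i) [:z:]) x * y ^ i)"
  by (simp add: eval3_def poly_three_pow)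

lemma eval3_last_poly:
  "eval3 G (vector [x, z, y])
    = poly (\<Sum>i\<le>Polynomial.degree G. Polynomial.monom (poly (poly (Polynomial.coeff G i) [:z:]) x) i) y"
  by (simp add: eval3_last_sum poly_sum poly_monom)

text \<open>For fixed general (u, w) both sides are polynomials of degree at most n in y. F vanishes
  at (U L, V L, Y) for each M, hence by homogeneity at (U, V, Y/L), which gives n distinct common
  roots. The coefficients of y^n are \<open>c\<^sub>0\<close> U on the left and, by the
  factorization of U over the orbit, the same on the right.\<close>

lemma F_prod:
  "\<exists>k. k \<noteq> 0 \<and> (\<forall>u w y. eval3 F (vector [U u w, V u w, y]) = k * (\<Prod>M\<in>set Ms. L M u w * y - Y M u w))"
proof -
  obtain k where k: "k \<noteq> 0" "\<And>u w. U u w = k * (\<Prod>M\<in>set Ms. L M u w)" using U_prod_L by blast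
  have c0: "c\<^sub>0 \<noteq> 0" using degree_F lead_F n_pos by (metis degree_0 leading_coeff_0_iff pCons_0_0 less_irrefl)
  have "eval3 F (vector [U u w, V u w, y]) - c\<^sub>0 * k * (\<Prod>M\<in>set Ms. L M u w * y - Y M u w) = 0" for u w y
  proof (rule generic_eq_0[where g = "\<lambda>u w. eval3 F (vector [U u w, V u w, y])
      - c\<^sub>0 * k * (\<Prod>M\<in>set Ms. L M u w * y - Y M u w)"])
    have "polyfun (\<lambda>u w. vector [U u w, V u w, y] $ i)" for i :: 3
      using exhaust_3[of i] polyfuns polyfun_const by auto
    then show "polyfun (\<lambda>u w. eval3 F (vector [U u w, V u w, y])
      - c\<^sub>0 * k * (\<Prod>M\<in>set Ms. L M u w * y - Y M u w))"
      by (intro polyfun_diff polyfun_mult polyfun_const polyfun_prod polyfun_eval3 polyfuns)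
  next
    fix u w
    assume L: "\<And>M. M \<in> set Ms \<Longrightarrow> L M u w \<noteq> 0" and inj: "inj_on (\<lambda>M. Y M u w / L M u w) (set Ms)"
    define p where "p = (\<Sum>i\<le>n. Polynomial.monom (poly (poly (Polynomial.coeff F i) [:V u w:]) (U u w)) i)"
    define q where "q = Polynomial.smult (c\<^sub>0 * k) (\<Prod>M\<in>set Ms. [:- Y M u w, L M u w:])"
    have deg: "Polynomial.degree (\<Prod>M\<in>set Ms. [:- Y M u w, L M u w:]) = n"
    proof -
      have "Polynomial.degree (\<Prod>M\<in>set Ms. [:- Y M u w, L M u w:])
          = (\<Sum>M\<in>set Ms. Polynomial.degree [:- Y M u w, L M u w:])"
        by (rule degree_prod_sum_eq) (use L in simp)
      also have "\<dots> = (\<Sum>M\<in>set Ms. 1)" by (rule sum.cong) (use L in simp_all)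
      finally show ?thesis using card_Ms by simp
    qed
    have cp: "Polynomial.coeff p j = (if j \<le> n then poly (poly (Polynomial.coeff F j) [:V u w:]) (U u w) else 0)" for j
      unfolding p_def by (simp add: coeff_sum if_distrib cong: if_cong)
    have "p = q"
    proof (rule poly_eq_by_roots[where n = n and S = "(\<lambda>M. Y M u w / L M u w) ` set Ms"])
      show "Polynomial.degree p \<le> n" by (rule degree_le) (simp add: cp)
      show "Polynomial.degree q \<le> n" unfolding q_def
        using degree_smult_le[of "c\<^sub>0 * k" "\<Prod>M\<in>set Ms. [:- Y M u w, L M u w:]"] deg by simp
      have "Polynomial.lead_coeff (\<Prod>M\<in>set Ms. [:- Y M u w, L M u w:]) = (\<Prod>M\<in>set Ms. L M u w)"
        unfolding lead_coeff_prod by (rule prod.cong) (use L in simp_all)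
      then have lead: "Polynomial.coeff (\<Prod>M\<in>set Ms. [:- Y M u w, L M u w:]) n = (\<Prod>M\<in>set Ms. L M u w)"
        unfolding deg .
      have "Polynomial.coeff q n = c\<^sub>0 * U u w" unfolding q_def coeff_smult lead k(2)[of u w] by (rule mult.assoc)
      moreover have "Polynomial.coeff p n = c\<^sub>0 * U u w"
        by (simp add: cp lead_F)
      ultimately show "Polynomial.coeff p n = Polynomial.coeff q n" by simp
      show "n \<le> card ((\<lambda>M. Y M u w / L M u w) ` set Ms)" using inj by (simp add: card_image card_Ms)
      fix x assume "x \<in> (\<lambda>M. Y M u w / L M u w) ` set Ms"
      then obtain M where M: "M \<in> set Ms" "x = Y M u w / L M u w" by blast
      have v: "L M u w *s vector [U u w, V u w, x] = (vector [U u w * L M u w, V u w * L M u w, Y M u w] :: 'a^3)"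
        using L[OF M(1)] M(2) by (simp add: vec_eq_iff forall_3)
      have "L M u w ^ Suc n * eval3 F (vector [U u w, V u w, x]) = 0"
        unfolding form3_scale[OF form_F, symmetric] v by (rule F_root[OF M(1)])
      then have "eval3 F (vector [U u w, V u w, x]) = 0" using L[OF M(1)] by simp
      then have "poly p x = 0" unfolding p_def eval3_last_poly degree_F .
      moreover have "(\<Prod>M\<in>set Ms. poly [:- Y M u w, L M u w:] x) = 0"
        by (rule prod_zero[OF List.finite_set bexI[OF _ M(1)]]) (use M(2) L[OF M(1)] in simp)
      then have "poly q x = 0" unfolding q_def poly_smult poly_prod by simp
      ultimately show "poly p x = poly q x" by simp
    qed simp
    have "poly p y = eval3 F (vector [U u w, V u w, y])" unfolding p_def eval3_last_poly degree_F ..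
    moreover have "poly q y = c\<^sub>0 * k * (\<Prod>M\<in>set Ms. L M u w * y - Y M u w)"
      unfolding q_def by (simp add: poly_prod mult.commute)
    ultimately show "eval3 F (vector [U u w, V u w, y]) - c\<^sub>0 * k * (\<Prod>M\<in>set Ms. L M u w * y - Y M u w) = 0"
      using \<open>p = q\<close> by simp
  qed
  then show ?thesis using c0 k(1) by (intro exI[of _ "c\<^sub>0 * k"]) simp
qed

text \<open>If x and z are not both zero, \<open>UV_surj\<close> gives a parameter with (U, V) = (x,
  z), and \<open>F_prod\<close> forces L y = Y for some M, so the point is the image of M(t). The
  remaining point (0:0:1) is the image of the zero of l.\<close>

lemma zero_set: "curve = {q. vanishes3 F q}"
proof (rule Set.set_eqI, rule iffI)
  fix q assume "q \<in> curve"
  then show "q \<in> {q. vanishes3 F q}" using vanishes3_on_curve_iff[OF form_F] F_param by blast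
next
  fix q :: "'a P2" assume "q \<in> {q. vanishes3 F q}"
  then have "vanishes3 F q" by simp
  define x z y where "x = rep_proj q $ 1" and "z = rep_proj q $ 2" and "y = rep_proj q $ 3"
  have r: "rep_proj q = vector [x, z, y]" by (simp add: vec_eq_iff forall_3 x_def y_def z_def)
  have nz: "vector [x, z, y] \<noteq> (0 :: 'a^3)" using r rep_proj_nonzero[of q] by simp
  have q: "q = abs_proj (vector [x, z, y])" using r abs_rep_proj[of q] by simp
  have F0: "eval3 F (vector [x, z, y]) = 0" using \<open>vanishes3 F q\<close> r by (simp add: vanishes3_def)
  show "q \<in> curve"
  proof (cases "x = 0 \<and> z = 0")
    case True
    then have y: "y \<noteq> 0" using nz by (simp add: vec3_nonzero_iff)
    obtain u w where uw: "u \<noteq> 0 \<or> w \<noteq> 0" "l u w = 0"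
      using binary_form_nontrivial_zero[OF form_l] by auto
    have "vector [U u w * l u w, V u w * l u w, m u w] = (m u w / y) *s (vector [x, z, y] :: 'a^3)"
      using True y uw by (simp add: vec_eq_iff forall_3)
    with nonzero[OF uw(1)] have eq: "abs_proj (vector [U u w * l u w, V u w * l u w, m u w]) = q"
      unfolding q using nz by (metis abs_proj_scale vector_smult_lzero)
    then show ?thesis using abs_proj_in_curve[OF uw(1)] by simp
  next
    case False
    obtain u w where uw: "U u w = x" "V u w = z" using UV_surj by blast
    have nuw: "u \<noteq> 0 \<or> w \<noteq> 0" using False uw UV_0 by auto
    obtain k where k: "k \<noteq> 0" "\<And>u w y. eval3 F (vector [U u w, V u w, y]) = k * (\<Prod>M\<in>set Ms. L M u w * y - Y M u w)"
      using F_prod by blast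
    have "k * (\<Prod>M\<in>set Ms. L M u w * y - Y M u w) = 0" using F0 k(2)[of u w y] uw by simp
    then have "\<exists>M\<in>set Ms. L M u w * y - Y M u w = 0" using k(1) prod_zero_iff[of "set Ms"] by simp
    then obtain M where M: "M \<in> set Ms" "Y M u w = L M u w * y" by force
    define u' w' where "u' = t\<^sub>1 M u w" and "w' = t\<^sub>2 M u w"
    have nz': "u' \<noteq> 0 \<or> w' \<noteq> 0" using t_nonzero[OF M(1) nuw] unfolding u'_def w'_def .
    have eq: "vector [U u' w' * l u' w', V u' w' * l u' w', m u' w'] = L M u w *s (vector [x, z, y] :: 'a^3)"
      unfolding u'_def w'_def param_t[OF M(1)] using M(2) uw by (simp add: vec_eq_iff forall_3)
    with nonzero[OF nz'] have "L M u w \<noteq> 0" by auto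
    then have "abs_proj (vector [U u' w' * l u' w', V u' w' * l u' w', m u' w']) = q"
      unfolding eq q using nz by (simp add: abs_proj_scale)
    then show ?thesis using abs_proj_in_curve[OF nz'] by simp
  qed
qed

text \<open>This is l^deg G times G(U, V, m/l), with the denominators cleared. A factor of F is not
  known to be a form, so its values at (U l, V l, m) and at (U, V, m/l) need not be related; the
  second representative is the useful one because U and V do not change under the normalized
  transformations.\<close>

definition homog where
  "homog G u w = (\<Sum>i\<le>Polynomial.degree G. poly (poly (Polynomial.coeff G i) [:V u w:]) (U u w)
    * m u w ^ i * l u w ^ (Polynomial.degree G - i))"

lemma polyfun_homog: "polyfun (homog G)"
  unfolding homog_def[abs_def] by (intro polyfun_sum polyfun_mult polyfun_power polyfun_poly2 polyfuns)

lemma homog_eq: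
  assumes "l u w \<noteq> 0"
  shows "homog G u w = l u w ^ Polynomial.degree G * eval3 G (vector [U u w, V u w, m u w / l u w])"
  unfolding homog_def eval3_last_sum sum_distrib_left
proof (rule sum.cong)
  fix i assume "i \<in> {..Polynomial.degree G}"
  then have "l u w ^ Polynomial.degree G = l u w ^ (Polynomial.degree G - i) * l u w ^ i"
    by (simp add: power_add[symmetric])
  then show "poly (poly (Polynomial.coeff G i) [:V u w:]) (U u w) * m u w ^ i * l u w ^ (Polynomial.degree G - i)
    = l u w ^ Polynomial.degree G * (poly (poly (Polynomial.coeff G i) [:V u w:]) (U u w) * (m u w / l u w) ^ i)"
    using assms by (simp add: power_divide)
qed simp

text \<open>A factor of \<open>F\<close> vanishing on the curve has all \<open>n\<close> conjugate roots, as polynomial in \<open>x\<^sub>3\<close>.\<close>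

lemma degree_vanishing_factor:
  assumes "G \<noteq> 0" "\<And>u w. homog G u w = 0"
  shows "n \<le> Polynomial.degree G"
proof (rule ccontr)
  assume "\<not> ?thesis"
  then have less: "Polynomial.degree G < n" by simp
  have "poly (poly (Polynomial.coeff G i) [:V u w:]) (U u w) = 0" for i u w
  proof (rule generic_eq_0[where g = "\<lambda>u w. poly (poly (Polynomial.coeff G i) [:V u w:]) (U u w)"])
    show "polyfun (\<lambda>u w. poly (poly (Polynomial.coeff G i) [:V u w:]) (U u w))"
      by (intro polyfun_poly2 polyfuns)
  next
    fix u w
    assume L: "\<And>M. M \<in> set Ms \<Longrightarrow> L M u w \<noteq> 0" and inj: "inj_on (\<lambda>M. Y M u w / L M u w) (set Ms)"
    define p where "p = (\<Sum>i\<le>Polynomial.degree G.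
      Polynomial.monom (poly (poly (Polynomial.coeff G i) [:V u w:]) (U u w)) i)"
    have cp: "Polynomial.coeff p j = poly (poly (Polynomial.coeff G j) [:V u w:]) (U u w)" for j
      unfolding p_def by (simp add: coeff_sum coeff_eq_0 if_distrib cong: if_cong)
    have deg: "Polynomial.degree p \<le> Polynomial.degree G" by (rule degree_le) (simp add: cp coeff_eq_0)
    have "p = 0"
    proof (rule poly_eq_by_roots[where n = n and S = "(\<lambda>M. Y M u w / L M u w) ` set Ms"])
      show "Polynomial.degree p \<le> n" using deg less by simp
      show "Polynomial.coeff p n = Polynomial.coeff 0 n" using deg less by (simp add: coeff_eq_0)
      show "n \<le> card ((\<lambda>M. Y M u w / L M u w) ` set Ms)" using inj by (simp add: card_image card_Ms)
      fix x assume "x \<in> (\<lambda>M. Y M u w / L M u w) ` set Ms"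
      then obtain M where M: "M \<in> set Ms" "x = Y M u w / L M u w" by blast
      have "homog G (t\<^sub>1 M u w) (t\<^sub>2 M u w) = L M u w ^ Polynomial.degree G * eval3 G (vector [U u w, V u w, x])"
        using homog_eq[of "t\<^sub>1 M u w" "t\<^sub>2 M u w" G] L[OF M(1)] unfolding M(2) UV_t[OF M(1)] by (simp add: L_def Y_def)
      then have "eval3 G (vector [U u w, V u w, x]) = 0" using assms(2) L[OF M(1)] by simp
      then show "poly p x = poly 0 x" unfolding p_def by (simp add: eval3_last_poly)
    qed auto
    then show "poly (poly (Polynomial.coeff G i) [:V u w:]) (U u w) = 0" using cp[of i] by simp
  qed
  then have "poly (poly (Polynomial.coeff G i) [:z:]) x = 0" for i x z using UV_surj by metis
  then have "Polynomial.coeff G i = 0" for i by (rule poly2_eq_0I)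
  then show False using \<open>G \<noteq> 0\<close> by (simp add: poly_eq_iff)
qed

text \<open>A factor free of x_3 divides the leading coefficient \<open>c\<^sub>0\<close> x_1, so it
  is a constant or a constant times x_1. In the second case F would vanish on the line x_1 = 0,
  which \<open>F_nonzero\<close> excludes.\<close>

lemma const_factor_unit:
  assumes "F = [:c:] * G"
  shows "c dvd 1"
proof -
  have n: "Polynomial.coeff F n = c * Polynomial.coeff G n" using assms by simp
  define g where "g = Polynomial.coeff G n"
  have cg: "c * g = [:[:0, c\<^sub>0:]:]" using n lead_F g_def by simp
  have c0: "c\<^sub>0 \<noteq> 0" using degree_F lead_F n_pos by (metis degree_0 leading_coeff_0_iff pCons_0_0 less_irrefl)
  have nz: "c \<noteq> 0" "g \<noteq> 0" using cg c0 by auto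
  have "Polynomial.degree c + Polynomial.degree g = 0"
    using degree_mult_eq[OF nz] cg by simp
  then obtain c' g' where c': "c = [:c':]" "g = [:g':]" by (metis add_is_0 degree_eq_zeroE)
  have eq: "c' * g' = [:0, c\<^sub>0:]" using cg c' by (simp add: mult.commute)
  have nz': "c' \<noteq> 0" "g' \<noteq> 0" using nz c' by auto
  have deg: "Polynomial.degree c' + Polynomial.degree g' = 1"
    using degree_mult_eq[OF nz'] eq c0 by simp
  show ?thesis
  proof (cases "Polynomial.degree c' = 0")
    case True
    then obtain a where "c' = [:a:]" by (metis degree_eq_zeroE)
    then have "c * [:[:inverse a:]:] = 1" using nz' c' by (simp add: one_pCons)
    then show ?thesis by (metis dvdI)
  next
    case False
    with deg have "Polynomial.degree g' = 0" by simp
    then obtain b where b: "g' = [:b:]" by (metis degree_eq_zeroE)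
    with eq nz' have "poly c' 0 * b = 0" by (metis poly_pCons poly_mult mult_zero_left add_0 poly_0 mult_zero_right add.right_neutral)
    with b nz' have "poly c' 0 = 0" by simp
    then have "eval3 F (vector [0, z, y]) = 0" for z y
      unfolding assms by (simp add: eval3_def c')
    with F_nonzero show ?thesis by blast
  qed
qed

text \<open>In a factorization one factor vanishes along the whole parametrization. By
  \<open>degree_vanishing_factor\<close> it has degree n in x_3, so the other one is free of x_3 and
  \<open>const_factor_unit\<close> applies.\<close>

lemma irreducible_F: "Factorial_Ring.irreducible F"
proof (rule Factorial_Ring.irreducibleI)
  show nz: "F \<noteq> 0" using degree_F n_pos by auto
  show "\<not> F dvd 1"
    using degree_F n_pos by (metis nz degree_1 divides_degree less_irrefl less_le_not_le zero_neq_one le_zero_eq)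
  fix G H assume GH: "F = G * H"
  with nz have nzs: "G \<noteq> 0" "H \<noteq> 0" by auto
  have deg: "Polynomial.degree G + Polynomial.degree H = n"
    using degree_mult_eq[OF nzs] GH degree_F by simp
  have "(\<forall>u w. homog G u w = 0) \<or> (\<forall>u w. homog H u w = 0)"
  proof (rule polyfun_mult_eq_0)
    fix u w
    \<comment> \<open>The extra factor l covers the zeros of l, where m/l has no meaning; being a
      nonzero polynomial function, it can be cancelled afterwards.\<close>
    have "l u w * (homog G u w * homog H u w) = 0" for u w
    proof (cases "l u w = 0")
      case False
      have "l u w *s vector [U u w, V u w, m u w / l u w] = (vector [U u w * l u w, V u w * l u w, m u w] :: 'a^3)"
        using False by (simp add: vec_eq_iff forall_3)
      then have "eval3 F (vector [U u w, V u w, m u w / l u w]) = 0"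
        using F_param[of u w] form3_scale[OF form_F] False by (metis mult_eq_0_iff power_not_zero)
      then show ?thesis by (auto simp: homog_eq[OF False] GH)
    qed simp
    then have "(\<forall>u w. l u w = 0) \<or> (\<forall>u w. homog G u w * homog H u w = 0)"
      by (intro polyfun_mult_eq_0 polyfuns polyfun_mult polyfun_homog)
    moreover have "\<not> (\<forall>u w. l u w = 0)"
      using L_nonzero n_pos length_Ms unfolding L_def by (metis length_greater_0_conv list.set_sel(1))
    ultimately show "homog G u w * homog H u w = 0" by blast
  qed (rule polyfun_homog)+
  then show "G dvd 1 \<or> H dvd 1"
  proof
    assume "\<forall>u w. homog G u w = 0"
    then have "Polynomial.degree H = 0" using degree_vanishing_factor[OF nzs(1)] deg by simp
    then obtain c where "H = [:c:]" by (metis degree_eq_zeroE)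
    then show ?thesis using const_factor_unit[of c G] GH by (simp add: mult.commute is_unit_const_poly_iff)
  next
    assume "\<forall>u w. homog H u w = 0"
    then have "Polynomial.degree G = 0" using degree_vanishing_factor[OF nzs(2)] deg by simp
    then obtain c where "G = [:c:]" by (metis degree_eq_zeroE)
    then show ?thesis using const_factor_unit[of c H] GH by (simp add: is_unit_const_poly_iff)
  qed
qed

lemma plane_curve: "plane_curve_of_degree curve (Suc n)"
  unfolding plane_curve_of_degree_def using form_F irreducible_F zero_set by blast

end

section \<open>Endomorphisms of k(t) by substitution\<close>

section \<open>Moebius substitutions in the rational function field\<close>

definition cst :: "'a::field \<Rightarrow> 'a poly fract" where "cst a = to_fract [:a:]"

definition tvar :: "'a::field poly fract" where "tvar = to_fract [:0, 1:]"

definition ev :: "'a::field poly \<Rightarrow> 'a poly fract \<Rightarrow> 'a poly fract" where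
  "ev p x = poly (map_poly cst p) x"

lemma cst_simps [simp]:
  "cst 0 = 0" "cst 1 = 1" "cst (a + b) = cst a + cst b" "cst (a * b) = cst a * cst b"
  "cst (- a) = - cst a" "cst (a - b) = cst a - cst b"
  "cst a = cst b \<longleftrightarrow> a = b" "cst a = 0 \<longleftrightarrow> a = 0"
  by (simp_all add: cst_def to_fract_add[symmetric] to_fract_mult[symmetric] to_fract_uminus[symmetric]
      to_fract_diff[symmetric] one_pCons[symmetric] del: to_fract_add to_fract_mult to_fract_uminus to_fract_diff)

lemma cst_divide: "cst a / cst b = cst (a / b)"
  by (cases "b = 0") (simp_all add: divide_eq_eq flip: cst_simps(4))

lemma ev_pCons [simp]: "ev (pCons a p) x = cst a + x * ev p x"
  by (simp add: ev_def map_poly_pCons)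

lemma ev_0 [simp]: "ev 0 x = 0"
  by (simp add: ev_def)

lemma ev_1 [simp]: "ev 1 x = 1"
  by (simp add: one_pCons)

lemma ev_add [simp]: "ev (p + q) x = ev p x + ev q x"
  by (induction p q rule: poly_induct2) (simp_all add: algebra_simps)

lemma ev_smult [simp]: "ev (Polynomial.smult a p) x = cst a * ev p x"
  by (induction p) (simp_all add: algebra_simps)

lemma ev_mult [simp]: "ev (p * q) x = ev p x * ev q x"
  by (induction p) (simp_all add: algebra_simps)

lemma ev_uminus [simp]: "ev (- p) x = - ev p x"
  by (induction p) (simp_all add: algebra_simps)

lemma ev_tvar: "ev p tvar = to_fract p"
proof (induction p)
  case (pCons a p)
  have "to_fract (pCons a p) = to_fract ([:a:] + [:0, 1:] * p)" by simp
  also have "\<dots> = cst a + tvar * to_fract p" unfolding to_fract_add to_fract_mult cst_def tvar_def ..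
  finally show ?case using pCons by simp
qed simp

lemma ev_sum_le:
  assumes "Polynomial.degree p \<le> n"
  shows "ev p x = (\<Sum>i\<le>n. cst (Polynomial.coeff p i) * x ^ i)"
proof -
  have "Polynomial.degree (map_poly cst p) \<le> n" using map_poly_degree_leq[of cst p] assms by linarith
  then have "ev p x = (\<Sum>i\<le>n. Polynomial.coeff (map_poly cst p) i * x ^ i)"
    unfolding ev_def poly_altdef by (intro sum.mono_neutral_left) (auto simp: coeff_eq_0)
  then show ?thesis by (simp add: coeff_map_poly)
qed

lemma fract_cases:
  obtains p q where "q \<noteq> 0" "x = to_fract p / to_fract q"
  by (cases x rule: Fract_cases) (auto simp: Fract_conv_to_fract)

text \<open>A nonconstant element x of k(t) is transcendental over k: p is a product of a nonzero
  constant and linear factors X - r, and no x - r is zero.\<close>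

lemma ev_nonzero:
  fixes p :: "'a::alg_closed_field poly"
  assumes "x \<notin> range cst" "p \<noteq> 0"
  shows "ev p x \<noteq> 0"
  using assms(2)
proof (induction "Polynomial.degree p" arbitrary: p rule: less_induct)
  case less
  show ?case
  proof (cases "Polynomial.degree p = 0")
    case True
    then obtain a where "p = [:a:]" by (metis degree_eq_zeroE)
    with less.prems show ?thesis by simp
  next
    case False
    then obtain r where "poly p r = 0" using alg_closed_imp_poly_has_root by blast
    then obtain q where q: "p = [:- r, 1:] * q" by (metis poly_eq_0_iff_dvd dvdE)
    with less.prems have "q \<noteq> 0" by auto
    then have "Polynomial.degree p = Suc (Polynomial.degree q)" unfolding q by (subst degree_mult_eq) auto
    then have "ev q x \<noteq> 0" using less.hyps \<open>q \<noteq> 0\<close> by simp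
    moreover have "ev [:- r, 1:] x \<noteq> 0" using assms(1) by (auto simp: eq_neg_iff_add_eq_0[symmetric] add_eq_0_iff)
    ultimately show ?thesis unfolding q ev_mult by simp
  qed
qed

text \<open>The k-algebra endomorphisms of k(t). They are injective but need not be surjective, so
  bijectivity is a separate condition in \<open>Gal\<close>.\<close>

definition khom :: "('a::field poly fract \<Rightarrow> 'a poly fract) \<Rightarrow> bool" where
  "khom h \<longleftrightarrow> (\<forall>x y. h (x + y) = h x + h y) \<and> (\<forall>x y. h (x * y) = h x * h y) \<and> (\<forall>a. h (cst a) = cst a)"

lemma khom_simps:
  assumes "khom h"
  shows "h (x + y) = h x + h y" "h (x * y) = h x * h y" "h (cst a) = cst a" "h 0 = 0" "h 1 = 1"
    "h (- x) = - h x" "h (x - y) = h x - h y" "h (x / y) = h x / h y" "h x = 0 \<longleftrightarrow> x = 0"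
proof -
  show add: "h (x + y) = h x + h y" and mult: "h (x * y) = h x * h y" and c: "h (cst a) = cst a" for x y a
    using assms unfolding khom_def by blast+
  show h0: "h 0 = 0" and h1: "h 1 = 1" using c[of 0] c[of 1] by simp_all
  show neg: "h (- x) = - h x" for x using mult[of "cst (-1)" x] c[of "- 1"] by simp
  show "h (x - y) = h x - h y" using add[of x "- y"] neg by simp
  show inj: "h x = 0 \<longleftrightarrow> x = 0" for x using mult[of x "inverse x"] h1 h0 by (cases "x = 0") auto
  show "h (x / y) = h x / h y"
  proof (cases "y = 0")
    case False
    then have "h x = h (x / y) * h y" using mult[of "x / y" y] by simp
    then show ?thesis using False inj by simp
  qed (simp add: h0)
qed

lemma khom_ev: "khom h \<Longrightarrow> h (ev p x) = ev p (h x)"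
  by (induction p) (simp_all add: khom_simps)

lemma khom_ext:
  assumes "khom h" "khom h'" "h tvar = h' tvar"
  shows "h = h'"
proof
  fix x :: "'a poly fract"
  obtain p q where "x = to_fract p / to_fract q" using fract_cases .
  then show "h x = h' x"
    using assms by (simp add: ev_tvar[symmetric] khom_simps(8) khom_ev)
qed

lemma khom_inj: "khom h \<Longrightarrow> inj h"
  by (rule injI) (metis khom_simps(7,9) eq_iff_diff_eq_0)

lemma khom_comp: "khom g \<Longrightarrow> khom h \<Longrightarrow> khom (g \<circ> h)"
  by (simp add: khom_def)

lemma khom_id: "khom id"
  by (simp add: khom_def)

text \<open>For nonconstant y this is the k-endomorphism of k(t) with t \<mapsto> y;
  \<open>subst_fraction\<close> shows that the result does not depend on the chosen
  fraction.\<close>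

definition subst :: "'a::field poly fract \<Rightarrow> 'a poly fract \<Rightarrow> 'a poly fract" where
  "subst y x = (case SOME (p, q). q \<noteq> 0 \<and> x = to_fract p / to_fract q of (p, q) \<Rightarrow> ev p y / ev q y)"

context
  fixes y :: "'a::alg_closed_field poly fract"
  assumes y: "y \<notin> range cst"
begin

lemma subst_fraction:
  assumes "q \<noteq> 0"
  shows "subst y (to_fract p / to_fract q) = ev p y / ev q y"
proof -
  define pq where "pq = (SOME (p', q'). q' \<noteq> 0 \<and> to_fract p / to_fract q = to_fract p' / to_fract q')"
  have "case pq of (p', q') \<Rightarrow> q' \<noteq> 0 \<and> to_fract p / to_fract q = to_fract p' / to_fract q'"
    unfolding pq_def by (rule someI[of _ "(p, q)"]) (use assms in simp)
  then obtain p' q' where pq: "pq = (p', q')" "q' \<noteq> 0" "to_fract p / to_fract q = to_fract p' / to_fract q'"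
    by (cases pq) auto
  then have "to_fract (p * q') = to_fract (p' * q)" using assms by (simp add: frac_eq_eq)
  then have "p * q' = p' * q" unfolding to_fract_eq_iff .
  then have "ev p y * ev q' y = ev p' y * ev q y" by (simp flip: ev_mult)
  then show ?thesis
    using ev_nonzero[OF y assms] ev_nonzero[OF y pq(2)] unfolding subst_def pq_def[symmetric] pq(1)
    by (simp add: frac_eq_eq)
qed

lemma subst_tvar: "subst y tvar = y"
  using subst_fraction[of 1 "[:0, 1:]"] by (simp add: tvar_def)

lemma khom_subst: "khom (subst y)"
  unfolding khom_def
proof (intro conjI allI)
  fix x1 x2 :: "'a poly fract" and a :: 'a
  obtain p1 q1 where 1: "q1 \<noteq> 0" "x1 = to_fract p1 / to_fract q1" using fract_cases .
  obtain p2 q2 where 2: "q2 \<noteq> 0" "x2 = to_fract p2 / to_fract q2" using fract_cases .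
  have nz: "ev q1 y \<noteq> 0" "ev q2 y \<noteq> 0" using ev_nonzero[OF y] 1 2 by auto
  have "x1 + x2 = to_fract (p1 * q2 + p2 * q1) / to_fract (q1 * q2)"
    using 1 2 by (simp add: field_simps)
  then have "subst y (x1 + x2) = ev (p1 * q2 + p2 * q1) y / ev (q1 * q2) y"
    using 1 2 by (simp only:) (rule subst_fraction, simp)
  moreover have s: "subst y x1 = ev p1 y / ev q1 y" "subst y x2 = ev p2 y / ev q2 y"
    unfolding 1(2) 2(2) by (rule subst_fraction[OF 1(1)], rule subst_fraction[OF 2(1)])
  ultimately show "subst y (x1 + x2) = subst y x1 + subst y x2"
    using nz unfolding s by (simp add: field_simps)
  have "x1 * x2 = to_fract (p1 * p2) / to_fract (q1 * q2)" using 1 2 by simp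
  then have "subst y (x1 * x2) = ev (p1 * p2) y / ev (q1 * q2) y"
    using 1 2 by (simp only:) (rule subst_fraction, simp)
  then show "subst y (x1 * x2) = subst y x1 * subst y x2" unfolding s by simp
  show "subst y (cst a) = cst a" using subst_fraction[of 1 "[:a:]"] by (simp add: cst_def)
qed

end

fun mob_fract :: "'a::field moebius \<Rightarrow> 'a poly fract" where
  "mob_fract (a, b, c, d) = to_fract [:b, a:] / to_fract [:d, c:]"

fun mob_comp :: "'a::field moebius \<Rightarrow> 'a moebius \<Rightarrow> 'a moebius" where
  "mob_comp (a, b, c, d) (a', b', c', d') =
    (a * a' + b * c', a * b' + b * d', c * a' + d * c', c * b' + d * d')"

lemma mob_fract_nonconst:
  assumes "mob_det M \<noteq> 0"
  shows "mob_fract M \<notin> range cst"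
proof
  obtain a b c d where M: "M = (a, b, c, d)" by (metis prod_cases4)
  assume "mob_fract M \<in> range cst"
  then obtain k where k: "to_fract [:b, a:] / to_fract [:d, c:] = to_fract [:k:]"
    by (auto simp: M cst_def)
  have "[:d, c:] \<noteq> 0" using assms M by auto
  then have "to_fract [:b, a:] = to_fract [:k:] * to_fract [:d, c:]" using k by (simp add: divide_eq_eq)
  then have "[:b, a:] = [:k:] * [:d, c:]" unfolding to_fract_mult[symmetric] to_fract_eq_iff .
  with assms show False by (simp add: M)
qed

lemma mob_fract_eq_iff:
  assumes "mob_det M \<noteq> 0" "mob_det M' \<noteq> 0"
  shows "mob_fract M = mob_fract M' \<longleftrightarrow> mob_eq M M'"
proof -
  obtain a b c d a' b' c' d' where M: "M = (a, b, c, d)" "M' = (a', b', c', d')"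
    by (metis prod_cases4)
  have nz: "[:d, c:] \<noteq> 0" "[:d', c':] \<noteq> 0" using assms M by auto
  then have "mob_fract M = mob_fract M' \<longleftrightarrow> to_fract ([:b, a:] * [:d', c':]) = to_fract ([:b', a':] * [:d, c:])"
    by (simp add: M frac_eq_eq del: mult_pCons_left mult_pCons_right)
  also have "\<dots> \<longleftrightarrow> [:b, a:] * [:d', c':] = [:b', a':] * [:d, c:]" unfolding to_fract_eq_iff ..
  also have "\<dots> \<longleftrightarrow> mob_eq M M'" by (auto simp: M algebra_simps)
  finally show ?thesis .
qed

lemma mob_det_comp: "mob_det (mob_comp M M') = mob_det M * mob_det M'"
  by (cases M; cases M') (simp add: algebra_simps)

text \<open>Replacing t by M(t) in M'(t) yields M'(M(t)): substitution reverses the order, hence the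
  order of the arguments of \<open>mob_comp\<close>.\<close>

lemma subst_mob_fract:
  fixes M M' :: "'a::alg_closed_field moebius"
  assumes "mob_det M \<noteq> 0" "mob_det M' \<noteq> 0"
  shows "subst (mob_fract M) (mob_fract M') = mob_fract (mob_comp M' M)"
proof -
  obtain a b c d a' b' c' d' where M: "M = (a, b, c, d)" "M' = (a', b', c', d')"
    by (metis prod_cases4)
  have nz: "[:d, c:] \<noteq> 0" "[:d', c':] \<noteq> 0" using assms M by auto
  define P Q where "P = to_fract [:b, a:]" and "Q = to_fract [:d, c:]"
  have Q: "Q \<noteq> 0" using nz unfolding Q_def by simp
  have lin: "cst x * P + cst y * Q = to_fract (Polynomial.smult x [:b, a:] + Polynomial.smult y [:d, c:])" for x y
    unfolding P_def Q_def cst_def to_fract_add[symmetric] to_fract_mult[symmetric] by simp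
  have "subst (mob_fract M) (mob_fract M') = ev [:b', a':] (P / Q) / ev [:d', c':] (P / Q)"
    using subst_fraction[OF mob_fract_nonconst[OF assms(1)] nz(2), of "[:b', a':]"] by (simp add: M P_def Q_def)
  also have "\<dots> = (cst a' * P + cst b' * Q) / (cst c' * P + cst d' * Q)"
  proof -
    have "ev [:b', a':] (P / Q) = (cst a' * P + cst b' * Q) / Q" "ev [:d', c':] (P / Q) = (cst c' * P + cst d' * Q) / Q"
      using Q by (simp_all add: field_simps)
    then show ?thesis using Q by simp
  qed
  also have "\<dots> = mob_fract (mob_comp M' M)" unfolding lin by (simp add: M add.commute)
  finally show ?thesis .
qed

lemma mob_fract_scalar: "k \<noteq> 0 \<Longrightarrow> mob_fract (k, 0, 0, k) = tvar"
  using ev_tvar[of "[:0, k:]"] ev_tvar[of "[:k:]"] by (simp add: tvar_def divide_eq_eq)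

text \<open>The adjugate matrix inverts M up to a scalar, and a scalar matrix is the identity on t.
  Since a k-endomorphism is determined by the image of t, this gives a right inverse; injectivity is
  automatic.\<close>

lemma bij_subst_mob:
  fixes M :: "'a::alg_closed_field moebius"
  assumes "mob_det M \<noteq> 0"
  shows "bij (subst (mob_fract M))"
proof -
  obtain a b c d where M: "M = (a, b, c, d)" by (metis prod_cases4)
  define M' where "M' = (d, - b, - c, a)"
  have det: "mob_det M' \<noteq> 0" using assms by (simp add: M M'_def algebra_simps)
  have "mob_comp M' M = (mob_det M, 0, 0, mob_det M)" by (simp add: M M'_def algebra_simps)
  then have "subst (mob_fract M) (mob_fract M') = tvar"
    using subst_mob_fract[OF assms det] mob_fract_scalar[OF assms] by simp
  moreover have k: "khom (subst (mob_fract M))" "khom (subst (mob_fract M'))"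
    using khom_subst mob_fract_nonconst assms det by blast+
  ultimately have "subst (mob_fract M) \<circ> subst (mob_fract M') = id"
    using subst_tvar[OF mob_fract_nonconst[OF det]] by (intro khom_ext khom_comp khom_id) simp_all
  then have "surj (subst (mob_fract M))" by (metis comp_apply id_apply surjI)
  then show ?thesis using khom_inj[OF k(1)] by (simp add: bij_def)
qed

section \<open>The extension k(t) over k(U/V): roots, automorphisms and fixed field\<close>

section \<open>The Galois group of the rational function field over an invariant function\<close>

text \<open>The polynomial g(t, 1). Its degree drops below d when g vanishes at infinity, so the
  bound d is kept instead of the actual degree.\<close>

definition dehomogenization :: "nat \<Rightarrow> ('a::field \<Rightarrow> 'a \<Rightarrow> 'a) \<Rightarrow> 'a poly" where
  "dehomogenization d g = (SOME p. Polynomial.degree p \<le> d \<and>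
    g = (\<lambda>u w. \<Sum>i\<le>d. Polynomial.coeff p i * u ^ i * w ^ (d - i)))"

lemma dehomogenization:
  assumes "binary_form d g"
  shows "Polynomial.degree (dehomogenization d g) \<le> d"
    "g u w = (\<Sum>i\<le>d. Polynomial.coeff (dehomogenization d g) i * u ^ i * w ^ (d - i))"
proof -
  define Q where "Q p \<longleftrightarrow> Polynomial.degree p \<le> d \<and>
    g = (\<lambda>u w. \<Sum>i\<le>d. Polynomial.coeff p i * u ^ i * w ^ (d - i))" for p
  obtain p where "Polynomial.degree p \<le> d"
    "\<And>u w. g u w = (\<Sum>i\<le>d. Polynomial.coeff p i * u ^ i * w ^ (d - i))"
    by (rule binary_form_poly[OF assms]) blast
  then have "Q p" unfolding Q_def fun_eq_iff by simp
  then have "Q (dehomogenization d g)" unfolding dehomogenization_def Q_def[symmetric] by (rule someI)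
  then have *: "Polynomial.degree (dehomogenization d g) \<le> d"
    "g = (\<lambda>u w. \<Sum>i\<le>d. Polynomial.coeff (dehomogenization d g) i * u ^ i * w ^ (d - i))"
    unfolding Q_def by (rule conjunct1, rule conjunct2)
  show "Polynomial.degree (dehomogenization d g) \<le> d" by (rule *(1))
  show "g u w = (\<Sum>i\<le>d. Polynomial.coeff (dehomogenization d g) i * u ^ i * w ^ (d - i))"
    by (rule fun_cong[OF fun_cong[OF *(2)]])
qed

context moebius_invariant
begin

definition pU where "pU = dehomogenization n U"
definition pV where "pV = dehomogenization n V"

lemmas pU = dehomogenization[OF form_U, folded pU_def]
lemmas pV = dehomogenization[OF form_V, folded pV_def]

lemma poly_pU: "poly pU t = U t 1" and poly_pV: "poly pV t = V t 1"
proof -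
  have *: "poly p t = (\<Sum>i\<le>n. Polynomial.coeff p i * t ^ i * 1 ^ (n - i))" if "Polynomial.degree p \<le> n" for p :: "'a poly"
  proof -
    have "(\<Sum>i\<le>Polynomial.degree p. Polynomial.coeff p i * t ^ i) = (\<Sum>i\<le>n. Polynomial.coeff p i * t ^ i)"
      by (rule sum.mono_neutral_left) (use that in \<open>auto simp: coeff_eq_0\<close>)
    then show ?thesis unfolding poly_altdef by simp
  qed
  show "poly pU t = U t 1" "poly pV t = V t 1"
    unfolding pU(2)[of t 1] pV(2)[of t 1] by (rule *[OF pU(1)], rule *[OF pV(1)])
qed

lemma pV_nonzero: "pV \<noteq> 0"
proof
  assume "pV = 0"
  then have "V u w = 0" for u w unfolding pV(2)[of u w] by simp
  moreover obtain u w where "V u w = 1" using UV_surj by blast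
  ultimately show False by simp
qed

definition f where "f = to_fract pU / to_fract pV"

lemma f_nonconst: "f \<notin> range cst"
proof
  assume "f \<in> range cst"
  then obtain k where "f = to_fract [:k:]" by (auto simp: cst_def)
  then have "to_fract pU = to_fract [:k:] * to_fract pV" using pV_nonzero by (simp add: f_def divide_eq_eq)
  then have "pU = [:k:] * pV" unfolding to_fract_mult[symmetric] to_fract_eq_iff .
  then have "U u w = k * V u w" for u w unfolding pU(2)[of u w] pV(2)[of u w] by (simp add: sum_distrib_left mult.assoc)
  moreover obtain u w where "U u w = 1" "V u w = 0" using UV_surj by blast
  ultimately show False by simp
qed

text \<open>The subfield k(f); the denominators do not vanish because f is nonconstant, hence
  transcendental.\<close>

definition K where "K = {ev p f / ev q f | p q. q \<noteq> 0}"

lemma KI: "q \<noteq> 0 \<Longrightarrow> x = ev p f / ev q f \<Longrightarrow> x \<in> K"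
  unfolding K_def by blast

lemma K_cst: "cst a \<in> K"
  by (rule KI[of 1 _ "[:a:]"]) simp_all

lemma K_f: "f \<in> K"
  by (rule KI[of 1 _ "[:0, 1:]"]) simp_all

lemma K_01: "0 \<in> K" "1 \<in> K"
  using K_cst[of 0] K_cst[of 1] by simp_all

lemma
  assumes "x \<in> K" "y \<in> K"
  shows K_add: "x + y \<in> K" and K_mult: "x * y \<in> K" and K_diff: "x - y \<in> K" and K_divide: "x / y \<in> K"
proof -
  have add: "x + y \<in> K" and mult: "x * y \<in> K" and neg: "- x \<in> K" and inv: "inverse x \<in> K"
    if "x \<in> K" "y \<in> K" for x y
  proof -
    from that obtain p q p' q' where x: "q \<noteq> 0" "x = ev p f / ev q f" and y: "q' \<noteq> 0" "y = ev p' f / ev q' f"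
      unfolding K_def by blast
    have nz: "ev q f \<noteq> 0" "ev q' f \<noteq> 0" using ev_nonzero[OF f_nonconst] x y by auto
    show "x + y \<in> K"
      unfolding x(2) y(2)
      by (rule KI[of "q * q'" _ "p * q' + p' * q"]) (use x(1) y(1) nz in \<open>simp_all add: field_simps\<close>)
    show "x * y \<in> K" by (rule KI[of "q * q'" _ "p * p'"]) (use x y nz in auto)
    show "- x \<in> K" by (rule KI[of q _ "- p"]) (use x in auto)
    show "inverse x \<in> K"
    proof (cases "p = 0")
      case True
      then show ?thesis using x K_01 by simp
    next
      case False
      show ?thesis by (rule KI[OF False, of _ q]) (use x in simp)
    qed
  qed
  show "x + y \<in> K" "x * y \<in> K"
    by (rule add[OF assms], rule mult[OF assms])
  show "x - y \<in> K" using add[OF assms(1) neg[OF assms(2) assms(2)]] by simp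
  show "x / y \<in> K" using mult[OF assms(1) inv[OF assms(2) assms(2)]] by (simp add: divide_inverse)
qed

text \<open>Multiplying p(M(t)) by the n-th power of the denominator of M gives the degree n
  homogenization of p at (a t + b, c t + d). Using the exponent n for both U and V, whatever their
  dehomogenized degrees, lets the power cancel in U/V.\<close>

lemma mob_fract_pow:
  fixes a b c d :: 'a
  assumes "mob_det (a, b, c, d) \<noteq> 0" "Polynomial.degree p \<le> n"
  shows "to_fract [:d, c:] ^ n * ev p (mob_fract (a, b, c, d))
    = to_fract (\<Sum>i\<le>n. Polynomial.smult (Polynomial.coeff p i) ([:b, a:] ^ i * [:d, c:] ^ (n - i)))"
proof -
  define P Q where "P = to_fract [:b, a:]" and "Q = to_fract [:d, c:]"
  have "[:d, c:] \<noteq> 0" using assms(1) by auto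
  then have Q: "Q \<noteq> 0" unfolding Q_def by simp
  have to_fract_power: "to_fract (r ^ k) = to_fract r ^ k" for r :: "'a poly" and k by (induction k) auto
  have to_fract_sum: "to_fract (sum g I) = (\<Sum>i\<in>I. to_fract (g i))" for g :: "nat \<Rightarrow> 'a poly" and I
    by (induction I rule: infinite_finite_induct) auto
  have "Q ^ n * ev p (P / Q) = (\<Sum>i\<le>n. cst (Polynomial.coeff p i) * (P ^ i * Q ^ (n - i)))"
    unfolding ev_sum_le[OF assms(2)] sum_distrib_left
  proof (rule sum.cong)
    fix i assume "i \<in> {..n}"
    then have "Q ^ n = Q ^ i * Q ^ (n - i)" by (simp add: power_add[symmetric])
    then show "Q ^ n * (cst (Polynomial.coeff p i) * (P / Q) ^ i) = cst (Polynomial.coeff p i) * (P ^ i * Q ^ (n - i))"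
      using Q by (simp add: power_divide)
  qed simp
  also have "\<dots> = to_fract (\<Sum>i\<le>n. [:Polynomial.coeff p i:] * ([:b, a:] ^ i * [:d, c:] ^ (n - i)))"
    unfolding to_fract_sum to_fract_mult to_fract_power P_def Q_def cst_def ..
  finally show ?thesis by (simp add: P_def Q_def)
qed

lemma subst_f:
  assumes "M \<in> set Ms"
  shows "subst (mob_fract M) f = f"
proof -
  obtain a b c d where M: "M = (a, b, c, d)" by (metis prod_cases4)
  have det: "mob_det (a, b, c, d) \<noteq> 0" using det_nonzero[OF assms] M by simp
  obtain \<rho> where \<rho>: "\<And>u w. U (mob_num M u w) (mob_den M u w) = \<rho> * U u w \<and>
      V (mob_num M u w) (mob_den M u w) = \<rho> * V u w" using invariant[OF assms] by blast
  have r0: "\<rho> \<noteq> 0" using invariant_factor_nonzero[OF assms] \<rho> by blast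
  have U: "(\<Sum>i\<le>n. Polynomial.smult (Polynomial.coeff pU i) ([:b, a:] ^ i * [:d, c:] ^ (n - i))) = Polynomial.smult \<rho> pU"
  proof (rule poly_eqI_all)
    fix t
    have "poly (\<Sum>i\<le>n. Polynomial.smult (Polynomial.coeff pU i) ([:b, a:] ^ i * [:d, c:] ^ (n - i))) t
      = U (mob_num M t 1) (mob_den M t 1)"
      unfolding pU(2)[of "mob_num M t 1" "mob_den M t 1"] by (simp add: M poly_sum ac_simps)
    also have "\<dots> = poly (Polynomial.smult \<rho> pU) t" using \<rho> by (simp add: poly_pU)
    finally show "poly (\<Sum>i\<le>n. Polynomial.smult (Polynomial.coeff pU i) ([:b, a:] ^ i * [:d, c:] ^ (n - i))) t
      = poly (Polynomial.smult \<rho> pU) t" .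
  qed
  have V: "(\<Sum>i\<le>n. Polynomial.smult (Polynomial.coeff pV i) ([:b, a:] ^ i * [:d, c:] ^ (n - i))) = Polynomial.smult \<rho> pV"
  proof (rule poly_eqI_all)
    fix t
    have "poly (\<Sum>i\<le>n. Polynomial.smult (Polynomial.coeff pV i) ([:b, a:] ^ i * [:d, c:] ^ (n - i))) t
      = V (mob_num M t 1) (mob_den M t 1)"
      unfolding pV(2)[of "mob_num M t 1" "mob_den M t 1"] by (simp add: M poly_sum ac_simps)
    also have "\<dots> = poly (Polynomial.smult \<rho> pV) t" using \<rho> by (simp add: poly_pV)
    finally show "poly (\<Sum>i\<le>n. Polynomial.smult (Polynomial.coeff pV i) ([:b, a:] ^ i * [:d, c:] ^ (n - i))) t
      = poly (Polynomial.smult \<rho> pV) t" .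
  qed
  define Q where "Q = to_fract [:d, c:] ^ n"
  have Q: "Q \<noteq> 0" using det unfolding Q_def by auto
  have sm: "to_fract (Polynomial.smult \<rho> p) = cst \<rho> * to_fract p" for p
    using ev_smult[of \<rho> p tvar] by (simp add: ev_tvar)
  have "Q * ev pU (mob_fract M) = cst \<rho> * to_fract pU" "Q * ev pV (mob_fract M) = cst \<rho> * to_fract pV"
    using mob_fract_pow[OF det pU(1)] mob_fract_pow[OF det pV(1)] unfolding Q_def U V M[symmetric] sm by simp_all
  then have "ev pU (mob_fract M) = cst \<rho> / Q * to_fract pU" "ev pV (mob_fract M) = cst \<rho> / Q * to_fract pV"
    using Q by (simp_all add: field_simps)
  then have "ev pU (mob_fract M) / ev pV (mob_fract M) = to_fract pU / to_fract pV"
    using Q r0 by simp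
  then show ?thesis
    unfolding f_def using subst_fraction[OF mob_fract_nonconst[OF det_nonzero[OF assms]] pV_nonzero] by simp
qed

text \<open>The equation U(X) - f V(X) of t over k(f).\<close>

definition P where "P = map_poly cst pU - Polynomial.smult f (map_poly cst pV)"

lemma poly_P: "poly P x = ev pU x - f * ev pV x"
  by (simp add: P_def ev_def)

lemma coeff_P: "Polynomial.coeff P i = cst (Polynomial.coeff pU i) - f * cst (Polynomial.coeff pV i)"
  by (simp add: P_def coeff_map_poly)

lemma degree_P_le: "Polynomial.degree P \<le> n"
  by (rule degree_le) (use pU(1) pV(1) in \<open>simp add: coeff_P coeff_eq_0\<close>)

lemma coeff_P_in_K: "Polynomial.coeff P i \<in> K"
  unfolding coeff_P by (intro K_diff K_mult K_cst K_f)

lemma P_nonzero: "P \<noteq> 0"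
proof
  assume "P = 0"
  obtain i where i: "Polynomial.coeff pV i \<noteq> 0" using pV_nonzero by (auto simp: poly_eq_iff)
  have "cst (Polynomial.coeff pU i) = f * cst (Polynomial.coeff pV i)" using coeff_P[of i] \<open>P = 0\<close> by simp
  with i have "f = cst (Polynomial.coeff pU i / Polynomial.coeff pV i)" by (simp add: cst_divide[symmetric])
  with f_nonconst show False by blast
qed

lemma P_tvar: "poly P tvar = 0"
  using pV_nonzero by (simp add: poly_P ev_tvar f_def)

definition Gal where "Gal = {h. khom h \<and> bij h \<and> (\<forall>x\<in>K. h x = x)}"

lemma khom_fix_K: "khom h \<Longrightarrow> h f = f \<Longrightarrow> x \<in> K \<Longrightarrow> h x = x"
  unfolding K_def by (auto simp: khom_simps(8) khom_ev)

lemma Gal_root: "h \<in> Gal \<Longrightarrow> poly P x = 0 \<Longrightarrow> poly P (h x) = 0"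
proof -
  assume h: "h \<in> Gal" and 0: "poly P x = 0"
  have "h (ev pU x - f * ev pV x) = ev pU (h x) - f * ev pV (h x)"
    using h K_f unfolding Gal_def by (simp add: khom_simps khom_ev)
  then show ?thesis using 0 h unfolding Gal_def poly_P by (simp add: khom_simps(4))
qed

lemma subst_in_Gal:
  assumes "M \<in> set Ms"
  shows "subst (mob_fract M) \<in> Gal"
proof -
  have k: "khom (subst (mob_fract M))"
    by (rule khom_subst[OF mob_fract_nonconst[OF det_nonzero[OF assms]]])
  then show ?thesis unfolding Gal_def
    using bij_subst_mob[OF det_nonzero[OF assms]] khom_fix_K[OF k subst_f[OF assms]] by blast
qed

lemma inj_mob_fract: "inj_on mob_fract (set Ms)"
proof (rule inj_onI, rule ccontr)
  fix M M' assume M: "M \<in> set Ms" "M' \<in> set Ms" "mob_fract M = mob_fract M'" "M \<noteq> M'"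
  then have "mob_eq M M'" using mob_fract_eq_iff det_nonzero by blast
  with M not_mob_eq' show False by blast
qed

lemma subst_mob_tvar: "M \<in> set Ms \<Longrightarrow> subst (mob_fract M) tvar = mob_fract M"
  by (rule subst_tvar[OF mob_fract_nonconst[OF det_nonzero]])

lemma mob_fract_root: "M \<in> set Ms \<Longrightarrow> poly P (mob_fract M) = 0"
  using Gal_root[OF subst_in_Gal P_tvar] subst_mob_tvar by simp

lemma card_mob_fract: "card (mob_fract ` set Ms) = n"
  using card_image[OF inj_mob_fract] card_Ms by simp

text \<open>The substitutions fix f, hence they permute the roots of P, and t is one of them. The n
  elements M(t) are distinct roots of a nonzero polynomial of degree at most n, so there are no
  others and the degree is n.\<close>

lemma roots_P: "{x. poly P x = 0} = mob_fract ` set Ms" and degree_P: "Polynomial.degree P = n"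
proof -
  have fin: "finite {x. poly P x = 0}" by (rule poly_roots_finite[OF P_nonzero])
  have sub: "mob_fract ` set Ms \<subseteq> {x. poly P x = 0}" using mob_fract_root by blast
  have "card {x. poly P x = 0} \<le> Polynomial.degree P" by (rule card_poly_roots_bound[OF P_nonzero])
  with degree_P_le card_mono[OF fin sub] card_mob_fract
  have "card {x. poly P x = 0} = n" "Polynomial.degree P = n" by linarith+
  then show "{x. poly P x = 0} = mob_fract ` set Ms" "Polynomial.degree P = n"
    using card_subset_eq[OF fin sub] card_mob_fract by simp_all
qed

text \<open>An automorphism over K is determined by the image of t, which is a root of P, hence some
  M(t).\<close>

lemma Gal_eq: "Gal = (\<lambda>M. subst (mob_fract M)) ` set Ms"
proof (rule Set.equalityI; rule subsetI)
  fix h assume h: "h \<in> Gal"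
  then have "h tvar \<in> mob_fract ` set Ms" using Gal_root[OF h P_tvar] roots_P by blast
  then obtain M where M: "M \<in> set Ms" "h tvar = mob_fract M" by blast
  then have "h = subst (mob_fract M)"
    using h subst_in_Gal[OF M(1)] subst_mob_tvar[OF M(1)] unfolding Gal_def by (intro khom_ext) auto
  with M(1) show "h \<in> (\<lambda>M. subst (mob_fract M)) ` set Ms" by blast
qed (use subst_in_Gal in blast)

lemma card_Gal: "card Gal = n"
proof -
  have "inj_on (\<lambda>M. subst (mob_fract M)) (set Ms)"
  proof (rule inj_onI)
    fix M M' assume M: "M \<in> set Ms" "M' \<in> set Ms" "subst (mob_fract M) = subst (mob_fract M')"
    then have "mob_fract M = mob_fract M'" using subst_mob_tvar by metis
    then show "M = M'" using inj_onD[OF inj_mob_fract] M by blast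
  qed
  then show ?thesis unfolding Gal_eq by (simp add: card_image card_Ms)
qed

lemma finite_Gal: "finite Gal"
  unfolding Gal_eq by simp

lemma Gal_id: "id \<in> Gal"
  unfolding Gal_def by (simp add: khom_id)

lemma Gal_comp: "g \<in> Gal \<Longrightarrow> h \<in> Gal \<Longrightarrow> g \<circ> h \<in> Gal"
  unfolding Gal_def by (simp add: khom_comp bij_comp)

lemma Gal_inv:
  assumes "h \<in> Gal"
  shows "inv_into UNIV h \<in> Gal"
proof -
  have h: "khom h" "bij h" "\<And>x. x \<in> K \<Longrightarrow> h x = x" using assms unfolding Gal_def by blast+
  have i: "inv_into UNIV h y = x" if "h x = y" for x y using h(2) that by (metis bij_inv_eq_iff)
  have "khom (inv_into UNIV h)" unfolding khom_def
  proof (intro conjI allI i)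
    show "h (inv_into UNIV h x + inv_into UNIV h y) = x + y" "h (inv_into UNIV h x * inv_into UNIV h y) = x * y" for x y
      using h(1,2) by (simp_all add: khom_simps surj_f_inv_f bij_is_surj)
    show "h (cst a) = cst a" for a by (rule khom_simps(3)[OF h(1)])
  qed
  moreover have "inv_into UNIV h x = x" if "x \<in> K" for x by (rule i[OF h(3)[OF that]])
  ultimately show ?thesis unfolding Gal_def using h(2) by (simp add: bij_imp_bij_inv)
qed

text \<open>Remainders modulo P: the values of such polynomials at t include every element of k[t]
  (\<open>to_fract_reduced\<close>).\<close>

definition reduced where "reduced r \<longleftrightarrow> Polynomial.degree r < n \<and> (\<forall>i. Polynomial.coeff r i \<in> K)"

lemma reduced_add: "reduced r \<Longrightarrow> reduced s \<Longrightarrow> reduced (r + s)"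
  unfolding reduced_def by (simp add: K_add degree_add_less)

text \<open>Multiplication by t raises the degree to at most n; subtracting the K-multiple of P with
  the same coefficient of index n lowers it again without changing the value at t.\<close>

lemma reduced_tvar_mult:
  assumes "reduced r"
  obtains s where "reduced s" "poly s tvar = tvar * poly r tvar"
proof -
  define c where "c = Polynomial.coeff (pCons 0 r) n / Polynomial.coeff P n"
  define s where "s = pCons 0 r - Polynomial.smult c P"
  have lc: "Polynomial.coeff P n \<noteq> 0" using degree_P P_nonzero by (metis leading_coeff_0_iff)
  have rK: "Polynomial.coeff (pCons 0 r) i \<in> K" for i
    using assms K_01 unfolding reduced_def by (simp add: coeff_pCons split: nat.split)
  then have c: "c \<in> K" unfolding c_def by (intro K_divide rK coeff_P_in_K)
  have "Polynomial.degree (pCons 0 r) \<le> n" using assms unfolding reduced_def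
    by (intro order_trans[OF degree_pCons_le]) simp
  moreover have "Polynomial.degree (Polynomial.smult c P) \<le> n"
    using degree_smult_le[of c P] degree_P by simp
  ultimately have "Polynomial.degree s \<le> n" unfolding s_def by (rule degree_diff_le)
  moreover have "Polynomial.coeff s n = 0" unfolding s_def c_def using lc by simp
  ultimately have "Polynomial.degree s < n" using n_pos
    by (metis degree_0 leading_coeff_0_iff le_neq_implies_less)
  moreover have "Polynomial.coeff s i \<in> K" for i
    unfolding s_def coeff_diff coeff_smult by (intro K_diff K_mult rK c coeff_P_in_K)
  ultimately have "reduced s" unfolding reduced_def by blast
  moreover have "poly s tvar = tvar * poly r tvar" unfolding s_def by (simp add: P_tvar)
  ultimately show ?thesis using that by blast
qed

lemma to_fract_reduced: "\<exists>r. reduced r \<and> poly r tvar = to_fract p"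
proof -
  have "\<exists>r. reduced r \<and> poly r tvar = ev p tvar"
  proof (induction p)
    case 0
    have "reduced 0" unfolding reduced_def using n_pos K_01 by simp
    then show ?case by (intro exI[of _ 0]) simp
  next
    case (pCons a p)
    then obtain r where r: "reduced r" "poly r tvar = ev p tvar" by blast
    obtain s where s: "reduced s" "poly s tvar = tvar * poly r tvar" using reduced_tvar_mult[OF r(1)] .
    have "reduced [:cst a:]" unfolding reduced_def using n_pos K_cst K_01 by (simp add: coeff_pCons split: nat.split)
    then have "reduced ([:cst a:] + s)" using reduced_add s(1) by blast
    then show ?case using r s by (intro exI[of _ "[:cst a:] + s"]) simp
  qed
  then show ?thesis by (simp add: ev_tvar)
qed

lemma Gal_poly_reduced:
  assumes "h \<in> Gal" "reduced r"
  shows "h (poly r x) = poly r (h x)"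
proof -
  have k: "khom h" "\<And>x. x \<in> K \<Longrightarrow> h x = x" using assms(1) unfolding Gal_def by blast+
  have "h (poly r x) = poly r (h x)" if "\<forall>i. Polynomial.coeff r i \<in> K" for r
    using that
  proof (induction r)
    case (pCons a r)
    have "a \<in> K" using pCons.prems by (metis coeff_pCons_0)
    moreover have "\<forall>i. Polynomial.coeff r i \<in> K" using pCons.prems by (metis coeff_pCons_Suc)
    ultimately show ?case using pCons.IH k by (simp add: khom_simps)
  qed (simp add: khom_simps(4)[OF k(1)])
  then show ?thesis using assms(2) unfolding reduced_def by blast
qed

text \<open>If \<open>x = p(t) / q(t)\<close> is fixed, where \<open>p\<close> and \<open>q\<close> have coefficients in \<open>K\<close> and degree less than
  \<open>n\<close>, then \<open>p - x q\<close> vanishes at the \<open>n\<close> conjugates of \<open>t\<close>, so \<open>x\<close> is a quotient of coefficients.\<close>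

lemma fixed_in_K:
  assumes "\<And>h. h \<in> Gal \<Longrightarrow> h x = x"
  shows "x \<in> K"
proof -
  obtain p q where pq: "q \<noteq> 0" "x = to_fract p / to_fract q" using fract_cases .
  obtain r where r: "reduced r" "poly r tvar = to_fract p" using to_fract_reduced by blast
  obtain s where s: "reduced s" "poly s tvar = to_fract q" using to_fract_reduced by blast
  have xs: "poly r tvar = x * poly s tvar" using pq r s by simp
  have "r - Polynomial.smult x s = 0"
  proof (rule poly_eq_by_roots[where n = n and S = "mob_fract ` set Ms"])
    show "Polynomial.degree (r - Polynomial.smult x s) \<le> n"
      using r s degree_smult_le[of x s] unfolding reduced_def by (intro degree_diff_le) auto
    show "Polynomial.coeff (r - Polynomial.smult x s) n = Polynomial.coeff 0 n"
      using r s unfolding reduced_def by (simp add: coeff_eq_0)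
    fix y assume "y \<in> mob_fract ` set Ms"
    then obtain M where M: "M \<in> set Ms" "y = subst (mob_fract M) tvar" using subst_mob_tvar by auto
    define h where "h = subst (mob_fract M)"
    have h: "h \<in> Gal" unfolding h_def using subst_in_Gal[OF M(1)] .
    have "poly r (h tvar) = h (x * poly s tvar)" using Gal_poly_reduced[OF h r(1)] xs by metis
    also have "\<dots> = x * poly s (h tvar)"
      using h assms[OF h] Gal_poly_reduced[OF h s(1)] unfolding Gal_def by (simp add: khom_simps)
    finally show "poly (r - Polynomial.smult x s) y = poly 0 y" by (simp add: M h_def)
  qed (simp_all add: card_mob_fract)
  then have eq: "r = Polynomial.smult x s" by simp
  have "s \<noteq> 0" using s(2) pq(1) by auto
  then obtain i where i: "Polynomial.coeff s i \<noteq> 0" by (auto simp: poly_eq_iff)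
  have "x = Polynomial.coeff r i / Polynomial.coeff s i" using i unfolding eq by simp
  then show ?thesis using r s K_divide unfolding reduced_def by simp
qed

text \<open>The product of X - h(x) over h in \<open>Gal\<close> has the root x. Each g in
  \<open>Gal\<close> permutes its factors, so the coefficients are fixed and lie in K by
  \<open>fixed_in_K\<close>.\<close>

lemma algebraic_over_K:
  "\<exists>Q. Q \<noteq> 0 \<and> (\<forall>i. Polynomial.coeff Q i \<in> K) \<and> poly Q x = 0"
proof -
  define Q where "Q = (\<Prod>h\<in>Gal. [:- h x, 1:])"
  have "Q \<noteq> 0" unfolding Q_def using finite_Gal by simp
  moreover have "poly Q x = 0"
    unfolding Q_def poly_prod by (rule prod_zero[OF finite_Gal bexI[OF _ Gal_id]]) simp
  moreover have "Polynomial.coeff Q i \<in> K" for i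
  proof (rule fixed_in_K)
    fix g assume g: "g \<in> Gal"
    then have k: "khom g" unfolding Gal_def by blast
    have mult: "map_poly g (p * q) = map_poly g p * map_poly g q" for p q
    proof (rule Polynomial.poly_eqI)
      have "g (\<Sum>i\<in>I. a i) = (\<Sum>i\<in>I. g (a i))" for I :: "nat set" and a
        by (induction I rule: infinite_finite_induct) (auto simp: khom_simps[OF k])
      then show "Polynomial.coeff (map_poly g (p * q)) i = Polynomial.coeff (map_poly g p * map_poly g q) i" for i
        by (simp add: coeff_map_poly khom_simps[OF k] coeff_mult)
    qed
    have "map_poly g (\<Prod>h\<in>A. [:- h x, 1:]) = (\<Prod>h\<in>A. [:- g (h x), 1:])" for A :: "('a poly fract \<Rightarrow> 'a poly fract) set"
    proof (induction A rule: infinite_finite_induct)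
      case (insert h A)
      then show ?case by (simp add: mult map_poly_pCons khom_simps[OF k] del: mult_pCons_left)
    qed (simp_all add: khom_simps[OF k])
    then have "map_poly g Q = (\<Prod>h\<in>Gal. [:- (g \<circ> h) x, 1:])" unfolding Q_def by simp
    also have "\<dots> = Q"
      unfolding Q_def
    proof (rule prod.reindex_bij_witness[where i = "\<lambda>h. inv_into UNIV g \<circ> h" and j = "\<lambda>h. g \<circ> h"])
      have b: "bij g" using g unfolding Gal_def by blast
      show "inv_into UNIV g \<circ> (g \<circ> h) = h" "g \<circ> (inv_into UNIV g \<circ> h) = h" for h
        using b by (simp_all add: fun_eq_iff bij_is_inj bij_is_surj surj_f_inv_f)
    qed (use g Gal_comp Gal_inv in auto)
    finally show "g (Polynomial.coeff Q i) = Polynomial.coeff Q i"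
      by (metis coeff_map_poly khom_simps(4)[OF k])
  qed
  ultimately show ?thesis by blast
qed

end

section \<open>Recognizing Z/4, Z/5 and (Z/2)^2\<close>

section \<open>Groups of order four and five\<close>

lemma (in group) iso_integer_mod_group:
  assumes "x \<in> carrier G" "ord x = order G" "order G > 0"
  shows "G \<cong> integer_mod_group (order G)"
proof -
  let ?Z = "integer_mod_group (order G)"
  have carr: "carrier ?Z = {0..<int (order G)}" using assms(3) by (simp add: carrier_integer_mod_group)
  define h where "h i = x [^] i" for i :: int
  have hom: "h \<in> hom ?Z G"
  proof (rule homI)
    fix i j
    have "int (ord x) dvd (i + j) - (i + j) mod int (order G)" unfolding assms(2) by (rule dvd_minus_mod)
    then have "h ((i + j) mod int (order G)) = h (i + j)"
      unfolding h_def int_pow_eq[OF assms(1)] .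
    also have "\<dots> = h i \<otimes> h j" unfolding h_def using assms(1) by (simp add: int_pow_mult)
    finally show "h (i \<otimes>\<^bsub>?Z\<^esub> j) = h i \<otimes> h j" by simp
  qed (simp add: h_def assms(1))
  moreover have "bij_betw h (carrier ?Z) (carrier G)"
  proof (rule bij_betw_imageI)
    show inj: "inj_on h (carrier ?Z)"
    proof (rule inj_onI)
      fix i j assume ij: "i \<in> carrier ?Z" "j \<in> carrier ?Z" "h i = h j"
      then have "int (order G) dvd j - i" using int_pow_eq[OF assms(1)] assms(2) by (simp add: h_def)
      moreover have "\<bar>j - i\<bar> < int (order G)" using ij carr by auto
      ultimately show "i = j" using dvd_imp_le_int[of "j - i" "int (order G)"] by linarith
    qed
    have "finite (carrier G)" using assms(3) order_gt_0_iff_finite by blast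
    moreover have "h ` carrier ?Z \<subseteq> carrier G" using assms(1) by (auto simp: h_def)
    moreover have "card (h ` carrier ?Z) = card (carrier G)"
      using card_image[OF inj] carr by (simp add: order_def)
    ultimately show "h ` carrier ?Z = carrier G" by (rule card_subset_eq)
  qed
  ultimately have "h \<in> iso ?Z G" by (rule isoI)
  then show ?thesis using group.iso_set_sym[OF group_integer_mod_group] is_isoI by blast
qed

text \<open>The order of x divides 4 but not 2, so x is a generator.\<close>

lemma (in group) iso_Z4:
  assumes "order G = 4" "x \<in> carrier G" "x \<otimes> x \<noteq> \<one>"
  shows "G \<cong> integer_mod_group 4"
proof -
  have "ord x dvd 4" using ord_dvd_group_order[OF assms(2)] assms(1) by simp
  then have "ord x \<le> 4" by (simp add: dvd_imp_le)
  have ns: "\<not> ord x dvd 2" using pow_eq_id[OF assms(2), of 2] assms(2,3) by (simp add: numeral_2_eq_2)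
  have "ord x \<noteq> 0" using \<open>ord x dvd 4\<close> by (intro notI) simp
  moreover have "ord x \<noteq> 1" "ord x \<noteq> 2" "ord x \<noteq> 3" using \<open>ord x dvd 4\<close> ns by auto
  ultimately have "ord x = 4" using \<open>ord x \<le> 4\<close> by linarith
  then show ?thesis using iso_integer_mod_group[OF assms(2)] assms(1) by simp
qed

lemma (in group) iso_Z5:
  assumes "order G = 5"
  shows "G \<cong> integer_mod_group 5"
proof -
  have "card (carrier G) = 5" using assms by (simp add: order_def)
  then have "\<not> carrier G \<subseteq> {\<one>}" using card_mono[of "{\<one>}" "carrier G"] by auto
  then obtain x where x: "x \<in> carrier G" "x \<noteq> \<one>" by blast
  have "Factorial_Ring.prime (5::nat)" by simp
  moreover have "ord x dvd 5" using ord_dvd_group_order[OF x(1)] assms by simp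
  moreover have "ord x \<noteq> 1" using ord_eq_1[OF x(1)] x(2) by blast
  ultimately have "ord x = 5" by (metis prime_nat_iff)
  then show ?thesis using iso_integer_mod_group[OF x(1)] assms by simp
qed

text \<open>All elements being their own inverses, the group is commutative. Elements x \<noteq> 1
  and y outside {1, x} yield the four distinct elements 1, x, y, x y.\<close>

lemma (in group) iso_Z2_Z2:
  assumes "order G = 4" "\<And>x. x \<in> carrier G \<Longrightarrow> x \<otimes> x = \<one>"
  shows "G \<cong> integer_mod_group 2 \<times>\<times> integer_mod_group 2"
proof -
  let ?Z = "integer_mod_group 2"
  have carr: "carrier ?Z = {0, 1}" by (auto simp: carrier_integer_mod_group)
  have fin: "finite (carrier G)" using assms(1) order_gt_0_iff_finite by simp
  have card4: "card (carrier G) = 4" using assms(1) by (simp add: order_def)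
  have "\<not> carrier G \<subseteq> {\<one>}" using card_mono[of "{\<one>}" "carrier G"] card4 by auto
  then obtain x where x: "x \<in> carrier G" "x \<noteq> \<one>" by blast
  have "card {\<one>, x} \<le> 2" by (simp add: card_insert_if)
  then have "\<not> carrier G \<subseteq> {\<one>, x}" using card_mono[of "{\<one>, x}" "carrier G"] card4 by auto
  then obtain y where y: "y \<in> carrier G" "y \<noteq> \<one>" "y \<noteq> x" by blast
  have inv: "inv z = z" if "z \<in> carrier G" for z using assms(2)[OF that] that by (metis inv_equality)
  have comm: "y \<otimes> x = x \<otimes> y" using inv[of "x \<otimes> y"] inv_mult_group[OF x(1) y(1)] inv x y by simp
  have xx: "x \<otimes> x = \<one>" "y \<otimes> y = \<one>" using assms(2) x y by auto
  have xxz: "x \<otimes> (x \<otimes> z) = z" "y \<otimes> (y \<otimes> z) = z" if "z \<in> carrier G" for z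
    using that x y xx by (simp_all add: m_assoc[symmetric])
  have comm': "y \<otimes> (x \<otimes> z) = x \<otimes> (y \<otimes> z)" if "z \<in> carrier G" for z
    using that x y comm by (simp add: m_assoc[symmetric])
  define h where "h = (\<lambda>(i, j). (if i = (0::int) then \<one> else x) \<otimes> (if j = (0::int) then \<one> else y))"
  have hom: "h \<in> hom (?Z \<times>\<times> ?Z) G"
    by (rule homI) (use x y in \<open>auto simp: h_def carr xx xxz comm comm' m_assoc\<close>)
  moreover have "bij_betw h (carrier (?Z \<times>\<times> ?Z)) (carrier G)"
  proof (rule bij_betw_imageI)
    have xy: "x \<otimes> y \<noteq> \<one>" "x \<otimes> y \<noteq> x" "x \<otimes> y \<noteq> y"
      using x y inv inv_equality[of x y] by (auto simp: r_cancel_one' l_cancel_one')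
    show inj: "inj_on h (carrier (?Z \<times>\<times> ?Z))"
      by (rule inj_onI) (use x y xy xy[symmetric] in \<open>auto simp: h_def carr\<close>)
    have "h ` carrier (?Z \<times>\<times> ?Z) \<subseteq> carrier G" using x y by (auto simp: h_def)
    moreover have "card (h ` carrier (?Z \<times>\<times> ?Z)) = card (carrier G)"
      using card_image[OF inj] card4 by (simp add: carr card_cartesian_product)
    ultimately show "h ` carrier (?Z \<times>\<times> ?Z) = carrier G" by (rule card_subset_eq[OF fin])
  qed
  ultimately have "h \<in> iso (?Z \<times>\<times> ?Z) G" by (rule isoI)
  moreover have "group (?Z \<times>\<times> ?Z)" by (rule DirProd_group) simp_all
  ultimately show ?thesis using group.iso_set_sym is_isoI by blast
qed


section \<open>Passage from a field given as a type to an isomorphic ring with carrier\<close>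

section \<open>Galois extensions under field isomorphisms\<close>

definition field_automorphisms :: "'b::field set \<Rightarrow> ('b \<Rightarrow> 'b) set" where
  "field_automorphisms K = {h. (\<forall>x y. h (x + y) = h x + h y) \<and> (\<forall>x y. h (x * y) = h x * h y) \<and>
    bij h \<and> (\<forall>x\<in>K. h x = x)}"

definition comp_monoid :: "('b \<Rightarrow> 'b) set \<Rightarrow> ('b \<Rightarrow> 'b) monoid" where
  "comp_monoid S = \<lparr>carrier = S, monoid.mult = (\<circ>), one = id\<rparr>"

text \<open>Polynomials of HOL-Algebra are lists with the leading coefficient first, hence the
  reversal.\<close>

lemma eval_rev_coeffs:
  fixes p :: "'b::field poly"
  shows "ring.eval ring_of_type_algebra (rev (coeffs p)) x = poly p x"
proof -
  interpret R: field "ring_of_type_algebra :: 'b ring" by (rule field_from_type_algebra)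
  have pow: "x [^]\<^bsub>ring_of_type_algebra\<^esub> k = x ^ k" for x :: 'b and k :: nat
    by (induction k) (simp_all add: ring_of_type_algebra_def nat_pow_def)
  have "R.eval l x = poly (Poly (rev l)) x" for l
    by (induction l) (simp_all add: pow Poly_append poly_monom, simp_all add: ring_of_type_algebra_def)
  then show ?thesis by simp
qed

text \<open>The field theory above lives in a type, whereas \<open>galois_extension\<close> concerns
  a ring with a carrier. The condition on zero is listed separately because a
  \<open>ring_iso\<close> speaks only of one, sums and products; it is what makes L a field.\<close>

locale galois_transport =
  fixes L :: "('c, 'm) ring_scheme" and \<Theta> :: "'b::field \<Rightarrow> 'c" and K :: "'b set"
  assumes iso: "\<Theta> \<in> ring_iso ring_of_type_algebra L"
    and zero: "\<Theta> 0 = \<zero>\<^bsub>L\<^esub>"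
    and one_K: "1 \<in> K"
    and add_K: "\<And>x y. x \<in> K \<Longrightarrow> y \<in> K \<Longrightarrow> x + y \<in> K"
    and mult_K: "\<And>x y. x \<in> K \<Longrightarrow> y \<in> K \<Longrightarrow> x * y \<in> K"
    and minus_K: "\<And>x. x \<in> K \<Longrightarrow> - x \<in> K"
    and inverse_K: "\<And>x. x \<in> K \<Longrightarrow> inverse x \<in> K"
    and algebraic_K: "\<And>x. \<exists>Q. Q \<noteq> 0 \<and> (\<forall>i. Polynomial.coeff Q i \<in> K) \<and> poly Q x = 0"
    and fixed_K: "\<And>x. (\<And>h. h \<in> field_automorphisms K \<Longrightarrow> h x = x) \<Longrightarrow> x \<in> K"
begin

abbreviation R :: "'b ring" where "R \<equiv> ring_of_type_algebra"

lemma R_simps: "carrier R = UNIV" "x \<otimes>\<^bsub>R\<^esub> y = x * y" "x \<oplus>\<^bsub>R\<^esub> y = x + y" "\<one>\<^bsub>R\<^esub> = 1" "\<zero>\<^bsub>R\<^esub> = 0"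
  by (simp_all add: ring_of_type_algebra_def)

lemma field_R: "field R" by (rule field_from_type_algebra)

lemma field_L: "field L"
  using field.ring_iso_imp_img_field[OF field_R iso] zero by (simp add: R_simps)

lemma hom_\<Theta>: "\<Theta> x \<in> carrier L" "\<Theta> (x * y) = \<Theta> x \<otimes>\<^bsub>L\<^esub> \<Theta> y" "\<Theta> (x + y) = \<Theta> x \<oplus>\<^bsub>L\<^esub> \<Theta> y" "\<Theta> 1 = \<one>\<^bsub>L\<^esub>"
  using ring_iso_memE(1-4)[OF iso] by (simp_all add: R_simps)

lemma bij_\<Theta>: "bij_betw \<Theta> UNIV (carrier L)"
  using ring_iso_memE(5)[OF iso] by (simp add: R_simps)

lemma inj_\<Theta>: "\<Theta> x = \<Theta> y \<longleftrightarrow> x = y"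
  using bij_\<Theta> by (auto simp: bij_betw_def inj_on_def)

lemma hom_ring: "ring_hom_ring R L \<Theta>"
proof (rule ring_hom_ringI2)
  show "ring R" "ring L" using field_R field_L by (simp_all add: field_def domain_def cring_def)
  show "\<Theta> \<in> ring_hom R L" using iso by (simp add: ring_iso_def)
qed

lemma subfield_R: "subfield K R"
proof -
  interpret R: field R by (rule field_R)
  have neg: "\<ominus>\<^bsub>R\<^esub> x = - x" for x
    by (rule R.minus_equality) (simp_all add: R_simps)
  have inv: "inv\<^bsub>R\<^esub> x = inverse x" if "x \<noteq> 0" for x
    by (rule R.inv_unique'[symmetric]) (use that in \<open>simp_all add: R_simps\<close>)
  show ?thesis
  proof (rule R.subfieldI')
    show "subring K R"
      by (rule R.subringI) (auto simp: R_simps neg one_K add_K mult_K minus_K)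
    show "inv\<^bsub>R\<^esub> k \<in> K" if "k \<in> K - {\<zero>\<^bsub>R\<^esub>}" for k
      using that inverse_K by (simp add: R_simps inv)
  qed
qed

lemma subfield_L: "subfield (\<Theta> ` K) L"
proof (rule ring_hom_ring.img_is_subfield(2)[OF hom_ring subfield_R])
  interpret L: field L by (rule field_L)
  show "\<one>\<^bsub>L\<^esub> \<noteq> \<zero>\<^bsub>L\<^esub>" by simp
qed

lemma algebraic_L:
  assumes "x \<in> carrier L"
  shows "ring.algebraic L (\<Theta> ` K) x"
proof -
  interpret L: field L by (rule field_L)
  interpret H: ring_hom_ring R L \<Theta> by (rule hom_ring)
  obtain y where y: "x = \<Theta> y" using assms bij_\<Theta> by (auto simp: bij_betw_def)
  obtain Q where Q: "Q \<noteq> 0" "\<And>i. Polynomial.coeff Q i \<in> K" "poly Q y = 0" using algebraic_K by blast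
  define p where "p = map \<Theta> (rev (coeffs Q))"
  have ne: "coeffs Q \<noteq> []" using Q(1) by simp
  have "hd p = \<Theta> (Polynomial.lead_coeff Q)"
    unfolding p_def using ne by (simp add: hd_map hd_rev last_coeffs_eq_coeff_degree Q(1))
  moreover have "\<Theta> (Polynomial.lead_coeff Q) \<noteq> \<zero>\<^bsub>L\<^esub>"
    unfolding zero[symmetric] inj_\<Theta> using Q(1) by simp
  moreover have "set p \<subseteq> \<Theta> ` K"
    unfolding p_def using Q(2) by (auto simp: coeffs_def)
  ultimately have "p \<in> carrier ((\<Theta> ` K)[X]\<^bsub>L\<^esub>)"
    unfolding univ_poly_carrier[symmetric] polynomial_def by simp
  moreover have "p \<noteq> []" using ne by (simp add: p_def)
  moreover have "L.eval p x = \<zero>\<^bsub>L\<^esub>"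
  proof -
    have "L.eval p x = \<Theta> (ring.eval R (rev (coeffs Q)) y)"
      unfolding p_def y by (rule H.eval_hom'[symmetric]) (simp_all add: R_simps)
    then show ?thesis by (simp add: eval_rev_coeffs Q(3) zero)
  qed
  ultimately have "(L.algebraic over \<Theta> ` K) x" by (rule L.algebraicI)
  then show ?thesis by (simp add: over_def)
qed

definition \<Psi> where "\<Psi> = inv_into UNIV \<Theta>"

lemma \<Psi>: "\<Psi> (\<Theta> x) = x" "y \<in> carrier L \<Longrightarrow> \<Theta> (\<Psi> y) = y"
  using bij_\<Theta> unfolding \<Psi>_def bij_betw_def by (auto simp: f_inv_into_f)

lemma carrier_L_cases:
  assumes "x \<in> carrier L" obtains y where "x = \<Theta> y"
  using \<Psi>(2)[OF assms] by metis

text \<open>Members of \<open>Bij\<close> are extensional, so the conjugate of h must be restricted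
  to the carrier for \<open>lift\<close> to be inverse to \<open>lower\<close>.\<close>

definition lift where "lift h = restrict (\<lambda>x. \<Theta> (h (\<Psi> x))) (carrier L)"

definition lower where "lower \<sigma> = (\<lambda>y. \<Psi> (\<sigma> (\<Theta> y)))"

lemma lift_\<Theta>: "lift h (\<Theta> y) = \<Theta> (h y)"
  by (simp add: lift_def hom_\<Theta> \<Psi>)

lemma carrier_galois_group:
  "carrier (galois_group (\<Theta> ` K) L) = {\<sigma> \<in> ring_hom L L \<inter> Bij (carrier L). \<forall>x\<in>\<Theta> ` K. \<sigma> x = x}"
  by (simp add: galois_group_def)

lemma lift_in_galois_group:
  assumes "h \<in> field_automorphisms K"
  shows "lift h \<in> carrier (galois_group (\<Theta> ` K) L)"
proof -
  have h: "\<And>x y. h (x + y) = h x + h y" "\<And>x y. h (x * y) = h x * h y" "bij h" "\<And>x. x \<in> K \<Longrightarrow> h x = x"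
    using assms unfolding field_automorphisms_def by blast+
  have "lift h \<in> ring_hom L L"
  proof (rule ring_hom_memI)
    show "lift h x \<in> carrier L" if "x \<in> carrier L" for x
      using that by (simp add: lift_def hom_\<Theta>)
    fix x y assume "x \<in> carrier L" "y \<in> carrier L"
    then obtain x' y' where xy: "x = \<Theta> x'" "y = \<Theta> y'" using carrier_L_cases by metis
    show "lift h (x \<otimes>\<^bsub>L\<^esub> y) = lift h x \<otimes>\<^bsub>L\<^esub> lift h y" "lift h (x \<oplus>\<^bsub>L\<^esub> y) = lift h x \<oplus>\<^bsub>L\<^esub> lift h y"
      unfolding xy hom_\<Theta>(2,3)[symmetric] lift_\<Theta> h(1,2) by (simp_all add: hom_\<Theta>)
  next
    show "lift h \<one>\<^bsub>L\<^esub> = \<one>\<^bsub>L\<^esub>" unfolding hom_\<Theta>(4)[symmetric] lift_\<Theta> h(4)[OF one_K] ..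
  qed
  moreover have "lift h \<in> Bij (carrier L)"
  proof -
    have "bij_betw (\<Theta> \<circ> h \<circ> \<Psi>) (carrier L) (carrier L)"
    proof (rule bij_betw_trans)
      show "bij_betw \<Psi> (carrier L) UNIV" unfolding \<Psi>_def by (rule bij_betw_inv_into[OF bij_\<Theta>])
      show "bij_betw (\<Theta> \<circ> h) UNIV (carrier L)" by (rule bij_betw_trans[OF h(3) bij_\<Theta>])
    qed
    then have "bij_betw (lift h) (carrier L) (carrier L)"
      by (rule bij_betw_cong[THEN iffD1, rotated]) (simp add: lift_def)
    then show ?thesis unfolding Bij_def by (simp add: lift_def)
  qed
  moreover have "\<forall>x\<in>\<Theta> ` K. lift h x = x" by (auto simp: lift_\<Theta> h(4))
  ultimately show ?thesis unfolding carrier_galois_group by blast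
qed

lemma lower_in_automorphisms:
  assumes "\<sigma> \<in> carrier (galois_group (\<Theta> ` K) L)"
  shows "lower \<sigma> \<in> field_automorphisms K" "lift (lower \<sigma>) = \<sigma>"
proof -
  have \<sigma>: "\<sigma> \<in> ring_hom L L" "\<sigma> \<in> Bij (carrier L)" "\<And>x. x \<in> K \<Longrightarrow> \<sigma> (\<Theta> x) = \<Theta> x"
    using assms unfolding carrier_galois_group by auto
  have c: "\<sigma> (\<Theta> x) \<in> carrier L" for x using ring_hom_memE(1)[OF \<sigma>(1)] hom_\<Theta>(1) by blast
  have l: "\<Theta> (lower \<sigma> x) = \<sigma> (\<Theta> x)" for x unfolding lower_def by (rule \<Psi>(2)[OF c])
  have "lower \<sigma> (x + y) = lower \<sigma> x + lower \<sigma> y" "lower \<sigma> (x * y) = lower \<sigma> x * lower \<sigma> y" for x y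
    using ring_hom_memE(2,3)[OF \<sigma>(1) hom_\<Theta>(1) hom_\<Theta>(1)]
    by (simp_all add: inj_\<Theta>[symmetric] hom_\<Theta>(2,3) l)
  moreover have "bij (lower \<sigma>)"
  proof -
    have "bij_betw (\<Psi> \<circ> (\<sigma> \<circ> \<Theta>)) UNIV UNIV"
      using \<sigma>(2) unfolding Bij_def \<Psi>_def
      by (intro bij_betw_trans[OF bij_betw_trans[OF bij_\<Theta>] bij_betw_inv_into[OF bij_\<Theta>]]) simp
    then show ?thesis by (simp add: lower_def comp_def)
  qed
  moreover have "lower \<sigma> x = x" if "x \<in> K" for x using \<sigma>(3)[OF that] l[of x] by (simp add: inj_\<Theta>)
  ultimately show "lower \<sigma> \<in> field_automorphisms K" unfolding field_automorphisms_def by blast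
  show "lift (lower \<sigma>) = \<sigma>"
  proof (rule extensionalityI)
    show "\<sigma> \<in> extensional (carrier L)" using \<sigma>(2) by (simp add: Bij_def)
    show "lift (lower \<sigma>) x = \<sigma> x" if "x \<in> carrier L" for x
      using that l by (auto elim!: carrier_L_cases simp: lift_\<Theta>)
  qed (simp add: lift_def)
qed

lemma lower_lift: "lower (lift h) = h"
  by (simp add: fun_eq_iff lower_def lift_\<Theta> \<Psi>)

theorem galois_extension_L: "galois_extension (\<Theta> ` K) L"
  unfolding galois_extension_def
proof (intro conjI ballI)
  show "field L" "subfield (\<Theta> ` K) L" by (rule field_L, rule subfield_L)
  show "ring.algebraic L (\<Theta> ` K) x" if "x \<in> carrier L" for x by (rule algebraic_L[OF that])
  show "{x \<in> carrier L. \<forall>\<sigma>\<in>carrier (galois_group (\<Theta> ` K) L). \<sigma> x = x} = \<Theta> ` K" (is "?A = _")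
  proof (rule Set.equalityI; rule subsetI)
    fix x assume x: "x \<in> ?A"
    then obtain y where y: "x = \<Theta> y" using carrier_L_cases by blast
    have "h y = y" if "h \<in> field_automorphisms K" for h
    proof -
      have "lift h (\<Theta> y) = \<Theta> y" using x lift_in_galois_group[OF that] unfolding y by blast
      then show ?thesis by (simp add: lift_\<Theta> inj_\<Theta>)
    qed
    then show "x \<in> \<Theta> ` K" unfolding y using fixed_K by blast
  qed (auto simp: carrier_galois_group hom_\<Theta>(1))
qed

theorem galois_group_iso: "galois_group (\<Theta> ` K) L \<cong> comp_monoid (field_automorphisms K)"
proof (rule is_isoI[OF isoI])
  show "lower \<in> hom (galois_group (\<Theta> ` K) L) (comp_monoid (field_automorphisms K))"
  proof (rule homI)
    fix \<sigma> \<tau> assume st: "\<sigma> \<in> carrier (galois_group (\<Theta> ` K) L)" "\<tau> \<in> carrier (galois_group (\<Theta> ` K) L)"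
    then have B: "\<sigma> \<in> Bij (carrier L)" "\<tau> \<in> Bij (carrier L)" unfolding carrier_galois_group by auto
    have m: "\<sigma> \<otimes>\<^bsub>galois_group (\<Theta> ` K) L\<^esub> \<tau> = compose (carrier L) \<sigma> \<tau>"
      using B by (simp add: galois_group_def BijGroup_def)
    have c: "\<tau> (\<Theta> y) \<in> carrier L" for y using Bij_imp_funcset[OF B(2)] hom_\<Theta>(1) by blast
    show "lower (\<sigma> \<otimes>\<^bsub>galois_group (\<Theta> ` K) L\<^esub> \<tau>) = lower \<sigma> \<otimes>\<^bsub>comp_monoid (field_automorphisms K)\<^esub> lower \<tau>"
      unfolding m by (simp add: comp_monoid_def fun_eq_iff lower_def compose_def hom_\<Theta>(1) \<Psi>(2)[OF c])
  qed (simp add: comp_monoid_def lower_in_automorphisms)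
  show "bij_betw lower (carrier (galois_group (\<Theta> ` K) L)) (carrier (comp_monoid (field_automorphisms K)))"
    by (rule bij_betwI[where g = lift])
      (auto simp: comp_monoid_def lower_in_automorphisms lift_in_galois_group lower_lift)
qed

end

section \<open>Identification of the function field of the curve with k(t), and of its projection
  fields\<close>

section \<open>The function field of a parametrized curve\<close>

lemma form3_homogenized:
  assumes "form3 e A" "form3 e B"
  shows "form3 (d * e) (\<Sum>i\<le>d. const3 (c i) * A ^ i * B ^ (d - i))"
proof (rule form3_sum)
  fix i assume "i \<in> {..d}"
  then have "0 + i * e + (d - i) * e = d * e" by (simp add: add_mult_distrib[symmetric])
  with form3_mult[OF form3_mult[OF form3_const3[of "c i"] form3_power[OF assms(1), of i]]
    form3_power[OF assms(2), of "d - i"]]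
  show "form3 (d * e) (const3 (c i) * A ^ i * B ^ (d - i))" by metis
qed

context plane_param
begin

text \<open>F along the parametrization in the chart w = 1, as a polynomial in t; it is chosen by
  its values, which determine it over an infinite field.\<close>

definition pullback :: "'a poly3 \<Rightarrow> 'a poly" where
  "pullback F = (SOME p. poly p = (\<lambda>t. eval3 F (\<phi> t 1)))"

lemma poly_pullback: "poly (pullback F) t = eval3 F (\<phi> t 1)"
proof -
  obtain P where "\<And>u w. eval3 F (\<phi> u w) = poly (poly P [:w:]) u"
    using polyfun_param[of F] unfolding polyfun_def by blast
  then have "poly (poly P [:1:]) = (\<lambda>t. eval3 F (\<phi> t 1))" by (simp add: fun_eq_iff)
  then have "poly (pullback F) = (\<lambda>t. eval3 F (\<phi> t 1))" unfolding pullback_def by (rule someI)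
  then show ?thesis by (rule fun_cong)
qed

lemma pullback_simps:
  "pullback (F + G) = pullback F + pullback G" "pullback (F * G) = pullback F * pullback G"
  "pullback (F - G) = pullback F - pullback G" "pullback 0 = 0" "pullback 1 = 1"
  by (rule poly_eqI_all; simp add: poly_pullback)+

text \<open>The chart w = 1 determines all values with w \<noteq> 0 by homogeneity, and density
  covers w = 0.\<close>

lemma pullback_eq_0_iff:
  assumes "form3 d F"
  shows "pullback F = 0 \<longleftrightarrow> (\<forall>u w. eval3 F (\<phi> u w) = 0)"
proof
  assume 0: "pullback F = 0"
  have "eval3 F (\<phi> u w) = 0" for u w
  proof (rule polyfun_generic_eq_0[where I = "{()}" and f = "\<lambda>_ u w. w" and g = "\<lambda>u w. eval3 F (\<phi> u w)"])
    show "\<exists>u w. (w :: 'a) \<noteq> 0" by (rule exI, rule exI[of _ 1]) simp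
    fix u w :: 'a assume "\<And>i. i \<in> {()} \<Longrightarrow> w \<noteq> 0"
    then have "w \<noteq> 0" by simp
    then have "\<phi> u w = w ^ N *s \<phi> (u / w) 1" using param_scale[of w "u / w" 1] by simp
    then have "eval3 F (\<phi> u w) = (w ^ N) ^ d * poly (pullback F) (u / w)"
      using form3_scale[OF assms] by (simp add: poly_pullback)
    with 0 show "eval3 F (\<phi> u w) = 0" by simp
  qed (simp_all add: polyfun_snd polyfun_param)
  then show "\<forall>u w. eval3 F (\<phi> u w) = 0" by blast
next
  assume "\<forall>u w. eval3 F (\<phi> u w) = 0"
  then show "pullback F = 0" by (intro poly_eqI_all) (simp add: poly_pullback)
qed

lemma vanishes3_iff_pullback:
  assumes "form3 d F"
  shows "(\<forall>q\<in>curve. vanishes3 F q) \<longleftrightarrow> pullback F = 0"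
proof
  assume "\<forall>q\<in>curve. vanishes3 F q"
  then have *: "\<forall>u w. u \<noteq> 0 \<or> w \<noteq> 0 \<longrightarrow> eval3 F (\<phi> u w) = 0" unfolding vanishes3_on_curve_iff[OF assms] .
  show "pullback F = 0" by (rule poly_eqI_all) (use * in \<open>simp add: poly_pullback\<close>)
next
  assume "pullback F = 0"
  then show "\<forall>q\<in>curve. vanishes3 F q"
    unfolding vanishes3_on_curve_iff[OF assms] pullback_eq_0_iff[OF assms] by blast
qed

lemma fractions_iff:
  "(F, G) \<in> fractions curve \<longleftrightarrow> (\<exists>d. form3 d F \<and> form3 d G) \<and> pullback G \<noteq> 0"
  unfolding fractions_def using vanishes3_iff_pullback by auto

definition rat :: "'a poly3 \<times> 'a poly3 \<Rightarrow> 'a poly fract" where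
  "rat = (\<lambda>(F, G). to_fract (pullback F) / to_fract (pullback G))"

lemma fraction_rel_iff:
  "(x, y) \<in> fraction_rel curve \<longleftrightarrow> x \<in> fractions curve \<and> y \<in> fractions curve \<and> rat x = rat y"
proof -
  obtain F G F' G' where xy: "x = (F, G)" "y = (F', G')" by (cases x, cases y) blast
  show ?thesis
  proof (cases "x \<in> fractions curve \<and> y \<in> fractions curve")
    case True
    then obtain d d' where d: "form3 d F" "form3 d G" "form3 d' F'" "form3 d' G'"
      and nz: "pullback G \<noteq> 0" "pullback G' \<noteq> 0"
      unfolding xy fractions_iff by blast
    have f: "form3 (d + d') (F * G' - F' * G)"
      using form3_diff[OF form3_mult[OF d(1,4)]] form3_mult[OF d(3,2)] by (simp add: add.commute)
    then have "(\<forall>p\<in>curve. vanishes3 (F * G' - F' * G) p) \<longleftrightarrow> pullback F * pullback G' = pullback F' * pullback G"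
      unfolding vanishes3_iff_pullback[OF f] by (simp add: pullback_simps)
    also have "\<dots> \<longleftrightarrow> to_fract (pullback F * pullback G') = to_fract (pullback F' * pullback G)"
      by (rule to_fract_eq_iff[symmetric])
    also have "\<dots> \<longleftrightarrow> rat x = rat y" using nz by (simp add: rat_def xy frac_eq_eq)
    finally show ?thesis using True unfolding fraction_rel_def xy by blast
  next
    case False
    then show ?thesis unfolding fraction_rel_def xy by blast
  qed
qed

text \<open>The set of all fractions that pull back to x. By \<open>fraction_rel_iff\<close> this is
  one full equivalence class as soon as it is nonempty.\<close>

definition \<Theta> :: "'a poly fract \<Rightarrow> ('a poly3 \<times> 'a poly3) set" where
  "\<Theta> x = {fg \<in> fractions curve. rat fg = x}"

lemma fraction_rel_image: "x \<in> fractions curve \<Longrightarrow> fraction_rel curve `` {x} = \<Theta> (rat x)"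
  by (rule Set.set_eqI) (simp add: \<Theta>_def fraction_rel_iff eq_commute)

lemma pullback_H2: "pullback H2 \<noteq> 0"
  using H2_nonzero pullback_eq_0_iff[OF form_H(2)] by blast

lemma pullback_sum: "poly (pullback (\<Sum>i\<in>I. const3 (c i) * A ^ i * B ^ (d - i))) t
    = (\<Sum>i\<in>I. c i * eval3 A (\<phi> t 1) ^ i * eval3 B (\<phi> t 1) ^ (d - i))"
  by (simp add: poly_pullback eval3_sum)

text \<open>Since H1/H2 pulls back to t, inserting H1 and H2 into the homogenizations of p and q of
  a common degree d gives forms pulling back to H2^d p and H2^d q; the factor H2^d cancels in the
  quotient.\<close>

lemma \<Theta>_nonempty: "\<exists>fg. fg \<in> \<Theta> x"
proof -
  obtain p q where pq: "q \<noteq> 0" "x = to_fract p / to_fract q" using fract_cases .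
  define d where "d = max (Polynomial.degree p) (Polynomial.degree q)"
  define hom where "hom r = (\<Sum>i\<le>d. const3 (Polynomial.coeff r i) * H1 ^ i * H2 ^ (d - i))" for r
  have pb: "pullback (hom r) = pullback H2 ^ d * r" if "Polynomial.degree r \<le> d" for r
  proof (rule poly_eqI_all)
    fix t
    define b where "b = eval3 H2 (\<phi> t 1)"
    have a: "eval3 H1 (\<phi> t 1) = t * b" using inverse_H[of 1 t] by (simp add: b_def)
    have "poly (pullback (hom r)) t = (\<Sum>i\<le>d. Polynomial.coeff r i * (t * b) ^ i * b ^ (d - i))"
      unfolding hom_def pullback_sum a b_def ..
    also have "\<dots> = (\<Sum>i\<le>d. b ^ d * (Polynomial.coeff r i * t ^ i))"
    proof (rule sum.cong)
      fix i assume "i \<in> {..d}"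
      then have "b ^ d = b ^ i * b ^ (d - i)" by (simp add: power_add[symmetric])
      then show "Polynomial.coeff r i * (t * b) ^ i * b ^ (d - i) = b ^ d * (Polynomial.coeff r i * t ^ i)"
        by (simp add: power_mult_distrib)
    qed simp
    also have "\<dots> = b ^ d * (\<Sum>i\<le>d. Polynomial.coeff r i * t ^ i)" by (simp add: sum_distrib_left)
    also have "(\<Sum>i\<le>d. Polynomial.coeff r i * t ^ i) = poly r t"
      unfolding poly_altdef by (rule sum.mono_neutral_right) (use that in \<open>auto simp: coeff_eq_0\<close>)
    finally show "poly (pullback (hom r)) t = poly (pullback H2 ^ d * r) t"
      by (simp add: poly_pullback b_def poly_power)
  qed
  have "form3 (d * e) (hom p)" "form3 (d * e) (hom q)"
    unfolding hom_def by (rule form3_homogenized[OF form_H])+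
  moreover have pbs: "pullback (hom p) = pullback H2 ^ d * p" "pullback (hom q) = pullback H2 ^ d * q"
    by (rule pb, simp add: d_def)+
  ultimately have "(hom p, hom q) \<in> fractions curve"
    unfolding fractions_iff using pullback_H2 pq(1) by auto
  moreover have "rat (hom p, hom q) = x"
    using pullback_H2 pq by (simp add: rat_def pbs)
  ultimately show ?thesis unfolding \<Theta>_def by blast
qed

lemma inj_\<Theta>: "\<Theta> x = \<Theta> y \<Longrightarrow> x = y"
  using \<Theta>_nonempty[of x] unfolding \<Theta>_def by blast

text \<open>The unions in \<open>function_field\<close> run over all representatives. Every pair
  gives the same class and there is at least one pair, so the union is that class.\<close>

lemma \<Theta>_mult:
  "(\<Union>(F, G)\<in>\<Theta> x. \<Union>(F', G')\<in>\<Theta> y. fraction_class curve (F * F') (G * G')) = \<Theta> (x * y)" (is ?mult)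
  and \<Theta>_add:
  "(\<Union>(F, G)\<in>\<Theta> x. \<Union>(F', G')\<in>\<Theta> y. fraction_class curve (F * G' + F' * G) (G * G')) = \<Theta> (x + y)" (is ?add)
proof -
  have cls: "fraction_class curve (F * F') (G * G') = \<Theta> (x * y)"
    "fraction_class curve (F * G' + F' * G) (G * G') = \<Theta> (x + y)"
    if "(F, G) \<in> \<Theta> x" "(F', G') \<in> \<Theta> y" for F G F' G'
  proof -
    from that obtain d d' where d: "form3 d F" "form3 d G" "form3 d' F'" "form3 d' G'"
      and nz: "pullback G \<noteq> 0" "pullback G' \<noteq> 0" and r: "rat (F, G) = x" "rat (F', G') = y"
      unfolding \<Theta>_def fractions_iff mem_Collect_eq by blast
    have f: "(F * F', G * G') \<in> fractions curve"
      unfolding fractions_iff using form3_mult[OF d(1,3)] form3_mult[OF d(2,4)] nz by (auto simp: pullback_simps)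
    have "form3 (d + d') (F' * G)" using form3_mult[OF d(3,2)] by (simp add: add.commute)
    then have f': "(F * G' + F' * G, G * G') \<in> fractions curve"
      unfolding fractions_iff using form3_add[OF form3_mult[OF d(1,4)]] form3_mult[OF d(2,4)] nz
      by (auto simp: pullback_simps)
    have "rat (F * F', G * G') = x * y" "rat (F * G' + F' * G, G * G') = x + y"
      using nz unfolding r[symmetric] by (simp_all add: rat_def pullback_simps field_simps)
    then show "fraction_class curve (F * F') (G * G') = \<Theta> (x * y)"
      "fraction_class curve (F * G' + F' * G) (G * G') = \<Theta> (x + y)"
      using fraction_rel_image[OF f] fraction_rel_image[OF f'] by simp_all
  qed
  obtain F G where FG: "(F, G) \<in> \<Theta> x" using \<Theta>_nonempty[of x] by (metis prod.exhaust)
  obtain F' G' where FG': "(F', G') \<in> \<Theta> y" using \<Theta>_nonempty[of y] by (metis prod.exhaust)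
  show ?mult
  proof (rule Set.equalityI; rule subsetI)
    fix z assume "z \<in> \<Theta> (x * y)"
    then have "z \<in> fraction_class curve (F * F') (G * G')" using cls(1)[OF FG FG'] by simp
    with FG FG' show "z \<in> (\<Union>(F, G)\<in>\<Theta> x. \<Union>(F', G')\<in>\<Theta> y. fraction_class curve (F * F') (G * G'))" by blast
  next
    fix z assume "z \<in> (\<Union>(F, G)\<in>\<Theta> x. \<Union>(F', G')\<in>\<Theta> y. fraction_class curve (F * F') (G * G'))"
    then obtain F G F' G' where "(F, G) \<in> \<Theta> x" "(F', G') \<in> \<Theta> y" "z \<in> fraction_class curve (F * F') (G * G')"
      by blast
    then show "z \<in> \<Theta> (x * y)" using cls(1) by simp
  qed
  show ?add
  proof (rule Set.equalityI; rule subsetI)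
    fix z assume "z \<in> \<Theta> (x + y)"
    then have "z \<in> fraction_class curve (F * G' + F' * G) (G * G')" using cls(2)[OF FG FG'] by simp
    with FG FG' show "z \<in> (\<Union>(F, G)\<in>\<Theta> x. \<Union>(F', G')\<in>\<Theta> y. fraction_class curve (F * G' + F' * G) (G * G'))" by blast
  next
    fix z assume "z \<in> (\<Union>(F, G)\<in>\<Theta> x. \<Union>(F', G')\<in>\<Theta> y. fraction_class curve (F * G' + F' * G) (G * G'))"
    then obtain F G F' G' where "(F, G) \<in> \<Theta> x" "(F', G') \<in> \<Theta> y"
      "z \<in> fraction_class curve (F * G' + F' * G) (G * G')"
      by blast
    then show "z \<in> \<Theta> (x + y)" using cls(2) by simp
  qed
qed

lemma one_fraction: "(1, 1) \<in> fractions curve" "(0, 1) \<in> fractions curve"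
  unfolding fractions_iff using form3_1 form3_0 by (auto simp: pullback_simps)

lemma \<Theta>_zero: "\<Theta> 0 = \<zero>\<^bsub>function_field curve\<^esub>"
  using fraction_rel_image[OF one_fraction(2)] by (simp add: function_field_def rat_def pullback_simps)

lemma \<Theta>_iso: "\<Theta> \<in> ring_iso ring_of_type_algebra (function_field curve)"
proof (rule ring_iso_memI)
  show "\<Theta> x \<in> carrier (function_field curve)" for x
  proof -
    obtain fg where "fg \<in> fractions curve" "rat fg = x" using \<Theta>_nonempty[of x] unfolding \<Theta>_def by blast
    then show ?thesis unfolding function_field_def using fraction_rel_image[of fg]
      by (auto intro!: quotientI simp flip: fraction_rel_image)
  qed
  show "\<Theta> (x \<otimes>\<^bsub>ring_of_type_algebra\<^esub> y) = \<Theta> x \<otimes>\<^bsub>function_field curve\<^esub> \<Theta> y" for x y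
    by (simp add: ring_of_type_algebra_def function_field_def \<Theta>_mult)
  show "\<Theta> (x \<oplus>\<^bsub>ring_of_type_algebra\<^esub> y) = \<Theta> x \<oplus>\<^bsub>function_field curve\<^esub> \<Theta> y" for x y
    by (simp add: ring_of_type_algebra_def function_field_def \<Theta>_add)
  show "\<Theta> \<one>\<^bsub>ring_of_type_algebra\<^esub> = \<one>\<^bsub>function_field curve\<^esub>"
    using fraction_rel_image[OF one_fraction(1)]
    by (simp add: ring_of_type_algebra_def function_field_def rat_def pullback_simps)
  show "bij_betw \<Theta> (carrier ring_of_type_algebra) (carrier (function_field curve))"
  proof (rule bij_betw_imageI)
    show "inj_on \<Theta> (carrier ring_of_type_algebra)" using inj_\<Theta> by (auto simp: inj_on_def)
    show "\<Theta> ` carrier ring_of_type_algebra = carrier (function_field curve)"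
    proof (rule Set.equalityI; rule subsetI)
      fix z assume "z \<in> carrier (function_field curve)"
      then obtain fg where "fg \<in> fractions curve" "z = fraction_rel curve `` {fg}"
        by (auto simp: function_field_def elim!: quotientE)
      then show "z \<in> \<Theta> ` carrier ring_of_type_algebra"
        using fraction_rel_image by (simp add: ring_of_type_algebra_def)
    next
      fix z assume "z \<in> \<Theta> ` carrier ring_of_type_algebra"
      then obtain x fg where "z = \<Theta> x" "fg \<in> fractions curve" "rat fg = x"
        using \<Theta>_nonempty unfolding \<Theta>_def by blast
      then show "z \<in> carrier (function_field curve)"
        unfolding function_field_def by (auto intro!: quotientI simp flip: fraction_rel_image)
    qed
  qed
qed

text \<open>The hypotheses say that \<open>\<alpha>\<^sub>k x + \<beta>\<^sub>k y\<close> (\<open>k = 1, 2, 3\<close>) parametrizes the pencil of lines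
  through \<open>P\<close>, with inverse \<open>(\<Lambda>\<^sub>1, \<Lambda>\<^sub>2)\<close>, so that the projection is given by \<open>x\<^sub>a\<close> and \<open>x\<^sub>b\<close>.\<close>

lemma projection_field_eq:
  fixes a b :: 3 and \<alpha> \<beta> :: "3 \<Rightarrow> 'a"
  assumes b: "pullback (var3 b) \<noteq> 0"
    and f: "f = rat (var3 a, var3 b)" "f \<notin> range cst"
    and join: "\<And>v k. join_coords (rep_proj P) v $ k = \<alpha> k * v $ a + \<beta> k * v $ b"
    and form: "form3 1 \<Lambda>1" "form3 1 \<Lambda>2"
    and \<Lambda>: "\<And>v. eval3 \<Lambda>1 (join_coords (rep_proj P) v) = v $ a" "\<And>v. eval3 \<Lambda>2 (join_coords (rep_proj P) v) = v $ b"
    and pencil: "\<And>v. (\<Sum>k\<in>UNIV. join_coords (rep_proj P) v $ k * rep_proj P $ k) = 0"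
  shows "projection_field curve P = \<Theta> ` {ev p f / ev q f | p q. q \<noteq> 0}"
proof -
  define xa xb where "xa = to_fract (pullback (var3 a))" and "xb = to_fract (pullback (var3 b))"
  have xb: "xb \<noteq> 0" using b by (simp add: xb_def)
  have f_eq: "f = xa / xb" by (simp add: f rat_def xa_def xb_def)
  have to_fract_power: "to_fract (r ^ k) = to_fract r ^ k" for r :: "'a poly" and k by (induction k) auto
  have to_fract_sum: "to_fract (sum g I) = (\<Sum>i\<in>I. to_fract (g i))" for g :: "nat \<Rightarrow> 'a poly" and I
    by (induction I rule: infinite_finite_induct) auto
  have pb: "to_fract (pullback F) = xb ^ d * ev p f"
    if "Polynomial.degree p \<le> d"
      "\<And>v. eval3 F v = (\<Sum>i\<le>d. Polynomial.coeff p i * v $ a ^ i * v $ b ^ (d - i))" for F p d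
  proof -
    have "pullback F = (\<Sum>i\<le>d. [:Polynomial.coeff p i:] * (pullback (var3 a) ^ i * pullback (var3 b) ^ (d - i)))"
      by (rule poly_eqI_all) (simp add: poly_pullback that(2) poly_sum poly_power mult.assoc)
    then have "to_fract (pullback F) = (\<Sum>i\<le>d. cst (Polynomial.coeff p i) * (xa ^ i * xb ^ (d - i)))"
      by (simp only: to_fract_sum to_fract_mult to_fract_power xa_def xb_def cst_def)
    also have "\<dots> = (\<Sum>i\<le>d. xb ^ d * (cst (Polynomial.coeff p i) * f ^ i))"
    proof (rule sum.cong)
      fix i assume "i \<in> {..d}"
      then have "xb ^ d = xb ^ i * xb ^ (d - i)" by (simp add: power_add[symmetric])
      then show "cst (Polynomial.coeff p i) * (xa ^ i * xb ^ (d - i)) = xb ^ d * (cst (Polynomial.coeff p i) * f ^ i)"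
        using xb by (simp add: f_eq power_divide)
    qed simp
    finally show ?thesis unfolding ev_sum_le[OF that(1)] by (simp add: sum_distrib_left)
  qed
  show ?thesis
  proof (rule Set.equalityI; rule subsetI)
    fix z assume "z \<in> projection_field curve P"
    then obtain F G A B where z: "z = fraction_class curve F G"
      and AB: "(A, B) \<in> fractions (pencil P)" and FG: "(F, G) \<in> fractions curve"
      and e: "\<And>v. eval3 F v = eval3 A (join_coords (rep_proj P) v)"
        "\<And>v. eval3 G v = eval3 B (join_coords (rep_proj P) v)"
      unfolding projection_field_def by blast
    from AB obtain d where d: "form3 d A" "form3 d B" unfolding fractions_def by blast
    \<comment> \<open>The joining line depends linearly on (v_a, v_b), so A composed with it is a
      binary form of degree d in these coordinates; dividing by x_b^d leaves a polynomial in
      f.\<close>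
    have dehom: "\<exists>p. to_fract (pullback F) = xb ^ d * ev p f"
      if "form3 d A" "\<And>v. eval3 F v = eval3 A (join_coords (rep_proj P) v)" for F A
    proof -
      have j: "join_coords (rep_proj P) v = (\<chi> k. \<alpha> k * v $ a + \<beta> k * v $ b)" for v
        by (simp add: vec_eq_iff join)
      have "binary_form (d * 1) (\<lambda>x y. eval3 A (\<chi> k. \<alpha> k * x + \<beta> k * y))"
        by (rule binary_form_eval3[OF that(1)])
          (simp del: One_nat_def, intro binary_form_add binary_form_scale binary_form_fst binary_form_snd)
      then have "binary_form d (\<lambda>x y. eval3 A (\<chi> k. \<alpha> k * x + \<beta> k * y))" by simp
      note dh = dehomogenization[OF this]
      show ?thesis by (rule exI, rule pb[OF dh(1)], unfold that(2) j, rule dh(2))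
    qed
    obtain p where p: "to_fract (pullback F) = xb ^ d * ev p f" using dehom[OF d(1) e(1)] by blast
    obtain q where q: "to_fract (pullback G) = xb ^ d * ev q f" using dehom[OF d(2) e(2)] by blast
    have "pullback G \<noteq> 0" using FG unfolding fractions_iff by blast
    then have "q \<noteq> 0" using q by auto
    moreover have "rat (F, G) = ev p f / ev q f" using xb by (simp add: rat_def p q)
    moreover have "z = \<Theta> (rat (F, G))" unfolding z by (rule fraction_rel_image[OF FG])
    ultimately show "z \<in> \<Theta> ` {ev p f / ev q f | p q. q \<noteq> 0}" by auto
  next
    fix z assume "z \<in> \<Theta> ` {ev p f / ev q f | p q. q \<noteq> 0}"
    then obtain p q where q: "q \<noteq> 0" and z: "z = \<Theta> (ev p f / ev q f)" by blast
    \<comment> \<open>The successor makes d positive, so that B vanishes at the zero vector; this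
      excludes J = 0 below.\<close>
    define d where "d = Suc (max (Polynomial.degree p) (Polynomial.degree q))"
    have dpq: "Polynomial.degree p \<le> d" "Polynomial.degree q \<le> d" by (simp_all add: d_def)
    define hom where "hom r S T = (\<Sum>i\<le>d. const3 (Polynomial.coeff r i) * S ^ i * T ^ (d - i))" for r :: "'a poly" and S T
    have ev_hom: "eval3 (hom r S T) v = (\<Sum>i\<le>d. Polynomial.coeff r i * eval3 S v ^ i * eval3 T v ^ (d - i))" for r S T v
      by (simp add: hom_def eval3_sum)
    define F G A B where "F = hom p (var3 a) (var3 b)" and "G = hom q (var3 a) (var3 b)"
      and "A = hom p \<Lambda>1 \<Lambda>2" and "B = hom q \<Lambda>1 \<Lambda>2"
    have forms: "form3 d F" "form3 d G" "form3 d A" "form3 d B"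
      unfolding F_def G_def A_def B_def hom_def
      using form3_homogenized[OF form3_var3 form3_var3] form3_homogenized[OF form] by (simp_all del: One_nat_def)
    have e: "eval3 F v = eval3 A (join_coords (rep_proj P) v)" "eval3 G v = eval3 B (join_coords (rep_proj P) v)" for v
      unfolding F_def G_def A_def B_def ev_hom by (simp_all add: \<Lambda>)
    have pF: "to_fract (pullback F) = xb ^ d * ev p f" and pG: "to_fract (pullback G) = xb ^ d * ev q f"
      by (rule pb; simp add: dpq F_def G_def ev_hom)+
    have "ev q f \<noteq> 0" using ev_nonzero[OF f(2) q] .
    with pG xb have nz: "pullback G \<noteq> 0" by auto
    then have FG: "(F, G) \<in> fractions curve" unfolding fractions_iff using forms by blast
    have "(A, B) \<in> fractions (pencil P)"
    proof -
      \<comment> \<open>A point of the pencil at which B does not vanish: the line joining P to a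
        point where G does not vanish.\<close>
      have "\<exists>t. poly (pullback G) t \<noteq> 0" using nz poly_eqI_all[of "pullback G" 0] by auto
      then obtain v where v: "eval3 G v \<noteq> 0" unfolding poly_pullback by blast
      define J where "J = join_coords (rep_proj P) v"
      have BJ: "eval3 B J \<noteq> 0" using v unfolding e J_def .
      have "eval3 B 0 = 0" using form3_scale[OF forms(4), of 0 0] by (simp add: d_def)
      with BJ have "J \<noteq> 0" by auto
      then have "\<not> vanishes3 B (abs_proj J)" using BJ vanishes3_abs_proj[OF forms(4)] by blast
      moreover have "abs_proj J \<in> pencil P"
      proof -
        obtain c where c: "rep_proj (abs_proj J) = c *s J" using rep_abs_proj[OF \<open>J \<noteq> 0\<close>] .
        have "(\<Sum>k\<in>UNIV. rep_proj (abs_proj J) $ k * rep_proj P $ k) = c * (\<Sum>k\<in>UNIV. J $ k * rep_proj P $ k)"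
          unfolding c by (simp add: sum_distrib_left mult.assoc)
        then show ?thesis unfolding pencil_def J_def pencil by simp
      qed
      ultimately show ?thesis unfolding fractions_def using forms by blast
    qed
    moreover have "z = fraction_class curve F G"
      using fraction_rel_image[OF FG] pF pG xb by (simp add: z rat_def)
    ultimately show "z \<in> projection_field curve P" unfolding projection_field_def using FG e by blast
  qed
qed

end

section \<open>Projections from the coordinate points and their Galois groups\<close>

section \<open>Galois points\<close>

context moebius_invariant
begin

text \<open>K contains the constants, so ring automorphisms fixing K are k-linear.\<close>

lemma field_automorphisms_eq_Gal: "field_automorphisms K = Gal"
  unfolding field_automorphisms_def Gal_def khom_def using K_cst by auto

lemma group_Gal: "group (comp_monoid Gal)" and order_Gal: "order (comp_monoid Gal) = n"
proof -
  show "group (comp_monoid Gal)"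
  proof (rule groupI)
    fix h assume "h \<in> carrier (comp_monoid Gal)"
    then have h: "h \<in> Gal" by (simp add: comp_monoid_def)
    then have "inv_into UNIV h \<circ> h = id" unfolding Gal_def by (auto simp: fun_eq_iff bij_is_inj)
    then show "\<exists>g\<in>carrier (comp_monoid Gal). g \<otimes>\<^bsub>comp_monoid Gal\<^esub> h = \<one>\<^bsub>comp_monoid Gal\<^esub>"
      using Gal_inv[OF h] by (auto simp: comp_monoid_def)
  qed (auto simp: comp_monoid_def Gal_comp Gal_id comp_assoc)
  show "order (comp_monoid Gal) = n" by (simp add: order_def comp_monoid_def card_Gal)
qed

lemma galois_transport_\<Theta>:
  assumes "plane_param \<phi> N H1 H2 e"
  shows "galois_transport (function_field (range (param_map \<phi>))) (plane_param.\<Theta> \<phi>) K"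
proof -
  interpret C: plane_param \<phi> N H1 H2 e by (rule assms)
  show ?thesis
  proof
    show "C.\<Theta> \<in> ring_iso ring_of_type_algebra (function_field C.curve)" by (rule C.\<Theta>_iso)
    show "C.\<Theta> 0 = \<zero>\<^bsub>function_field C.curve\<^esub>" by (rule C.\<Theta>_zero)
    show "- x \<in> K" if "x \<in> K" for x using K_diff[OF K_01(1) that] by simp
    show "inverse x \<in> K" if "x \<in> K" for x using K_divide[OF K_01(2) that] by (simp add: divide_inverse)
    show "x \<in> K" if "\<And>h. h \<in> field_automorphisms K \<Longrightarrow> h x = x" for x
      using fixed_in_K that unfolding field_automorphisms_eq_Gal by blast
  qed (use K_01 K_add K_mult algebraic_over_K in auto)
qed

text \<open>The common factor l cancels in the quotient of the coordinates a and b, which therefore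
  pulls back to f = U/V. The projection field then corresponds to K = k(f), over which k(t) has
  automorphism group \<open>Gal\<close> and fixed field K.\<close>

lemma galois_point_at:
  fixes a b :: 3 and \<phi> :: "'a \<Rightarrow> 'a \<Rightarrow> 'a^3" and \<alpha> \<beta> :: "3 \<Rightarrow> 'a"
  assumes param: "plane_param \<phi> N H1 H2 e"
    and ab: "\<And>u w. \<phi> u w $ a = U u w * l u w" "\<And>u w. \<phi> u w $ b = V u w * l u w"
    and l: "binary_form 1 l" "\<exists>u w. l u w \<noteq> 0"
    and join: "\<And>v k. join_coords (rep_proj Q) v $ k = \<alpha> k * v $ a + \<beta> k * v $ b"
    and form: "form3 1 \<Lambda>1" "form3 1 \<Lambda>2"
    and \<Lambda>: "\<And>v. eval3 \<Lambda>1 (join_coords (rep_proj Q) v) = v $ a" "\<And>v. eval3 \<Lambda>2 (join_coords (rep_proj Q) v) = v $ b"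
    and pencil: "\<And>v. (\<Sum>k\<in>UNIV. join_coords (rep_proj Q) v $ k * rep_proj Q $ k) = 0"
  shows "galois_point (range (param_map \<phi>)) Q"
    "galois_group_at (range (param_map \<phi>)) Q \<cong> comp_monoid Gal"
proof -
  interpret C: plane_param \<phi> N H1 H2 e by (rule param)
  have "C.pullback (var3 b) \<noteq> 0"
  proof
    assume "C.pullback (var3 b) = 0"
    then have "V u w * l u w = 0" for u w
      using C.pullback_eq_0_iff[OF form3_var3[of b]] by (simp add: ab)
    then have "(\<forall>u w. V u w = 0) \<or> (\<forall>u w. l u w = 0)"
      by (intro polyfun_mult_eq_0 binary_form_polyfun[OF form_V] binary_form_polyfun[OF l(1)])
    moreover obtain u w where "V u w = 1" using UV_surj by blast
    ultimately show False using l(2) by (metis zero_neq_one)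
  qed
  moreover have "f = C.rat (var3 a, var3 b)"
  proof -
    have "pU * C.pullback (var3 b) = C.pullback (var3 a) * pV"
      by (rule poly_eqI_all) (simp add: poly_pU poly_pV C.poly_pullback ab)
    then have "to_fract pU * to_fract (C.pullback (var3 b)) = to_fract (C.pullback (var3 a)) * to_fract pV"
      by (simp flip: to_fract_mult)
    then show ?thesis using calculation pV_nonzero by (simp add: f_def C.rat_def frac_eq_eq)
  qed
  ultimately have K: "projection_field C.curve Q = C.\<Theta> ` K"
    unfolding K_def by (rule C.projection_field_eq[OF _ _ f_nonconst join form \<Lambda> pencil])
  interpret T: galois_transport "function_field C.curve" C.\<Theta> K by (rule galois_transport_\<Theta>[OF param])
  show "galois_point C.curve Q" unfolding galois_point_def K by (rule T.galois_extension_L)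
  show "galois_group_at C.curve Q \<cong> comp_monoid Gal"
    unfolding galois_group_at_def K using T.galois_group_iso by (simp add: field_automorphisms_eq_Gal)
qed

lemma galois_point_3:
  assumes "plane_param \<phi> N H1 H2 e" "\<And>u w. \<phi> u w $ 1 = U u w * l u w" "\<And>u w. \<phi> u w $ 2 = V u w * l u w"
    "binary_form 1 l" "\<exists>u w. l u w \<noteq> 0" "y \<noteq> 0"
  shows "galois_point (range (param_map \<phi>)) (abs_proj (vector [0, 0, y]))"
    "galois_group_at (range (param_map \<phi>)) (abs_proj (vector [0, 0, y])) \<cong> comp_monoid Gal"
proof -
  have "vector [0, 0, y] \<noteq> (0 :: 'a^3)" using assms(6) by (simp add: vec3_nonzero_iff)
  then obtain c where c: "c \<noteq> 0" "rep_proj (abs_proj (vector [0, 0, y])) = c *s (vector [0, 0, y] :: 'a^3)"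
    using rep_abs_proj by blast
  define r where "r = c * y"
  have r: "r \<noteq> 0" "rep_proj (abs_proj (vector [0, 0, y])) = (vector [0, 0, r] :: 'a^3)"
    using c assms(6) by (simp_all add: r_def vec_eq_iff forall_3)
  \<comment> \<open>The line joining (0, 0, r) to v has coordinates (- r v_2, r v_1, 0), where r is
    the scale of the chosen representative; dividing by r recovers v_1 and v_2.\<close>
  define \<alpha> \<beta> :: "3 \<Rightarrow> 'a" where "\<alpha> = (\<lambda>k. if k = 2 then r else 0)" and "\<beta> = (\<lambda>k. if k = 1 then - r else 0)"
  have j: "join_coords (vector [0, 0, r]) v = (vector [- (r * v $ 2), r * v $ 1, 0] :: 'a^3)" for v
    by (simp add: join_coords_def)
  note * = galois_point_at[OF assms(1-5), of "abs_proj (vector [0, 0, y])" \<alpha> \<beta>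
    "const3 (1 / r) * var3 2" "const3 (- 1 / r) * var3 1", unfolded r j]
  have f: "form3 1 (const3 k * var3 i)" for k :: 'a and i
    using form3_mult[OF form3_const3 form3_var3] by simp
  have jc: "(vector [- (r * v $ 2), r * v $ 1, 0] :: 'a^3) $ k = \<alpha> k * v $ 1 + \<beta> k * v $ 2" for v :: "'a^3" and k
    using exhaust_3[of k] by (auto simp: \<alpha>_def \<beta>_def)
  show "galois_point (range (param_map \<phi>)) (abs_proj (vector [0, 0, y]))"
    "galois_group_at (range (param_map \<phi>)) (abs_proj (vector [0, 0, y])) \<cong> comp_monoid Gal"
    by (rule *; (rule jc | use r(1) f in \<open>simp add: sum_3\<close>))+
qed

lemma galois_point_1:
  assumes "plane_param \<phi> N H1 H2 e" "\<And>u w. \<phi> u w $ 3 = U u w * l u w" "\<And>u w. \<phi> u w $ 2 = V u w * l u w"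
    "binary_form 1 l" "\<exists>u w. l u w \<noteq> 0" "x \<noteq> 0"
  shows "galois_point (range (param_map \<phi>)) (abs_proj (vector [x, 0, 0]))"
    "galois_group_at (range (param_map \<phi>)) (abs_proj (vector [x, 0, 0])) \<cong> comp_monoid Gal"
proof -
  have "vector [x, 0, 0] \<noteq> (0 :: 'a^3)" using assms(6) by (simp add: vec3_nonzero_iff)
  then obtain c where c: "c \<noteq> 0" "rep_proj (abs_proj (vector [x, 0, 0])) = c *s (vector [x, 0, 0] :: 'a^3)"
    using rep_abs_proj by blast
  define r where "r = c * x"
  have r: "r \<noteq> 0" "rep_proj (abs_proj (vector [x, 0, 0])) = (vector [r, 0, 0] :: 'a^3)"
    using c assms(6) by (simp_all add: r_def vec_eq_iff forall_3)
  define \<alpha> \<beta> :: "3 \<Rightarrow> 'a" where "\<alpha> = (\<lambda>k. if k = 2 then - r else 0)" and "\<beta> = (\<lambda>k. if k = 3 then r else 0)"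
  have j: "join_coords (vector [r, 0, 0]) v = (vector [0, - (r * v $ 3), r * v $ 2] :: 'a^3)" for v
    by (simp add: join_coords_def)
  note * = galois_point_at[OF assms(1-5), of "abs_proj (vector [x, 0, 0])" \<alpha> \<beta>
    "const3 (- 1 / r) * var3 2" "const3 (1 / r) * var3 3", unfolded r j]
  have f: "form3 1 (const3 k * var3 i)" for k :: 'a and i
    using form3_mult[OF form3_const3 form3_var3] by simp
  have jc: "(vector [0, - (r * v $ 3), r * v $ 2] :: 'a^3) $ k = \<alpha> k * v $ 3 + \<beta> k * v $ 2" for v :: "'a^3" and k
    using exhaust_3[of k] by (auto simp: \<alpha>_def \<beta>_def)
  show "galois_point (range (param_map \<phi>)) (abs_proj (vector [x, 0, 0]))"
    "galois_group_at (range (param_map \<phi>)) (abs_proj (vector [x, 0, 0])) \<cong> comp_monoid Gal"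
    by (rule *; (rule jc | use r(1) f in \<open>simp add: sum_3\<close>))+
qed

text \<open>The matrix square is scalar; the identity is included, as needed for a group of exponent
  two.\<close>

definition mob_involution :: "'a moebius \<Rightarrow> bool" where
  "mob_involution M \<longleftrightarrow> mob_eq (mob_comp M M) (1, 0, 0, 1)"

lemma subst_involution:
  assumes "M \<in> set Ms"
  shows "subst (mob_fract M) \<circ> subst (mob_fract M) = id \<longleftrightarrow> mob_involution M"
proof -
  have det: "mob_det M \<noteq> 0" "mob_det (mob_comp M M) \<noteq> 0" "mob_det (1, 0, 0, 1 :: 'a) \<noteq> 0"
    using det_nonzero[OF assms] by (simp_all add: mob_det_comp)
  have k: "khom (subst (mob_fract M))" by (rule khom_subst[OF mob_fract_nonconst[OF det(1)]])
  have t: "(subst (mob_fract M) \<circ> subst (mob_fract M)) tvar = mob_fract (mob_comp M M)"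
    using subst_mob_tvar[OF assms] subst_mob_fract[OF det(1) det(1)] by simp
  have "subst (mob_fract M) \<circ> subst (mob_fract M) = id \<longleftrightarrow> mob_fract (mob_comp M M) = tvar"
    using khom_ext[OF khom_comp[OF k k] khom_id] t by (metis id_apply)
  also have "\<dots> \<longleftrightarrow> mob_fract (mob_comp M M) = mob_fract (1, 0, 0, 1)"
    by (simp only: mob_fract_scalar[OF one_neq_zero])
  also have "\<dots> \<longleftrightarrow> mob_involution M"
    unfolding mob_involution_def using mob_fract_eq_iff[OF det(2,3)] .
  finally show ?thesis .
qed

lemma Gal_Z4:
  assumes "n = 4" "M \<in> set Ms" "\<not> mob_involution M"
  shows "comp_monoid Gal \<cong> integer_mod_group 4"
proof (rule group.iso_Z4[OF group_Gal])
  show "order (comp_monoid Gal) = 4" using order_Gal assms(1) by simp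
  show "subst (mob_fract M) \<in> carrier (comp_monoid Gal)"
    using subst_in_Gal[OF assms(2)] by (simp add: comp_monoid_def)
  show "subst (mob_fract M) \<otimes>\<^bsub>comp_monoid Gal\<^esub> subst (mob_fract M) \<noteq> \<one>\<^bsub>comp_monoid Gal\<^esub>"
    using subst_involution[OF assms(2)] assms(3) by (simp add: comp_monoid_def)
qed

lemma Gal_Z5:
  assumes "n = 5"
  shows "comp_monoid Gal \<cong> integer_mod_group 5"
  by (rule group.iso_Z5[OF group_Gal]) (unfold order_Gal, rule assms)

lemma Gal_Z2_Z2:
  assumes "n = 4" "\<And>M. M \<in> set Ms \<Longrightarrow> mob_involution M"
  shows "comp_monoid Gal \<cong> integer_mod_group 2 \<times>\<times> integer_mod_group 2"
proof (rule group.iso_Z2_Z2[OF group_Gal])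
  show "order (comp_monoid Gal) = 4" using order_Gal assms(1) by simp
  fix h assume "h \<in> carrier (comp_monoid Gal)"
  then obtain M where "M \<in> set Ms" "h = subst (mob_fract M)" by (auto simp: comp_monoid_def Gal_eq)
  then show "h \<otimes>\<^bsub>comp_monoid Gal\<^esub> h = \<one>\<^bsub>comp_monoid Gal\<^esub>"
    using subst_involution assms(2) by (simp add: comp_monoid_def)
qed

end

section \<open>The criterion for two Galois points, and the four explicit curves\<close>

section \<open>Curves with two Galois points\<close>

lemma is_iso_trans: "G \<cong> H \<Longrightarrow> H \<cong> K \<Longrightarrow> G \<cong> K"
  unfolding is_iso_def iso_def using Group.hom_compose bij_betw_trans by blast

lemma abs_proj_neq: 
  assumes "x \<noteq> 0" "y \<noteq> 0"
  shows "abs_proj (vector [0, 0, y] :: 'a::field^3) \<noteq> abs_proj (vector [x, 0, 0])"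
proof
  assume eq: "abs_proj (vector [0, 0, y] :: 'a^3) = abs_proj (vector [x, 0, 0])"
  have "vector [0, 0, y] \<noteq> (0 :: 'a^3)" "vector [x, 0, 0] \<noteq> (0 :: 'a^3)"
    using assms by (simp_all add: vec3_nonzero_iff)
  then obtain c d where "c \<noteq> 0" "rep_proj (abs_proj (vector [0, 0, y])) = c *s (vector [0, 0, y] :: 'a^3)"
    "rep_proj (abs_proj (vector [x, 0, 0])) = d *s (vector [x, 0, 0] :: 'a^3)"
    using rep_abs_proj by metis
  then have "c *s (vector [0, 0, y] :: 'a^3) = d *s vector [x, 0, 0]" "c \<noteq> 0" using eq by simp_all
  then have "c * y = 0" by (simp add: vec_eq_iff forall_3)
  with \<open>c \<noteq> 0\<close> assms show False by simp
qed

definition has_galois_points ::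
  "('a::alg_closed_field P1 \<Rightarrow> 'a P2) \<Rightarrow> nat \<Rightarrow> ('b, 'm) monoid_scheme \<Rightarrow> ('c, 'l) monoid_scheme \<Rightarrow> bool" where
  "has_galois_points f d \<Gamma>\<^sub>1 \<Gamma>\<^sub>2 \<longleftrightarrow>
    morphism_P1_P2 f \<and> birational_onto_image f \<and> plane_curve_of_degree (range f) d \<and>
    (\<exists>P\<^sub>1 P\<^sub>2. f P\<^sub>1 \<noteq> f P\<^sub>2 \<and>
      galois_point (range f) (f P\<^sub>1) \<and> galois_point (range f) (f P\<^sub>2) \<and>
      galois_group_at (range f) (f P\<^sub>1) \<cong> \<Gamma>\<^sub>1 \<and> galois_group_at (range f) (f P\<^sub>2) \<cong> \<Gamma>\<^sub>2)"

text \<open>Because V l = V' l', the coordinates of the curve in the order x_3, x_2 are W l' and V'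
  l', so the same curve is in standard form with respect to (1:0:0) as well. At the zero of l only m
  survives, and at the zero of l' only U l survives; these are the two coordinate points.\<close>

lemma has_galois_points_galois_curve:
  assumes curve: "galois_curve n U V l m Ms H1 H2 e F \<kappa> c\<^sub>0"
    and second: "moebius_invariant n W V' Ms'"
    and m: "\<And>u w. m u w = W u w * l' u w" and V': "\<And>u w. V u w * l u w = V' u w * l' u w"
    and l': "binary_form 1 l'"
    and zero: "a \<noteq> 0 \<or> b \<noteq> 0" "l a b = 0" and zero': "a' \<noteq> 0 \<or> b' \<noteq> 0" "l' a' b' = 0"
    and \<Gamma>: "comp_monoid (moebius_invariant.Gal n U V) \<cong> \<Gamma>\<^sub>1"
      "comp_monoid (moebius_invariant.Gal n W V') \<cong> \<Gamma>\<^sub>2"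
  shows "has_galois_points (param_map (\<lambda>u w. vector [U u w * l u w, V u w * l u w, m u w])) (Suc n) \<Gamma>\<^sub>1 \<Gamma>\<^sub>2"
proof -
  interpret A: galois_curve n U V l m Ms H1 H2 e F \<kappa> c\<^sub>0 by (rule curve)
  interpret B: moebius_invariant n W V' Ms' by (rule second)
  define \<phi> where "\<phi> u w = (vector [U u w * l u w, V u w * l u w, m u w] :: 'a^3)" for u w
  have param: "plane_param \<phi> (Suc n) H1 H2 e"
    unfolding \<phi>_def[abs_def] by (rule A.plane_param_axioms)
  have y: "m a b \<noteq> 0" using A.nonzero[OF zero(1)] zero(2) by (simp add: vec3_nonzero_iff)
  have V0: "V a' b' * l a' b' = 0" "m a' b' = 0" using V'[of a' b'] m[of a' b'] zero'(2) by simp_all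
  then have x: "U a' b' * l a' b' \<noteq> 0" using A.nonzero[OF zero'(1)] by (simp add: vec3_nonzero_iff)
  have P1: "param_map \<phi> (abs_proj (vector [a, b])) = abs_proj (vector [0, 0, m a b])"
    using A.param_map_abs_proj[OF zero(1)] zero(2) by (simp add: \<phi>_def[abs_def])
  have P2: "param_map \<phi> (abs_proj (vector [a', b'])) = abs_proj (vector [U a' b' * l a' b', 0, 0])"
    using A.param_map_abs_proj[OF zero'(1)] V0 by (simp add: \<phi>_def[abs_def])
  have l: "\<exists>u w. l u w \<noteq> 0" using x by auto
  have l'_nz: "\<exists>u w. l' u w \<noteq> 0" using y m[of a b] by auto
  have g1: "galois_point (range (param_map \<phi>)) (abs_proj (vector [0, 0, m a b]))"
    "galois_group_at (range (param_map \<phi>)) (abs_proj (vector [0, 0, m a b])) \<cong> comp_monoid A.Gal"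
    by (rule A.galois_point_3[OF param _ _ A.form_l l y]; simp add: \<phi>_def)+
  have g2: "galois_point (range (param_map \<phi>)) (abs_proj (vector [U a' b' * l a' b', 0, 0]))"
    "galois_group_at (range (param_map \<phi>)) (abs_proj (vector [U a' b' * l a' b', 0, 0])) \<cong> comp_monoid B.Gal"
    by (rule B.galois_point_1[OF param _ _ l' l'_nz x]; simp add: \<phi>_def m V')+
  have "has_galois_points (param_map \<phi>) (Suc n) \<Gamma>\<^sub>1 \<Gamma>\<^sub>2"
    unfolding has_galois_points_def
  proof (intro conjI exI)
    show "morphism_P1_P2 (param_map \<phi>)" "birational_onto_image (param_map \<phi>)"
      by (rule plane_param.morphism[OF param], rule plane_param.birational[OF param])
    show "plane_curve_of_degree (range (param_map \<phi>)) (Suc n)"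
      unfolding \<phi>_def[abs_def] by (rule A.plane_curve)
    show "param_map \<phi> (abs_proj (vector [a, b])) \<noteq> param_map \<phi> (abs_proj (vector [a', b']))"
      unfolding P1 P2 by (rule abs_proj_neq[OF x y])
    show "galois_point (range (param_map \<phi>)) (param_map \<phi> (abs_proj (vector [a, b])))"
      "galois_point (range (param_map \<phi>)) (param_map \<phi> (abs_proj (vector [a', b'])))"
      unfolding P1 P2 by (rule g1(1), rule g2(1))
    show "galois_group_at (range (param_map \<phi>)) (param_map \<phi> (abs_proj (vector [a, b]))) \<cong> \<Gamma>\<^sub>1"
      "galois_group_at (range (param_map \<phi>)) (param_map \<phi> (abs_proj (vector [a', b']))) \<cong> \<Gamma>\<^sub>2"
      unfolding P1 P2 by (rule is_iso_trans[OF g1(2) \<Gamma>(1)], rule is_iso_trans[OF g2(2) \<Gamma>(2)])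
  qed
  then show ?thesis unfolding \<phi>_def[abs_def] .
qed

definition form1 :: "nat \<Rightarrow> 'a::field poly \<Rightarrow> bool" where
  "form1 d p \<longleftrightarrow> (\<forall>i. Polynomial.coeff p i \<noteq> 0 \<longrightarrow> i = d)"

lemma form1_pCons:
  "form1 d 0" "form1 0 (pCons a p) \<longleftrightarrow> p = 0" "form1 (Suc d) (pCons a p) \<longleftrightarrow> a = 0 \<and> form1 d p"
  by (auto simp: form1_def coeff_pCons poly_eq_iff split: nat.splits)

lemma form2_pCons:
  "form2 d 0" "form2 0 (pCons p P) \<longleftrightarrow> form1 0 p \<and> P = 0"
  "form2 (Suc d) (pCons p P) \<longleftrightarrow> form1 (Suc d) p \<and> form2 d P"
  by (auto simp: form1_def form2_def coeff_pCons poly_eq_iff split: nat.splits)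

lemma form3_pCons:
  "form3 d 0" "form3 0 (pCons P F) \<longleftrightarrow> form2 0 P \<and> F = 0"
  "form3 (Suc d) (pCons P F) \<longleftrightarrow> form2 (Suc d) P \<and> form3 d F"
  by (auto simp: form2_def form3_def coeff_pCons poly_eq_iff split: nat.splits)

lemma binary_form_monomial:
  assumes "i + j = d"
  shows "binary_form d (\<lambda>u w. c * (u ^ i * w ^ j))"
  using binary_form_scale[OF binary_form_mult[OF binary_form_power[OF binary_form_fst, of i]
    binary_form_power[OF binary_form_snd, of j]], of c] assms by simp

lemma binary_form_eq: "binary_form d g \<Longrightarrow> (\<And>u w. f u w = g u w) \<Longrightarrow> binary_form d f"
  by (simp add: binary_form_def)

lemma numeral_neq_0_of_CHAR:
  assumes "CHAR('a::field) \<noteq> p" "Factorial_Ring.prime p"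
  shows "(of_nat p :: 'a) \<noteq> 0"
proof
  assume "(of_nat p :: 'a) = 0"
  then have "CHAR('a) dvd p" by (simp add: of_nat_eq_0_iff_char_dvd)
  with assms have "CHAR('a) = 1" using prime_nat_iff by blast
  then show False using CHAR_not_1[where 'a = 'a] by simp
qed

text \<open>Certifies that an integer constant without prime factors other than 2 and 3 is
  invertible, as required in the first example.\<close>

lemma two_three_smooth:
  assumes "(2 :: 'a::field) \<noteq> 0" "(3 :: 'a) \<noteq> 0" "(x :: 'a) = 2 ^ i * 3 ^ j"
  shows "x \<noteq> 0"
  using assms by simp

text \<open>These rules alone turn the evaluation of an explicit coefficient list into a polynomial
  expression, leaving a ring identity to be decided.\<close>

lemmas eval3_list = eval3_def vector_3 poly_pCons poly_add poly_mult poly_0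
  mult_zero_right mult_zero_left add_0_left add_0_right

lemmas form_list = form3_pCons form2_pCons form1_pCons simp_thms eval_nat_numeral BitM.simps numeral_One One_nat_def

text \<open>G1 is generated by M(t) = (t - 5)/(t + 3), where trace^2 = 2 det gives order four, and
  \<open>Ms\<close> lists its powers. Here Q1 = 3 and Q2 = -3: the zeros of U are the orbit 3, -1/3,
  -2, -7, and those of V the orbit -3, infinity, 1, -1. The reflection t \<mapsto> -t exchanges the
  two groups and the two points, and turns U into W and V into -V'. Since 1, -1 and infinity are
  common to V and V', the divisor condition holds. In characteristic 3 the points 3 and -3 would
  coincide.\<close>

lemma galois_points_Z4_Z4:
  assumes two: "(2 :: 'a::alg_closed_field) \<noteq> 0" and three: "(3 :: 'a) \<noteq> 0"
  shows "\<exists>f :: 'a P1 \<Rightarrow> 'a P2. has_galois_points f 5 (integer_mod_group 4) (integer_mod_group 4)"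
proof -
  note smooth = two_three_smooth[OF two three]
  define U V W V' l l' m :: "'a \<Rightarrow> 'a \<Rightarrow> 'a"
    where "U u w = (u - 3 * w) * (3 * u + w) * (u + 2 * w) * (u + 7 * w)"
      and "V u w = (u + 3 * w) * (u ^ 2 - w ^ 2) * w"
      and "W u w = (u + 3 * w) * (3 * u - w) * (u - 2 * w) * (u - 7 * w)"
      and "V' u w = (u - 3 * w) * (u ^ 2 - w ^ 2) * w"
      and "l u w = u - 3 * w" and "l' u w = u + 3 * w" and "m u w = W u w * l' u w" for u w
  define Ms Ms' :: "'a moebius list"
    where "Ms = [(1, 0, 0, 1), (1, -5, 1, 3), (1, 5, -1, -1), (3, 5, -1, 1)]"
      and "Ms' = [(1, 0, 0, 1), (1, 5, -1, 3), (1, -5, 1, -1), (3, -5, 1, 1)]"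
  \<comment> \<open>On the curve (H1 : H2) is the parameter, and F = 0 is the equation; both are
    certified below by polynomial identities. In the nested lists the innermost level is x_1 and the
    outermost x_3.\<close>
  define H1 H2 F :: "'a poly3"
    where "H1 = [:[:[:0, 0, -6:], [:0, 45:], [:4620:]:], [:[:0, 18:], [:-45:]:], [:[:-6:]:]:]"
      and "H2 = [:[:[:0, 0, 2:], [:0, -31:]:], [:0, [:-31:]:], [:[:-2:]:]:]"
      and "F = [:[:0, 0, [:0, 0, 0, 500:], [:0, 0, -18550:], [:0, -97020:], [:5976432:]:], [:[:0, 0, 0, 0, 2:], [:0, 0, 0, -85:], [:0, 0, -1435:], [:0, 54880:], [:97020:]:], [:[:0, 0, 0, -7:], [:0, 0, 190:], [:0, 1435:], [:-18550:]:], [:[:0, 0, 7:], [:0, -85:], [:-500:]:], [:[:0, -2:]:]:]"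
  define c :: 'a where "c = - 2"
  have c: "c \<noteq> 0" using two by (simp add: c_def)
  have form_l: "binary_form 1 l" and form_l': "binary_form 1 l'"
    by (rule binary_form_eq[where g = "\<lambda>u w. 1 * (u ^ 1 * w ^ 0) + (-3) * (u ^ 0 * w ^ 1)"],
        (rule binary_form_add | rule binary_form_monomial, simp)+, simp add: l_def,
      rule binary_form_eq[where g = "\<lambda>u w. 1 * (u ^ 1 * w ^ 0) + 3 * (u ^ 0 * w ^ 1)"],
        (rule binary_form_add | rule binary_form_monomial, simp)+, simp add: l'_def)
  have num: "(4 :: 'a) \<noteq> 0" "(8 :: 'a) \<noteq> 0" "(16 :: 'a) \<noteq> 0"
    by (rule smooth[of _ 2 0], simp, rule smooth[of _ 3 0], simp, rule smooth[of _ 4 0], simp)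
  have n13: "(1 :: 'a) \<noteq> 3"
  proof
    assume "(1 :: 'a) = 3"
    then have "(3 :: 'a) - 1 = 0" by simp
    with two show False by simp
  qed
  have inv0: "U (mob_num (1, 0, 0, 1) u w) (mob_den (1, 0, 0, 1) u w) = (1) * U u w \<and>
      V (mob_num (1, 0, 0, 1) u w) (mob_den (1, 0, 0, 1) u w) = (1) * V u w" for u w
    unfolding U_def V_def mob_num.simps mob_den.simps by (intro conjI; Groebner_Basis.algebra)
  have inv1: "U (mob_num (1, -5, 1, 3) u w) (mob_den (1, -5, 1, 3) u w) = (-64) * U u w \<and>
      V (mob_num (1, -5, 1, 3) u w) (mob_den (1, -5, 1, 3) u w) = (-64) * V u w" for u w
    unfolding U_def V_def mob_num.simps mob_den.simps by (intro conjI; Groebner_Basis.algebra)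
  have inv2: "U (mob_num (1, 5, -1, -1) u w) (mob_den (1, 5, -1, -1) u w) = (16) * U u w \<and>
      V (mob_num (1, 5, -1, -1) u w) (mob_den (1, 5, -1, -1) u w) = (16) * V u w" for u w
    unfolding U_def V_def mob_num.simps mob_den.simps by (intro conjI; Groebner_Basis.algebra)
  have inv3: "U (mob_num (3, 5, -1, 1) u w) (mob_den (3, 5, -1, 1) u w) = (-64) * U u w \<and>
      V (mob_num (3, 5, -1, 1) u w) (mob_den (3, 5, -1, 1) u w) = (-64) * V u w" for u w
    unfolding U_def V_def mob_num.simps mob_den.simps by (intro conjI; Groebner_Basis.algebra)
  have det0: "mob_det ((1, 0, 0, 1) :: 'a moebius) \<noteq> 0"
    by simp
  have det1: "mob_det ((1, -5, 1, 3) :: 'a moebius) \<noteq> 0"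
    using num by simp
  have det2: "mob_det ((1, 5, -1, -1) :: 'a moebius) \<noteq> 0"
    using num by simp
  have det3: "mob_det ((3, 5, -1, 1) :: 'a moebius) \<noteq> 0"
    using num by simp
  have first: "moebius_invariant 4 U V Ms"
  proof
    show "(0::nat) < 4" "length Ms = 4" by (simp_all add: Ms_def)
    show "binary_form 4 U"
      by (rule binary_form_eq[where g = "\<lambda>u w. (-42) * (u ^ 0 * w ^ 4) + (-139) * (u ^ 1 * w ^ 3) + (-33) * (u ^ 2 * w ^ 2) + 19 * (u ^ 3 * w ^ 1) + 3 * (u ^ 4 * w ^ 0)"],
        (rule binary_form_add | rule binary_form_monomial, simp)+, unfold U_def, Groebner_Basis.algebra)
    show "binary_form 4 V"
      by (rule binary_form_eq[where g = "\<lambda>u w. (-3) * (u ^ 0 * w ^ 4) + (-1) * (u ^ 1 * w ^ 3) + 3 * (u ^ 2 * w ^ 2) + 1 * (u ^ 3 * w ^ 1)"],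
        (rule binary_form_add | rule binary_form_monomial, simp)+, unfold V_def, Groebner_Basis.algebra)
    show "u = 0 \<and> w = 0" if 0: "U u w = 0" "V u w = 0" for u w
    proof -
      have "w = 0"
      proof -
        \<comment> \<open>Evaluating V at each of the four zeros of U leaves a constant times
          w^4.\<close>
        from 0(1) have "u - 3 * w = 0 \<or> 3 * u + w = 0 \<or> u + 2 * w = 0 \<or> u + 7 * w = 0" by (simp add: U_def)
        then show ?thesis
        proof (elim disjE)
          assume "u - 3 * w = 0"
          with 0(2) have "48 * w ^ 4 = 0" unfolding V_def by Groebner_Basis.algebra
          moreover have "(48 :: 'a) \<noteq> 0" by (rule smooth[of _ 4 1]) simp
          ultimately show "w = 0" by simp
        next
          assume "3 * u + w = 0"
          with 0(2) have "64 * w ^ 4 = 0" unfolding V_def by Groebner_Basis.algebra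
          moreover have "(64 :: 'a) \<noteq> 0" by (rule smooth[of _ 6 0]) simp
          ultimately show "w = 0" by simp
        next
          assume "u + 2 * w = 0"
          with 0(2) have "3 * w ^ 4 = 0" unfolding V_def by Groebner_Basis.algebra
          moreover have "(3 :: 'a) \<noteq> 0" by (rule smooth[of _ 0 1]) simp
          ultimately show "w = 0" by simp
        next
          assume "u + 7 * w = 0"
          with 0(2) have "192 * w ^ 4 = 0" unfolding V_def by Groebner_Basis.algebra
          moreover have "(192 :: 'a) \<noteq> 0" by (rule smooth[of _ 6 1]) simp
          ultimately show "w = 0" by simp
        qed
      qed
      moreover from this 0(1) have "3 * u ^ 4 = 0" unfolding U_def by Groebner_Basis.algebra
      ultimately show ?thesis using three by simp
    qed
    have cases: "M = (1, 0, 0, 1) \<or> M = (1, -5, 1, 3) \<or> M = (1, 5, -1, -1) \<or> M = (3, 5, -1, 1)" if "M \<in> set Ms" for M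
      using that by (simp add: Ms_def)
    show "mob_det M \<noteq> 0" if "M \<in> set Ms" for M
      using cases[OF that] det0 det1 det2 det3 by blast
    show "\<exists>\<rho>. \<forall>u w. U (mob_num M u w) (mob_den M u w) = \<rho> * U u w \<and>
        V (mob_num M u w) (mob_den M u w) = \<rho> * V u w" if "M \<in> set Ms" for M
      using cases[OF that] inv0 inv1 inv2 inv3 by blast
    show "sorted_wrt (\<lambda>M M'. \<not> mob_eq M M') Ms"
      unfolding Ms_def by (simp add: num two[symmetric] num[symmetric] n13)
  qed
  have inv0: "W (mob_num (1, 0, 0, 1) u w) (mob_den (1, 0, 0, 1) u w) = (1) * W u w \<and>
      V' (mob_num (1, 0, 0, 1) u w) (mob_den (1, 0, 0, 1) u w) = (1) * V' u w" for u w
    unfolding W_def V'_def mob_num.simps mob_den.simps by (intro conjI; Groebner_Basis.algebra)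
  have inv1: "W (mob_num (1, 5, -1, 3) u w) (mob_den (1, 5, -1, 3) u w) = (-64) * W u w \<and>
      V' (mob_num (1, 5, -1, 3) u w) (mob_den (1, 5, -1, 3) u w) = (-64) * V' u w" for u w
    unfolding W_def V'_def mob_num.simps mob_den.simps by (intro conjI; Groebner_Basis.algebra)
  have inv2: "W (mob_num (1, -5, 1, -1) u w) (mob_den (1, -5, 1, -1) u w) = (16) * W u w \<and>
      V' (mob_num (1, -5, 1, -1) u w) (mob_den (1, -5, 1, -1) u w) = (16) * V' u w" for u w
    unfolding W_def V'_def mob_num.simps mob_den.simps by (intro conjI; Groebner_Basis.algebra)
  have inv3: "W (mob_num (3, -5, 1, 1) u w) (mob_den (3, -5, 1, 1) u w) = (-64) * W u w \<and>
      V' (mob_num (3, -5, 1, 1) u w) (mob_den (3, -5, 1, 1) u w) = (-64) * V' u w" for u w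
    unfolding W_def V'_def mob_num.simps mob_den.simps by (intro conjI; Groebner_Basis.algebra)
  have det0: "mob_det ((1, 0, 0, 1) :: 'a moebius) \<noteq> 0"
    by simp
  have det1: "mob_det ((1, 5, -1, 3) :: 'a moebius) \<noteq> 0"
    using num by simp
  have det2: "mob_det ((1, -5, 1, -1) :: 'a moebius) \<noteq> 0"
    using num by simp
  have det3: "mob_det ((3, -5, 1, 1) :: 'a moebius) \<noteq> 0"
    using num by simp
  have second: "moebius_invariant 4 W V' Ms'"
  proof
    show "(0::nat) < 4" "length Ms' = 4" by (simp_all add: Ms'_def)
    show "binary_form 4 W"
      by (rule binary_form_eq[where g = "\<lambda>u w. (-42) * (u ^ 0 * w ^ 4) + 139 * (u ^ 1 * w ^ 3) + (-33) * (u ^ 2 * w ^ 2) + (-19) * (u ^ 3 * w ^ 1) + 3 * (u ^ 4 * w ^ 0)"],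
        (rule binary_form_add | rule binary_form_monomial, simp)+, unfold W_def, Groebner_Basis.algebra)
    show "binary_form 4 V'"
      by (rule binary_form_eq[where g = "\<lambda>u w. 3 * (u ^ 0 * w ^ 4) + (-1) * (u ^ 1 * w ^ 3) + (-3) * (u ^ 2 * w ^ 2) + 1 * (u ^ 3 * w ^ 1)"],
        (rule binary_form_add | rule binary_form_monomial, simp)+, unfold V'_def, Groebner_Basis.algebra)
    show "u = 0 \<and> w = 0" if 0: "W u w = 0" "V' u w = 0" for u w
    proof -
      have "w = 0"
      proof -
        from 0(1) have "u + 3 * w = 0 \<or> 3 * u - w = 0 \<or> u - 2 * w = 0 \<or> u - 7 * w = 0" by (simp add: W_def)
        then show ?thesis
        proof (elim disjE)
          assume "u + 3 * w = 0"
          with 0(2) have "48 * w ^ 4 = 0" unfolding V'_def by Groebner_Basis.algebra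
          moreover have "(48 :: 'a) \<noteq> 0" by (rule smooth[of _ 4 1]) simp
          ultimately show "w = 0" by simp
        next
          assume "3 * u - w = 0"
          with 0(2) have "64 * w ^ 4 = 0" unfolding V'_def by Groebner_Basis.algebra
          moreover have "(64 :: 'a) \<noteq> 0" by (rule smooth[of _ 6 0]) simp
          ultimately show "w = 0" by simp
        next
          assume "u - 2 * w = 0"
          with 0(2) have "3 * w ^ 4 = 0" unfolding V'_def by Groebner_Basis.algebra
          moreover have "(3 :: 'a) \<noteq> 0" by (rule smooth[of _ 0 1]) simp
          ultimately show "w = 0" by simp
        next
          assume "u - 7 * w = 0"
          with 0(2) have "192 * w ^ 4 = 0" unfolding V'_def by Groebner_Basis.algebra
          moreover have "(192 :: 'a) \<noteq> 0" by (rule smooth[of _ 6 1]) simp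
          ultimately show "w = 0" by simp
        qed
      qed
      moreover from this 0(1) have "3 * u ^ 4 = 0" unfolding W_def by Groebner_Basis.algebra
      ultimately show ?thesis using three by simp
    qed
    have cases: "M = (1, 0, 0, 1) \<or> M = (1, 5, -1, 3) \<or> M = (1, -5, 1, -1) \<or> M = (3, -5, 1, 1)" if "M \<in> set Ms'" for M
      using that by (simp add: Ms'_def)
    show "mob_det M \<noteq> 0" if "M \<in> set Ms'" for M
      using cases[OF that] det0 det1 det2 det3 by blast
    show "\<exists>\<rho>. \<forall>u w. W (mob_num M u w) (mob_den M u w) = \<rho> * W u w \<and>
        V' (mob_num M u w) (mob_den M u w) = \<rho> * V' u w" if "M \<in> set Ms'" for M
      using cases[OF that] inv0 inv1 inv2 inv3 by blast
    show "sorted_wrt (\<lambda>M M'. \<not> mob_eq M M') Ms'"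
      unfolding Ms'_def by (simp add: num two[symmetric] num[symmetric] n13)
  qed
  have U_prod: "- 16 * U u w = (\<Prod>M\<leftarrow>Ms. l (mob_num M u w) (mob_den M u w))" for u w
    unfolding Ms_def list.map prod_list.Cons prod_list.Nil mob_num.simps mob_den.simps U_def l_def by Groebner_Basis.algebra
  have kappa: "(- 16 :: 'a) \<noteq> 0" using num by simp
  interpret M: moebius_invariant 4 U V Ms by (rule first)
  have form_m: "binary_form (Suc 4) m" unfolding m_def[abs_def]
    using binary_form_mult[OF moebius_invariant.form_U[OF second] form_l'] by simp
  have curve: "galois_curve 4 U V l m Ms H1 H2 2 F (1 / - 16) c"
  proof (intro galois_curve.intro galois_curve_axioms.intro plane_param.intro first)
    have "binary_form (Suc 4) (\<lambda>u w. U u w * l u w)" "binary_form (Suc 4) (\<lambda>u w. V u w * l u w)"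
      using binary_form_mult[OF M.form_U form_l] binary_form_mult[OF M.form_V form_l] by simp_all
    with form_m show "binary_form (Suc 4) (\<lambda>u w. vector [U u w * l u w, V u w * l u w, m u w] $ k)" for k :: 3
      using exhaust_3[of k] by auto
    show "vector [U u w * l u w, V u w * l u w, m u w] \<noteq> (0 :: 'a^3)" if uw: "u \<noteq> 0 \<or> w \<noteq> 0" for u w
    proof
      assume "vector [U u w * l u w, V u w * l u w, m u w] = (0 :: 'a^3)"
      then have 0: "U u w * l u w = 0" "V u w * l u w = 0" "m u w = 0" by (simp_all add: vec_eq_iff forall_3)
      have "l u w = 0" using 0 M.no_common_zero[of u w] uw by auto
      then show False
      proof -
        have "1152 * w ^ 5 = 0" using \<open>l u w = 0\<close> 0(3) unfolding m_def W_def l'_def l_def by Groebner_Basis.algebra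
        moreover have "(1152 :: 'a) \<noteq> 0" by (rule smooth[of _ 7 2]) simp
        ultimately have "w = 0" by simp
        with \<open>l u w = 0\<close> uw show False by (simp add: l_def)
      qed
    qed
    show "form3 2 H1" "form3 2 H2" unfolding H1_def H2_def
      by (simp_all only: form_list)
    show "w * eval3 H1 (vector [U u w * l u w, V u w * l u w, m u w])
        = u * eval3 H2 (vector [U u w * l u w, V u w * l u w, m u w])" for u w
      unfolding U_def V_def l_def m_def W_def l'_def H1_def H2_def
      by (simp only: eval3_list) Groebner_Basis.algebra
    show "\<exists>u w. eval3 H2 (vector [U u w * l u w, V u w * l u w, m u w]) \<noteq> 0"
    proof (rule ccontr)
      assume "\<not> ?thesis"
      then have 0: "eval3 H2 (vector [U t 1 * l t 1, V t 1 * l t 1, m t 1]) = 0" for t by blast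
      \<comment> \<open>The pullback of H2 in the chart w = 1; its coefficient 54 = 2 * 3^3 is
        invertible.\<close>
      define p :: "'a poly" where "p = [:0, 168750, 0, 72000, 0, -18900, 0, -720, 0, 54, 0:]"
      have "poly p t = eval3 H2 (vector [U t 1 * l t 1, V t 1 * l t 1, m t 1])" for t
        unfolding U_def V_def l_def m_def W_def l'_def H2_def p_def
        by (simp only: eval3_list power_one mult_1_right mult_1_left) Groebner_Basis.algebra
      then have "p = 0" using 0 by (intro poly_eqI_all) simp
      then show False unfolding p_def using smooth[of "54 :: 'a" 1 3] by simp
    qed
    show "binary_form 1 l" by (rule form_l)
    show "U u w = (1 / - 16) * (\<Prod>M\<leftarrow>Ms. l (mob_num M u w) (mob_den M u w))" for u w
      unfolding U_prod[symmetric] using kappa by simp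
    show "form3 (Suc 4) F" unfolding F_def by (simp only: form_list)
    show "Polynomial.degree F = 4" unfolding F_def using c by (simp add: c_def)
    show "Polynomial.coeff F 4 = [:[:0, c:]:]" unfolding F_def c_def by (simp only: eval_nat_numeral BitM.simps numeral_One One_nat_def coeff_pCons_Suc coeff_pCons_0)
    show "eval3 F (vector [U u w * l u w, V u w * l u w, m u w]) = 0" for u w
      unfolding U_def V_def l_def m_def W_def l'_def F_def
      by (simp only: eval3_list) Groebner_Basis.algebra
    show "\<exists>y z. eval3 F (vector [0, z, y]) \<noteq> 0"
    proof (rule ccontr)
      assume "\<not> ?thesis"
      then have 0: "eval3 F (vector [0, 1, y]) = 0" for y by blast
      have "[:5976432, 97020, - 18550, - 500:] = (0 :: 'a poly)"
      proof (rule poly_eqI_all)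
        show "poly [:5976432, 97020, - 18550, - 500:] y = poly 0 y" for y :: 'a
          using 0[of y] unfolding F_def by (simp only: eval3_list) Groebner_Basis.algebra
      qed
      \<comment> \<open>The two coefficients cannot both vanish: 500 = 4 * 5^3 forces 5 = 0, while
        5976432 is 2 modulo 5.\<close>
      then have 5: "(5976432 :: 'a) = 0" "(500 :: 'a) = 0" by simp_all
      have "(4 :: 'a) * 5 ^ 3 = 0" using 5(2) by simp
      then have f5: "(5 :: 'a) = 0" using num(1) unfolding mult_eq_0_iff power_eq_0_iff by simp
      have "(2 :: 'a) = 5976432 - 1195286 * 5" by simp
      then have "(2 :: 'a) = 0" unfolding 5(1) f5 by simp
      with two show False by simp
    qed
  qed
  have mV: "V u w * l u w = V' u w * l' u w" for u w
    unfolding V_def V'_def l_def l'_def by Groebner_Basis.algebra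
  have G1: "comp_monoid M.Gal \<cong> integer_mod_group 4"
    by (rule M.Gal_Z4[of "(1, -5, 1, 3)"]) (use num in \<open>simp_all add: Ms_def M.mob_involution_def\<close>)
  have G2: "comp_monoid (moebius_invariant.Gal 4 W V') \<cong> integer_mod_group 4"
    by (rule moebius_invariant.Gal_Z4[OF second, of "(1, 5, -1, 3)"])
      (use num in \<open>simp_all add: Ms'_def moebius_invariant.mob_involution_def[OF second]\<close>)
  have "has_galois_points (param_map (\<lambda>u w. vector [U u w * l u w, V u w * l u w, m u w])) (Suc 4)
      (integer_mod_group 4) (integer_mod_group 4)"
    by (rule has_galois_points_galois_curve[OF curve second m_def mV form_l' _ _ _ _ G1 G2,
          of 3 1 "- 3" 1]) (simp_all add: l_def l'_def)
  then show ?thesis by auto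
qed

text \<open>Here Q1 = 1 and Q2 = -1. G1 consists of the identity, t \<mapsto> (1 - t)/(1 + t) and
  two maps involving a square root i of -1; all three nontrivial matrices have trace zero and so are
  involutions. The zeros of U are the orbit 1, 0, -2 + i, -2 - i, those of V the orbit -1, infinity,
  i, -i. Again t \<mapsto> -t exchanges the two groups, and i, -i, infinity are common to V and
  V'.\<close>

lemma galois_points_V4_V4:
  assumes two: "(2 :: 'a::alg_closed_field) \<noteq> 0"
  shows "\<exists>f :: 'a P1 \<Rightarrow> 'a P2. has_galois_points f 5 (integer_mod_group 2 \<times>\<times> integer_mod_group 2) (integer_mod_group 2 \<times>\<times> integer_mod_group 2)"
proof -
  obtain i :: 'a where "i ^ 2 = - 1" using nth_root_exists[of 2 "- 1 :: 'a"] by auto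
  then have i2: "i * i + 1 = 0" by (simp add: power2_eq_square)
  have "(4 :: 'a) = 2 * 2" "(8 :: 'a) = 2 * 2 * 2" by simp_all
  then have num: "(4 :: 'a) \<noteq> 0" "(8 :: 'a) \<noteq> 0" using two by (metis mult_eq_0_iff)+
  have i: "i \<noteq> 0" "i \<noteq> 1" "i \<noteq> - 1" "- i \<noteq> i" "i \<noteq> - i" "1 \<noteq> - (1 :: 'a)" "- 1 \<noteq> (1 :: 'a)"
  proof -
    show i0: "i \<noteq> 0" using i2 by auto
    show "i \<noteq> 1" "i \<noteq> - 1" using i2 two by auto
    show "- i \<noteq> i" "i \<noteq> - i" using i0 two by (auto simp: neg_eq_iff_add_eq_0 eq_neg_iff_add_eq_0 mult_2[symmetric])
    show "1 \<noteq> - (1 :: 'a)" "- 1 \<noteq> (1 :: 'a)" using two by (auto simp: neg_eq_iff_add_eq_0 eq_neg_iff_add_eq_0)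
  qed
  define U V W V' l l' m :: "'a \<Rightarrow> 'a \<Rightarrow> 'a"
    where "U u w = u * (u - w) * (u ^ 2 + 4 * u * w + 5 * w ^ 2)"
      and "V u w = (u ^ 2 + w ^ 2) * (u + w) * w"
      and "W u w = u * (u + w) * (u ^ 2 - 4 * u * w + 5 * w ^ 2)"
      and "V' u w = (u ^ 2 + w ^ 2) * (u - w) * w"
      and "l u w = u - w" and "l' u w = u + w" and "m u w = W u w * l' u w" for u w
  define Ms Ms' :: "'a moebius list"
    where "Ms = [(1, 0, 0, 1), (-1, 1, 1, 1), (- i, -1 + -2 * i, 1, i), (i, -1 + 2 * i, 1, - i)]"
      and "Ms' = [(1, 0, 0, 1), (-1, -1, -1, 1), (- i, 1 + 2 * i, -1, i), (i, 1 + -2 * i, -1, - i)]"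
  define H1 H2 F :: "'a poly3"
    where "H1 = [:[:0, 0, [:0, 9:]:], [:[:0, 0, -2:], [:0, 2:], [:-11:]:], [:[:0, 1:], [:-6:]:], [:[:-1:]:]:]"
      and "H2 = [:[:0, 0, [:0, 1:], [:10:]:], [:0, [:0, -2:], [:-5:]:], [:[:0, 1:], [:-4:]:], [:[:-1:]:]:]"
      and "F = [:[:0, 0, [:0, 0, 0, -5:], [:0, 0, 26:], [:0, -50:]:], [:[:0, 0, 0, 0, 1:], [:0, 0, 0, -6:], [:0, 0, 23:], [:0, -28:], [:50:]:], [:[:0, 0, 0, -1:], [:0, 0, 4:], [:0, -23:], [:26:]:], [:[:0, 0, 1:], [:0, -6:], [:5:]:], [:[:0, -1:]:]:]"
  define c :: 'a where "c = - 1"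
  have c: "c \<noteq> 0" by (simp add: c_def)
  have form_l: "binary_form 1 l" and form_l': "binary_form 1 l'"
    by (rule binary_form_eq[where g = "\<lambda>u w. (-1) * (u ^ 0 * w ^ 1) + 1 * (u ^ 1 * w ^ 0)"],
        (rule binary_form_add | rule binary_form_monomial, simp)+, simp add: l_def,
      rule binary_form_eq[where g = "\<lambda>u w. 1 * (u ^ 0 * w ^ 1) + 1 * (u ^ 1 * w ^ 0)"],
        (rule binary_form_add | rule binary_form_monomial, simp)+, simp add: l'_def)
  have inv0: "U (mob_num (1, 0, 0, 1) u w) (mob_den (1, 0, 0, 1) u w) = (1) * U u w \<and>
      V (mob_num (1, 0, 0, 1) u w) (mob_den (1, 0, 0, 1) u w) = (1) * V u w" for u w
    by simp
  have inv1: "U (mob_num (-1, 1, 1, 1) u w) (mob_den (-1, 1, 1, 1) u w) = (4) * U u w \<and>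
      V (mob_num (-1, 1, 1, 1) u w) (mob_den (-1, 1, 1, 1) u w) = (4) * V u w" for u w
    unfolding U_def V_def mob_num.simps mob_den.simps by (intro conjI; Groebner_Basis.algebra)
  have inv2: "U (mob_num (- i, -1 + -2 * i, 1, i) u w) (mob_den (- i, -1 + -2 * i, 1, i) u w) = (8 * i) * U u w \<and>
      V (mob_num (- i, -1 + -2 * i, 1, i) u w) (mob_den (- i, -1 + -2 * i, 1, i) u w) = (8 * i) * V u w" for u w
    unfolding U_def V_def mob_num.simps mob_den.simps by (intro conjI; use i2 in \<open>Groebner_Basis.algebra\<close>)
  have inv3: "U (mob_num (i, -1 + 2 * i, 1, - i) u w) (mob_den (i, -1 + 2 * i, 1, - i) u w) = (-8 * i) * U u w \<and>
      V (mob_num (i, -1 + 2 * i, 1, - i) u w) (mob_den (i, -1 + 2 * i, 1, - i) u w) = (-8 * i) * V u w" for u w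
    unfolding U_def V_def mob_num.simps mob_den.simps by (intro conjI; use i2 in \<open>Groebner_Basis.algebra\<close>)
  have det0: "mob_det ((1, 0, 0, 1) :: 'a moebius) \<noteq> 0"
    by simp
  have det1: "mob_det ((-1, 1, 1, 1) :: 'a moebius) \<noteq> 0"
    using two by simp
  have det2: "mob_det ((- i, -1 + -2 * i, 1, i) :: 'a moebius) \<noteq> 0"
    proof -
    \<comment> \<open>The determinant is 2 + 2 i; its product with the conjugate 2 - 2 i is
      8.\<close>
    have "mob_det ((- i, -1 + -2 * i, 1, i) :: 'a moebius) * (2 - 2 * i) - 8 = 0" unfolding mob_det.simps using i2 by Groebner_Basis.algebra
    then show ?thesis using num two by auto
  qed
  have det3: "mob_det ((i, -1 + 2 * i, 1, - i) :: 'a moebius) \<noteq> 0"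
    proof -
    have "mob_det ((i, -1 + 2 * i, 1, - i) :: 'a moebius) * (2 + 2 * i) - 8 = 0" unfolding mob_det.simps using i2 by Groebner_Basis.algebra
    then show ?thesis using num two by auto
  qed
  have first: "moebius_invariant 4 U V Ms"
  proof
    show "(0::nat) < 4" "length Ms = 4" by (simp_all add: Ms_def)
    show "binary_form 4 U"
      by (rule binary_form_eq[where g = "\<lambda>u w. (-5) * (u ^ 1 * w ^ 3) + 1 * (u ^ 2 * w ^ 2) + 3 * (u ^ 3 * w ^ 1) + 1 * (u ^ 4 * w ^ 0)"],
        (rule binary_form_add | rule binary_form_monomial, simp)+, unfold U_def, Groebner_Basis.algebra)
    show "binary_form 4 V"
      by (rule binary_form_eq[where g = "\<lambda>u w. 1 * (u ^ 0 * w ^ 4) + 1 * (u ^ 1 * w ^ 3) + 1 * (u ^ 2 * w ^ 2) + 1 * (u ^ 3 * w ^ 1)"],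
        (rule binary_form_add | rule binary_form_monomial, simp)+, unfold V_def, Groebner_Basis.algebra)
    show "u = 0 \<and> w = 0" if 0: "U u w = 0" "V u w = 0" for u w
    proof -
      have "w = 0"
      proof -
        from 0(1) have "u = 0 \<or> u - w = 0 \<or> u ^ 2 + 4 * u * w + 5 * w ^ 2 = 0" by (simp add: U_def)
        then show ?thesis
        proof (elim disjE)
          assume "u = 0"
          with 0(2) have "1 * w ^ 4 = 0" unfolding V_def by Groebner_Basis.algebra
          then show "w = 0" using two num by simp
        next
          assume "u - w = 0"
          with 0(2) have "4 * w ^ 4 = 0" unfolding V_def by Groebner_Basis.algebra
          then show "w = 0" using two num by simp
        next
          assume "u ^ 2 + 4 * u * w + 5 * w ^ 2 = 0"
          with 0(2) have "8 * w ^ 5 = 0" unfolding V_def by Groebner_Basis.algebra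
          then show "w = 0" using two num by simp
        qed
      qed
      moreover from this 0(1) have "u ^ 4 - 0 * w = 0" unfolding U_def by Groebner_Basis.algebra
      ultimately show ?thesis by simp
    qed
    have cases: "M = (1, 0, 0, 1) \<or> M = (-1, 1, 1, 1) \<or> M = (- i, -1 + -2 * i, 1, i) \<or> M = (i, -1 + 2 * i, 1, - i)" if "M \<in> set Ms" for M
      using that by (simp add: Ms_def)
    show "mob_det M \<noteq> 0" if "M \<in> set Ms" for M
      using cases[OF that] det0 det1 det2 det3 by blast
    show "\<exists>\<rho>. \<forall>u w. U (mob_num M u w) (mob_den M u w) = \<rho> * U u w \<and>
        V (mob_num M u w) (mob_den M u w) = \<rho> * V u w" if "M \<in> set Ms" for M
      using cases[OF that] inv0 inv1 inv2 inv3 by blast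
    show "sorted_wrt (\<lambda>M M'. \<not> mob_eq M M') Ms"
      unfolding Ms_def by (simp add: i two two[symmetric])
  qed
  have inv0: "W (mob_num (1, 0, 0, 1) u w) (mob_den (1, 0, 0, 1) u w) = (1) * W u w \<and>
      V' (mob_num (1, 0, 0, 1) u w) (mob_den (1, 0, 0, 1) u w) = (1) * V' u w" for u w
    by simp
  have inv1: "W (mob_num (-1, -1, -1, 1) u w) (mob_den (-1, -1, -1, 1) u w) = (4) * W u w \<and>
      V' (mob_num (-1, -1, -1, 1) u w) (mob_den (-1, -1, -1, 1) u w) = (4) * V' u w" for u w
    unfolding W_def V'_def mob_num.simps mob_den.simps by (intro conjI; Groebner_Basis.algebra)
  have inv2: "W (mob_num (- i, 1 + 2 * i, -1, i) u w) (mob_den (- i, 1 + 2 * i, -1, i) u w) = (8 * i) * W u w \<and>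
      V' (mob_num (- i, 1 + 2 * i, -1, i) u w) (mob_den (- i, 1 + 2 * i, -1, i) u w) = (8 * i) * V' u w" for u w
    unfolding W_def V'_def mob_num.simps mob_den.simps by (intro conjI; use i2 in \<open>Groebner_Basis.algebra\<close>)
  have inv3: "W (mob_num (i, 1 + -2 * i, -1, - i) u w) (mob_den (i, 1 + -2 * i, -1, - i) u w) = (-8 * i) * W u w \<and>
      V' (mob_num (i, 1 + -2 * i, -1, - i) u w) (mob_den (i, 1 + -2 * i, -1, - i) u w) = (-8 * i) * V' u w" for u w
    unfolding W_def V'_def mob_num.simps mob_den.simps by (intro conjI; use i2 in \<open>Groebner_Basis.algebra\<close>)
  have det0: "mob_det ((1, 0, 0, 1) :: 'a moebius) \<noteq> 0"
    by simp
  have det1: "mob_det ((-1, -1, -1, 1) :: 'a moebius) \<noteq> 0"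
    using two by simp
  have det2: "mob_det ((- i, 1 + 2 * i, -1, i) :: 'a moebius) \<noteq> 0"
    proof -
    have "mob_det ((- i, 1 + 2 * i, -1, i) :: 'a moebius) * (2 - 2 * i) - 8 = 0" unfolding mob_det.simps using i2 by Groebner_Basis.algebra
    then show ?thesis using num two by auto
  qed
  have det3: "mob_det ((i, 1 + -2 * i, -1, - i) :: 'a moebius) \<noteq> 0"
    proof -
    have "mob_det ((i, 1 + -2 * i, -1, - i) :: 'a moebius) * (2 + 2 * i) - 8 = 0" unfolding mob_det.simps using i2 by Groebner_Basis.algebra
    then show ?thesis using num two by auto
  qed
  have second: "moebius_invariant 4 W V' Ms'"
  proof
    show "(0::nat) < 4" "length Ms' = 4" by (simp_all add: Ms'_def)
    show "binary_form 4 W"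
      by (rule binary_form_eq[where g = "\<lambda>u w. 5 * (u ^ 1 * w ^ 3) + 1 * (u ^ 2 * w ^ 2) + (-3) * (u ^ 3 * w ^ 1) + 1 * (u ^ 4 * w ^ 0)"],
        (rule binary_form_add | rule binary_form_monomial, simp)+, unfold W_def, Groebner_Basis.algebra)
    show "binary_form 4 V'"
      by (rule binary_form_eq[where g = "\<lambda>u w. (-1) * (u ^ 0 * w ^ 4) + 1 * (u ^ 1 * w ^ 3) + (-1) * (u ^ 2 * w ^ 2) + 1 * (u ^ 3 * w ^ 1)"],
        (rule binary_form_add | rule binary_form_monomial, simp)+, unfold V'_def, Groebner_Basis.algebra)
    show "u = 0 \<and> w = 0" if 0: "W u w = 0" "V' u w = 0" for u w
    proof -
      have "w = 0"
      proof -
        from 0(1) have "u = 0 \<or> u + w = 0 \<or> u ^ 2 - 4 * u * w + 5 * w ^ 2 = 0" by (simp add: W_def)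
        then show ?thesis
        proof (elim disjE)
          assume "u = 0"
          with 0(2) have "1 * w ^ 4 = 0" unfolding V'_def by Groebner_Basis.algebra
          then show "w = 0" using two num by simp
        next
          assume "u + w = 0"
          with 0(2) have "4 * w ^ 4 = 0" unfolding V'_def by Groebner_Basis.algebra
          then show "w = 0" using two num by simp
        next
          assume "u ^ 2 - 4 * u * w + 5 * w ^ 2 = 0"
          with 0(2) have "8 * w ^ 5 = 0" unfolding V'_def by Groebner_Basis.algebra
          then show "w = 0" using two num by simp
        qed
      qed
      moreover from this 0(1) have "u ^ 4 - 0 * w = 0" unfolding W_def by Groebner_Basis.algebra
      ultimately show ?thesis by simp
    qed
    have cases: "M = (1, 0, 0, 1) \<or> M = (-1, -1, -1, 1) \<or> M = (- i, 1 + 2 * i, -1, i) \<or> M = (i, 1 + -2 * i, -1, - i)" if "M \<in> set Ms'" for M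
      using that by (simp add: Ms'_def)
    show "mob_det M \<noteq> 0" if "M \<in> set Ms'" for M
      using cases[OF that] det0 det1 det2 det3 by blast
    show "\<exists>\<rho>. \<forall>u w. W (mob_num M u w) (mob_den M u w) = \<rho> * W u w \<and>
        V' (mob_num M u w) (mob_den M u w) = \<rho> * V' u w" if "M \<in> set Ms'" for M
      using cases[OF that] inv0 inv1 inv2 inv3 by blast
    show "sorted_wrt (\<lambda>M M'. \<not> mob_eq M M') Ms'"
      unfolding Ms'_def by (simp add: i two two[symmetric])
  qed
  have U_prod: "- 4 * U u w = (\<Prod>M\<leftarrow>Ms. l (mob_num M u w) (mob_den M u w))" for u w
    unfolding Ms_def list.map prod_list.Cons prod_list.Nil mob_num.simps mob_den.simps U_def l_def using i2 by Groebner_Basis.algebra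
  have kappa: "(- 4 :: 'a) \<noteq> 0" using two num by simp
  interpret M: moebius_invariant 4 U V Ms by (rule first)
  have form_m: "binary_form (Suc 4) m" unfolding m_def[abs_def]
    using binary_form_mult[OF moebius_invariant.form_U[OF second] form_l'] by simp
  have curve: "galois_curve 4 U V l m Ms H1 H2 3 F (1 / - 4) c"
  proof (intro galois_curve.intro galois_curve_axioms.intro plane_param.intro first)
    have "binary_form (Suc 4) (\<lambda>u w. U u w * l u w)" "binary_form (Suc 4) (\<lambda>u w. V u w * l u w)"
      using binary_form_mult[OF M.form_U form_l] binary_form_mult[OF M.form_V form_l] by simp_all
    with form_m show "binary_form (Suc 4) (\<lambda>u w. vector [U u w * l u w, V u w * l u w, m u w] $ k)" for k :: 3
      using exhaust_3[of k] by auto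
    show "vector [U u w * l u w, V u w * l u w, m u w] \<noteq> (0 :: 'a^3)" if uw: "u \<noteq> 0 \<or> w \<noteq> 0" for u w
    proof
      assume "vector [U u w * l u w, V u w * l u w, m u w] = (0 :: 'a^3)"
      then have 0: "U u w * l u w = 0" "V u w * l u w = 0" "m u w = 0" by (simp_all add: vec_eq_iff forall_3)
      have "l u w = 0" using 0 M.no_common_zero[of u w] uw by auto
      then show False
      proof -
        have "8 * w ^ 5 = 0" using \<open>l u w = 0\<close> 0(3) unfolding m_def W_def l'_def l_def by Groebner_Basis.algebra
        then have "w = 0" using two num by simp
        with \<open>l u w = 0\<close> uw show False by (simp add: l_def)
      qed
    qed
    show "form3 3 H1" "form3 3 H2" unfolding H1_def H2_def
      by (simp_all only: form_list)
    show "w * eval3 H1 (vector [U u w * l u w, V u w * l u w, m u w])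
        = u * eval3 H2 (vector [U u w * l u w, V u w * l u w, m u w])" for u w
      unfolding U_def V_def l_def m_def W_def l'_def H1_def H2_def
      by (simp only: eval3_list) Groebner_Basis.algebra
    show "\<exists>u w. eval3 H2 (vector [U u w * l u w, V u w * l u w, m u w]) \<noteq> 0"
    proof (rule ccontr)
      assume "\<not> ?thesis"
      then have 0: "eval3 H2 (vector [U t 1 * l t 1, V t 1 * l t 1, m t 1]) = 0" for t by blast
      define p :: "'a poly" where "p = [:-10, -20, 114, 248, -306, -860, -134, 592, 162, -268, -106, 56, 26, -4, -2, 0:]"
      have "poly p t = eval3 H2 (vector [U t 1 * l t 1, V t 1 * l t 1, m t 1])" for t
        unfolding U_def V_def l_def m_def W_def l'_def H2_def p_def
        by (simp only: eval3_list power_one mult_1_right mult_1_left) Groebner_Basis.algebra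
      then have "p = 0" using 0 by (intro poly_eqI_all) simp
      then show False unfolding p_def using two by simp
    qed
    show "binary_form 1 l" by (rule form_l)
    show "U u w = (1 / - 4) * (\<Prod>M\<leftarrow>Ms. l (mob_num M u w) (mob_den M u w))" for u w
      unfolding U_prod[symmetric] using kappa by simp
    show "form3 (Suc 4) F" unfolding F_def by (simp only: form_list)
    show "Polynomial.degree F = 4" unfolding F_def using c by (simp add: c_def)
    show "Polynomial.coeff F 4 = [:[:0, c:]:]" unfolding F_def c_def by (simp only: eval_nat_numeral BitM.simps numeral_One One_nat_def coeff_pCons_Suc coeff_pCons_0)
    show "eval3 F (vector [U u w * l u w, V u w * l u w, m u w]) = 0" for u w
      unfolding U_def V_def l_def m_def W_def l'_def F_def
      by (simp only: eval3_list) Groebner_Basis.algebra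
    show "\<exists>y z. eval3 F (vector [0, z, y]) \<noteq> 0"
    proof (rule ccontr)
      assume "\<not> ?thesis"
      then have 0: "eval3 F (vector [0, 1, y]) = 0" for y by blast
      have "[:0, 50, 26, 5:] = (0 :: 'a poly)"
      proof (rule poly_eqI_all)
        show "poly [:0, 50, 26, 5:] y = poly 0 y" for y :: 'a
          using 0[of y] unfolding F_def by (simp only: eval3_list) Groebner_Basis.algebra
      qed
      then have 5: "(26 :: 'a) = 0" "(5 :: 'a) = 0" by simp_all
      have "(1 :: 'a) = 26 - 5 * 5" by simp
      then have "(1 :: 'a) = 0" unfolding 5 by simp
      then show False by simp
    qed
  qed
  have mV: "V u w * l u w = V' u w * l' u w" for u w
    unfolding V_def V'_def l_def l'_def by Groebner_Basis.algebra
  have G1: "comp_monoid M.Gal \<cong> integer_mod_group 2 \<times>\<times> integer_mod_group 2"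
    by (rule M.Gal_Z2_Z2) (auto simp: Ms_def M.mob_involution_def algebra_simps)
  have G2: "comp_monoid (moebius_invariant.Gal 4 W V') \<cong> integer_mod_group 2 \<times>\<times> integer_mod_group 2"
    by (rule moebius_invariant.Gal_Z2_Z2[OF second])
      (auto simp: Ms'_def moebius_invariant.mob_involution_def[OF second] algebra_simps)
  have "has_galois_points (param_map (\<lambda>u w. vector [U u w * l u w, V u w * l u w, m u w])) (Suc 4)
      (integer_mod_group 2 \<times>\<times> integer_mod_group 2) (integer_mod_group 2 \<times>\<times> integer_mod_group 2)"
    by (rule has_galois_points_galois_curve[OF curve second m_def mV form_l' _ _ _ _ G1 G2,
          of 1 1 "- 1" 1]) (simp_all add: l_def l'_def)
  then show ?thesis by auto
qed

text \<open>The groups have different types, so no symmetry relates the two halves. G1 is generated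
  by M(t) = (t - i)/(1 - i t), whose square is 1/t. It fixes Q1 = 1, which is why U is a fourth
  power. The point Q2 is infinity, with G1-orbit infinity, i, 0, -i, the zeros of V; the G2-orbit of
  1 is 1, 0, i, -i, the zeros of V'. The zeros of W are the fixed points of the involution (1 -
  t)/(1 + t) in G2, each counted twice: a ramified fibre of the quotient by G2.\<close>

lemma galois_points_Z4_V4:
  assumes two: "(2 :: 'a::alg_closed_field) \<noteq> 0"
  shows "\<exists>f :: 'a P1 \<Rightarrow> 'a P2. has_galois_points f 5 (integer_mod_group 4) (integer_mod_group 2 \<times>\<times> integer_mod_group 2)"
proof -
  obtain i :: 'a where "i ^ 2 = - 1" using nth_root_exists[of 2 "- 1 :: 'a"] by auto
  then have i2: "i * i + 1 = 0" by (simp add: power2_eq_square)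
  have "(4 :: 'a) = 2 * 2" "(8 :: 'a) = 2 * 2 * 2" by simp_all
  then have num: "(4 :: 'a) \<noteq> 0" "(8 :: 'a) \<noteq> 0" using two by (metis mult_eq_0_iff)+
  have i: "i \<noteq> 0" "i \<noteq> 1" "i \<noteq> - 1" "- i \<noteq> i" "i \<noteq> - i" "1 \<noteq> - (1 :: 'a)" "- 1 \<noteq> (1 :: 'a)"
  proof -
    show i0: "i \<noteq> 0" using i2 by auto
    show "i \<noteq> 1" "i \<noteq> - 1" using i2 two by auto
    show "- i \<noteq> i" "i \<noteq> - i" using i0 two by (auto simp: neg_eq_iff_add_eq_0 eq_neg_iff_add_eq_0 mult_2[symmetric])
    show "1 \<noteq> - (1 :: 'a)" "- 1 \<noteq> (1 :: 'a)" using two by (auto simp: neg_eq_iff_add_eq_0 eq_neg_iff_add_eq_0)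
  qed
  define U V W V' l l' m :: "'a \<Rightarrow> 'a \<Rightarrow> 'a"
    where "U u w = (u - w) ^ 4"
      and "V u w = u * (u ^ 2 + w ^ 2) * w"
      and "W u w = (u ^ 2 + 2 * u * w - w ^ 2) ^ 2"
      and "V' u w = (u ^ 2 + w ^ 2) * u * (u - w)"
      and "l u w = u - w" and "l' u w = w" and "m u w = W u w * l' u w" for u w
  define Ms Ms' :: "'a moebius list"
    where "Ms = [(1, 0, 0, 1), (1, - i, - i, 1), (0, 1, 1, 0), (1, i, i, 1)]"
      and "Ms' = [(1, 0, 0, 1), (-1, 1, 1, 1), (- i, -1, 1 + -2 * i, i), (i, -1, 1 + 2 * i, - i)]"
  define H1 H2 F :: "'a poly3"
    where "H1 = [:[:0, [:0, 0, -10:], [:0, -56:], [:80:]:], [:[:0, 0, 2:], [:0, 11:], [:-84:]:], [:[:0, -1:], [:26:]:], [:[:-3:]:]:]"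
      and "H2 = [:[:0, 0, [:0, 12:], [:156:]:], [:0, [:0, -27:], [:-124:]:], [:[:0, 7:], [:32:]:], [:[:-3:]:]:]"
      and "F = [:[:0, [:0, 0, 0, 0, 2:], [:0, 0, 0, 32:], [:0, 0, 120:], [:0, -64:], [:8:]:], [:[:0, 0, 0, 0, -2:], [:0, 0, 0, -22:], [:0, 0, -32:], [:0, 132:]:], [:0, [:0, 0, -7:], [:0, -62:]:], [:[:0, 0, 1:], [:0, 12:]:], [:[:0, -1:]:]:]"
  define c :: 'a where "c = - 1"
  have c: "c \<noteq> 0" by (simp add: c_def)
  have form_l: "binary_form 1 l" and form_l': "binary_form 1 l'"
    by (rule binary_form_eq[where g = "\<lambda>u w. (-1) * (u ^ 0 * w ^ 1) + 1 * (u ^ 1 * w ^ 0)"],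
        (rule binary_form_add | rule binary_form_monomial, simp)+, simp add: l_def,
      rule binary_form_eq[where g = "\<lambda>u w. 1 * (u ^ 0 * w ^ 1)"],
        (rule binary_form_add | rule binary_form_monomial, simp)+, simp add: l'_def)
  have inv0: "U (mob_num (1, 0, 0, 1) u w) (mob_den (1, 0, 0, 1) u w) = (1) * U u w \<and>
      V (mob_num (1, 0, 0, 1) u w) (mob_den (1, 0, 0, 1) u w) = (1) * V u w" for u w
    by simp
  have inv1: "U (mob_num (1, - i, - i, 1) u w) (mob_den (1, - i, - i, 1) u w) = (-4) * U u w \<and>
      V (mob_num (1, - i, - i, 1) u w) (mob_den (1, - i, - i, 1) u w) = (-4) * V u w" for u w
    unfolding U_def V_def mob_num.simps mob_den.simps by (intro conjI; use i2 in \<open>Groebner_Basis.algebra\<close>)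
  have inv2: "U (mob_num (0, 1, 1, 0) u w) (mob_den (0, 1, 1, 0) u w) = (1) * U u w \<and>
      V (mob_num (0, 1, 1, 0) u w) (mob_den (0, 1, 1, 0) u w) = (1) * V u w" for u w
    unfolding U_def V_def mob_num.simps mob_den.simps by (intro conjI; Groebner_Basis.algebra)
  have inv3: "U (mob_num (1, i, i, 1) u w) (mob_den (1, i, i, 1) u w) = (-4) * U u w \<and>
      V (mob_num (1, i, i, 1) u w) (mob_den (1, i, i, 1) u w) = (-4) * V u w" for u w
    unfolding U_def V_def mob_num.simps mob_den.simps by (intro conjI; use i2 in \<open>Groebner_Basis.algebra\<close>)
  have det0: "mob_det ((1, 0, 0, 1) :: 'a moebius) \<noteq> 0"
    by simp
  have det1: "mob_det ((1, - i, - i, 1) :: 'a moebius) \<noteq> 0"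
    proof -
    have "mob_det ((1, - i, - i, 1) :: 'a moebius) * (1 :: 'a) - 2 = 0" unfolding mob_det.simps using i2 by Groebner_Basis.algebra
    then show ?thesis using num two by auto
  qed
  have det2: "mob_det ((0, 1, 1, 0) :: 'a moebius) \<noteq> 0"
    by simp
  have det3: "mob_det ((1, i, i, 1) :: 'a moebius) \<noteq> 0"
    proof -
    have "mob_det ((1, i, i, 1) :: 'a moebius) * (1 :: 'a) - 2 = 0" unfolding mob_det.simps using i2 by Groebner_Basis.algebra
    then show ?thesis using num two by auto
  qed
  have first: "moebius_invariant 4 U V Ms"
  proof
    show "(0::nat) < 4" "length Ms = 4" by (simp_all add: Ms_def)
    show "binary_form 4 U"
      by (rule binary_form_eq[where g = "\<lambda>u w. 1 * (u ^ 0 * w ^ 4) + (-4) * (u ^ 1 * w ^ 3) + 6 * (u ^ 2 * w ^ 2) + (-4) * (u ^ 3 * w ^ 1) + 1 * (u ^ 4 * w ^ 0)"],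
        (rule binary_form_add | rule binary_form_monomial, simp)+, unfold U_def, Groebner_Basis.algebra)
    show "binary_form 4 V"
      by (rule binary_form_eq[where g = "\<lambda>u w. 1 * (u ^ 1 * w ^ 3) + 1 * (u ^ 3 * w ^ 1)"],
        (rule binary_form_add | rule binary_form_monomial, simp)+, unfold V_def, Groebner_Basis.algebra)
    show "u = 0 \<and> w = 0" if 0: "U u w = 0" "V u w = 0" for u w
    proof -
      have "w = 0"
      proof -
        from 0(1) have "u - w = 0" by (simp add: U_def)
        then show ?thesis
        proof -
          assume "u - w = 0"
          with 0(2) have "2 * w ^ 4 = 0" unfolding V_def by Groebner_Basis.algebra
          then show "w = 0" using two num by simp
        qed
      qed
      moreover from this 0(1) have "u ^ 4 - 0 * w = 0" unfolding U_def by Groebner_Basis.algebra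
      ultimately show ?thesis by simp
    qed
    have cases: "M = (1, 0, 0, 1) \<or> M = (1, - i, - i, 1) \<or> M = (0, 1, 1, 0) \<or> M = (1, i, i, 1)" if "M \<in> set Ms" for M
      using that by (simp add: Ms_def)
    show "mob_det M \<noteq> 0" if "M \<in> set Ms" for M
      using cases[OF that] det0 det1 det2 det3 by blast
    show "\<exists>\<rho>. \<forall>u w. U (mob_num M u w) (mob_den M u w) = \<rho> * U u w \<and>
        V (mob_num M u w) (mob_den M u w) = \<rho> * V u w" if "M \<in> set Ms" for M
      using cases[OF that] inv0 inv1 inv2 inv3 by blast
    show "sorted_wrt (\<lambda>M M'. \<not> mob_eq M M') Ms"
      unfolding Ms_def by (simp add: i two two[symmetric])
  qed
  have inv0: "W (mob_num (1, 0, 0, 1) u w) (mob_den (1, 0, 0, 1) u w) = (1) * W u w \<and>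
      V' (mob_num (1, 0, 0, 1) u w) (mob_den (1, 0, 0, 1) u w) = (1) * V' u w" for u w
    by simp
  have inv1: "W (mob_num (-1, 1, 1, 1) u w) (mob_den (-1, 1, 1, 1) u w) = (4) * W u w \<and>
      V' (mob_num (-1, 1, 1, 1) u w) (mob_den (-1, 1, 1, 1) u w) = (4) * V' u w" for u w
    unfolding W_def V'_def mob_num.simps mob_den.simps by (intro conjI; Groebner_Basis.algebra)
  have inv2: "W (mob_num (- i, -1, 1 + -2 * i, i) u w) (mob_den (- i, -1, 1 + -2 * i, i) u w) = (-8 * i) * W u w \<and>
      V' (mob_num (- i, -1, 1 + -2 * i, i) u w) (mob_den (- i, -1, 1 + -2 * i, i) u w) = (-8 * i) * V' u w" for u w
    unfolding W_def V'_def mob_num.simps mob_den.simps by (intro conjI; use i2 in \<open>Groebner_Basis.algebra\<close>)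
  have inv3: "W (mob_num (i, -1, 1 + 2 * i, - i) u w) (mob_den (i, -1, 1 + 2 * i, - i) u w) = (8 * i) * W u w \<and>
      V' (mob_num (i, -1, 1 + 2 * i, - i) u w) (mob_den (i, -1, 1 + 2 * i, - i) u w) = (8 * i) * V' u w" for u w
    unfolding W_def V'_def mob_num.simps mob_den.simps by (intro conjI; use i2 in \<open>Groebner_Basis.algebra\<close>)
  have det0: "mob_det ((1, 0, 0, 1) :: 'a moebius) \<noteq> 0"
    by simp
  have det1: "mob_det ((-1, 1, 1, 1) :: 'a moebius) \<noteq> 0"
    using two by simp
  have det2: "mob_det ((- i, -1, 1 + -2 * i, i) :: 'a moebius) \<noteq> 0"
    proof -
    have "mob_det ((- i, -1, 1 + -2 * i, i) :: 'a moebius) * (2 + 2 * i) - 8 = 0" unfolding mob_det.simps using i2 by Groebner_Basis.algebra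
    then show ?thesis using num two by auto
  qed
  have det3: "mob_det ((i, -1, 1 + 2 * i, - i) :: 'a moebius) \<noteq> 0"
    proof -
    have "mob_det ((i, -1, 1 + 2 * i, - i) :: 'a moebius) * (2 - 2 * i) - 8 = 0" unfolding mob_det.simps using i2 by Groebner_Basis.algebra
    then show ?thesis using num two by auto
  qed
  have second: "moebius_invariant 4 W V' Ms'"
  proof
    show "(0::nat) < 4" "length Ms' = 4" by (simp_all add: Ms'_def)
    show "binary_form 4 W"
      by (rule binary_form_eq[where g = "\<lambda>u w. 1 * (u ^ 0 * w ^ 4) + (-4) * (u ^ 1 * w ^ 3) + 2 * (u ^ 2 * w ^ 2) + 4 * (u ^ 3 * w ^ 1) + 1 * (u ^ 4 * w ^ 0)"],
        (rule binary_form_add | rule binary_form_monomial, simp)+, unfold W_def, Groebner_Basis.algebra)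
    show "binary_form 4 V'"
      by (rule binary_form_eq[where g = "\<lambda>u w. (-1) * (u ^ 1 * w ^ 3) + 1 * (u ^ 2 * w ^ 2) + (-1) * (u ^ 3 * w ^ 1) + 1 * (u ^ 4 * w ^ 0)"],
        (rule binary_form_add | rule binary_form_monomial, simp)+, unfold V'_def, Groebner_Basis.algebra)
    show "u = 0 \<and> w = 0" if 0: "W u w = 0" "V' u w = 0" for u w
    proof -
      have "w = 0"
      proof -
        from 0(2) have "u ^ 2 + w ^ 2 = 0 \<or> u = 0 \<or> u - w = 0" by (simp add: V'_def)
        then show ?thesis
        proof (elim disjE)
          assume "u ^ 2 + w ^ 2 = 0"
          with 0(1) have "8 * w ^ 5 = 0" unfolding W_def by Groebner_Basis.algebra
          then show "w = 0" using two num by simp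
        next
          assume "u = 0"
          with 0(1) have "1 * w ^ 4 = 0" unfolding W_def by Groebner_Basis.algebra
          then show "w = 0" using two num by simp
        next
          assume "u - w = 0"
          with 0(1) have "4 * w ^ 4 = 0" unfolding W_def by Groebner_Basis.algebra
          then show "w = 0" using two num by simp
        qed
      qed
      moreover from this 0(1) have "u ^ 4 - 0 * w = 0" unfolding W_def by Groebner_Basis.algebra
      ultimately show ?thesis by simp
    qed
    have cases: "M = (1, 0, 0, 1) \<or> M = (-1, 1, 1, 1) \<or> M = (- i, -1, 1 + -2 * i, i) \<or> M = (i, -1, 1 + 2 * i, - i)" if "M \<in> set Ms'" for M
      using that by (simp add: Ms'_def)
    show "mob_det M \<noteq> 0" if "M \<in> set Ms'" for M
      using cases[OF that] det0 det1 det2 det3 by blast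
    show "\<exists>\<rho>. \<forall>u w. W (mob_num M u w) (mob_den M u w) = \<rho> * W u w \<and>
        V' (mob_num M u w) (mob_den M u w) = \<rho> * V' u w" if "M \<in> set Ms'" for M
      using cases[OF that] inv0 inv1 inv2 inv3 by blast
    show "sorted_wrt (\<lambda>M M'. \<not> mob_eq M M') Ms'"
      unfolding Ms'_def by (simp add: i two two[symmetric])
  qed
  have U_prod: "- 2 * U u w = (\<Prod>M\<leftarrow>Ms. l (mob_num M u w) (mob_den M u w))" for u w
    unfolding Ms_def list.map prod_list.Cons prod_list.Nil mob_num.simps mob_den.simps U_def l_def using i2 by Groebner_Basis.algebra
  have kappa: "(- 2 :: 'a) \<noteq> 0" using two num by simp
  interpret M: moebius_invariant 4 U V Ms by (rule first)
  have form_m: "binary_form (Suc 4) m" unfolding m_def[abs_def]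
    using binary_form_mult[OF moebius_invariant.form_U[OF second] form_l'] by simp
  have curve: "galois_curve 4 U V l m Ms H1 H2 3 F (1 / - 2) c"
  proof (intro galois_curve.intro galois_curve_axioms.intro plane_param.intro first)
    have "binary_form (Suc 4) (\<lambda>u w. U u w * l u w)" "binary_form (Suc 4) (\<lambda>u w. V u w * l u w)"
      using binary_form_mult[OF M.form_U form_l] binary_form_mult[OF M.form_V form_l] by simp_all
    with form_m show "binary_form (Suc 4) (\<lambda>u w. vector [U u w * l u w, V u w * l u w, m u w] $ k)" for k :: 3
      using exhaust_3[of k] by auto
    show "vector [U u w * l u w, V u w * l u w, m u w] \<noteq> (0 :: 'a^3)" if uw: "u \<noteq> 0 \<or> w \<noteq> 0" for u w
    proof
      assume "vector [U u w * l u w, V u w * l u w, m u w] = (0 :: 'a^3)"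
      then have 0: "U u w * l u w = 0" "V u w * l u w = 0" "m u w = 0" by (simp_all add: vec_eq_iff forall_3)
      have "l u w = 0" using 0 M.no_common_zero[of u w] uw by auto
      then show False
      proof -
        have "4 * w ^ 5 = 0" using \<open>l u w = 0\<close> 0(3) unfolding m_def W_def l'_def l_def by Groebner_Basis.algebra
        then have "w = 0" using two num by simp
        with \<open>l u w = 0\<close> uw show False by (simp add: l_def)
      qed
    qed
    show "form3 3 H1" "form3 3 H2" unfolding H1_def H2_def
      by (simp_all only: form_list)
    show "w * eval3 H1 (vector [U u w * l u w, V u w * l u w, m u w])
        = u * eval3 H2 (vector [U u w * l u w, V u w * l u w, m u w])" for u w
      unfolding U_def V_def l_def m_def W_def l'_def H1_def H2_def
      by (simp only: eval3_list) Groebner_Basis.algebra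
    show "\<exists>u w. eval3 H2 (vector [U u w * l u w, V u w * l u w, m u w]) \<noteq> 0"
    proof (rule ccontr)
      assume "\<not> ?thesis"
      then have 0: "eval3 H2 (vector [U t 1 * l t 1, V t 1 * l t 1, m t 1]) = 0" for t by blast
      define p :: "'a poly" where "p = [:-10, 68, -230, 296, 272, -1768, 2852, -2312, 742, -212, 226, -160, 52, -8:]"
      have "poly p t = eval3 H2 (vector [U t 1 * l t 1, V t 1 * l t 1, m t 1])" for t
        unfolding U_def V_def l_def m_def W_def l'_def H2_def p_def
        by (simp only: eval3_list power_one mult_1_right mult_1_left) Groebner_Basis.algebra
      then have "p = 0" using 0 by (intro poly_eqI_all) simp
      then show False unfolding p_def using num by simp
    qed
    show "binary_form 1 l" by (rule form_l)
    show "U u w = (1 / - 2) * (\<Prod>M\<leftarrow>Ms. l (mob_num M u w) (mob_den M u w))" for u w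
      unfolding U_prod[symmetric] using kappa by simp
    show "form3 (Suc 4) F" unfolding F_def by (simp only: form_list)
    show "Polynomial.degree F = 4" unfolding F_def using c by (simp add: c_def)
    show "Polynomial.coeff F 4 = [:[:0, c:]:]" unfolding F_def c_def by (simp only: eval_nat_numeral BitM.simps numeral_One One_nat_def coeff_pCons_Suc coeff_pCons_0)
    show "eval3 F (vector [U u w * l u w, V u w * l u w, m u w]) = 0" for u w
      unfolding U_def V_def l_def m_def W_def l'_def F_def
      by (simp only: eval3_list) Groebner_Basis.algebra
    \<comment> \<open>On the line x_1 = 0 the form F is 8 x_2^5: the tangent at (0:0:1) meets the
      curve nowhere else, reflecting that Q1 is fixed by G1.\<close>
    show "\<exists>y z. eval3 F (vector [0, z, y]) \<noteq> 0"
      by (rule exI[of _ 0], rule exI[of _ 1], use num in \<open>simp add: F_def eval3_list\<close>)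
  qed
  have mV: "V u w * l u w = V' u w * l' u w" for u w
    unfolding V_def V'_def l_def l'_def by Groebner_Basis.algebra
  have G1: "comp_monoid M.Gal \<cong> integer_mod_group 4"
    by (rule M.Gal_Z4[of "(1, - i, - i, 1)"])
      (use i2 i two in \<open>simp_all add: Ms_def M.mob_involution_def\<close>)
  have G2: "comp_monoid (moebius_invariant.Gal 4 W V') \<cong> integer_mod_group 2 \<times>\<times> integer_mod_group 2"
    by (rule moebius_invariant.Gal_Z2_Z2[OF second])
      (auto simp: Ms'_def moebius_invariant.mob_involution_def[OF second] algebra_simps)
  have "has_galois_points (param_map (\<lambda>u w. vector [U u w * l u w, V u w * l u w, m u w])) (Suc 4)
      (integer_mod_group 4) (integer_mod_group 2 \<times>\<times> integer_mod_group 2)"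
    by (rule has_galois_points_galois_curve[OF curve second m_def mV form_l' _ _ _ _ G1 G2,
          of 1 1 1 0]) (simp_all add: l_def l'_def)
  then show ?thesis by auto
qed

text \<open>Here Q1 is infinity and Q2 = 0, with d^2 = 5 and e^2 = 2 - d. Outside characteristic 5,
  put s = a t with a^2 = -d; up to a constant U/V is then (5 s^4 - 10 s^2 + 1)/(s^5 - 10 s^3 + 5 s),
  the formula for cot 5x in s = tan x, which has a cyclic symmetry group of order five. The formulas
  remain valid in characteristic 5, where d = 0, the group consists of translations, and U = w^5.
  Exchanging u and w exchanges the two halves, and the quartic common to V and V' is symmetric, so V
  l = V' l'.\<close>

lemma galois_points_Z5_Z5:
  assumes two: "(2 :: 'a::alg_closed_field) \<noteq> 0"
  shows "\<exists>f :: 'a P1 \<Rightarrow> 'a P2. has_galois_points f 6 (integer_mod_group 5) (integer_mod_group 5)"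
proof -
  obtain d :: 'a where "d ^ 2 = 5" using nth_root_exists[of 2 "5 :: 'a"] by auto
  then have d2: "d * d - 5 = 0" by (simp add: power2_eq_square)
  obtain e :: 'a where "e ^ 2 = 2 - d" using nth_root_exists[of 2 "2 - d"] by auto
  then have e2: "e * e + d - 2 = 0" by (simp add: power2_eq_square)
  have "(4 :: 'a) = 2 * 2" "(8 :: 'a) = 2 * 2 * 2" "(16 :: 'a) = 2 * 2 * 2 * 2" by simp_all
  then have num: "(4 :: 'a) \<noteq> 0" "(8 :: 'a) \<noteq> 0" "(16 :: 'a) \<noteq> 0" using two by (metis mult_eq_0_iff)+
  have e: "e \<noteq> 0" "e \<noteq> - e" "e * e \<noteq> 1" "e * e \<noteq> - 1" "- (e * e) \<noteq> 1"
  proof -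
    \<comment> \<open>The product of 2 - d and 2 + d is -1, so e^2 = 2 - d is invertible.\<close>
    have "e * e * (2 + d) + 1 = 0" using d2 e2 by Groebner_Basis.algebra
    then show e0: "e \<noteq> 0" by auto
    with two show "e \<noteq> - e" by (auto simp: eq_neg_iff_add_eq_0 mult_2[symmetric])
    show "e * e \<noteq> 1"
    proof
      assume "e * e = 1"
      then have "d = 1" using e2 by (simp add: algebra_simps)
      with d2 num show False by simp
    qed
    show neg: "e * e \<noteq> - 1"
    proof
      assume "e * e = - 1"
      then have "d = 3" using e2 by (simp add: algebra_simps)
      with d2 num show False by simp
    qed
    from neg show "- (e * e) \<noteq> 1" by (metis minus_minus)
  qed
  define U V W V' l l' m :: "'a \<Rightarrow> 'a \<Rightarrow> 'a"
    where "U u w = w * (25 * u ^ 4 + 10 * d * u ^ 2 * w ^ 2 + w ^ 4)"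
      and "V u w = u * (u ^ 4 + 2 * d * u ^ 2 * w ^ 2 + w ^ 4)"
      and "W u w = u * (u ^ 4 + 10 * d * u ^ 2 * w ^ 2 + 25 * w ^ 4)"
      and "V' u w = w * (u ^ 4 + 2 * d * u ^ 2 * w ^ 2 + w ^ 4)"
      and "l u w = w" and "l' u w = u" and "m u w = W u w * l' u w" for u w
  define Ms Ms' :: "'a moebius list"
    where "Ms = [(1, 0, 0, 1), (1, e, d * e, 1), (1, - e, - d * e, 1), (e, - 1, - d, e), (e, 1, d, e)]"
      and "Ms' = [(1, 0, 0, 1), (1, d * e, e, 1), (1, - d * e, - e, 1), (e, - d, - 1, e), (e, d, 1, e)]"
  define H1 H2 F :: "'a poly3"
    where "H1 = [:[:0, 0, 0, [:0, -171:]:], [:0, [:0, 0, 7:], 0, [:81 * d:]:], [:0, [:0, -5 * d:]:], [:0, [:4:]:]:]"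
      and "H2 = [:[:0, 0, [:0, 0, -21:], 0, [:-297 * d:]:], [:[:0, 0, 0, 1:], 0, [:0, 30 * d:]:], [:[:0, 0, - d:], 0, [:-21:]:], [:[:0, 1:]:]:]"
      and "F = [:[:0, 0, [:0, 0, 0, 0, -25:], 0, [:0, 0, -585 * d:], 0, [:-9801:]:], [:[:0, 0, 0, 0, 0, 1:], 0, [:0, 0, 0, 67 * d:], 0, [:0, 3141:]:], [:[:0, 0, 0, 0, -2 * d:], 0, [:0, 0, -259:], 0, [:-585 * d:]:], [:[:0, 0, 0, 7:], 0, [:0, 67 * d:]:], [:[:0, 0, -2 * d:], 0, [:-25:]:], [:[:0, 1:]:]:]"
  define c :: 'a where "c = 1"
  have c: "c \<noteq> 0" by (simp add: c_def)
  have form_l: "binary_form 1 l" and form_l': "binary_form 1 l'"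
    by (rule binary_form_eq[where g = "\<lambda>u w. 1 * (u ^ 0 * w ^ 1)"],
        (rule binary_form_add | rule binary_form_monomial, simp)+, simp add: l_def,
      rule binary_form_eq[where g = "\<lambda>u w. 1 * (u ^ 1 * w ^ 0)"],
        (rule binary_form_add | rule binary_form_monomial, simp)+, simp add: l'_def)
  have inv0: "U (mob_num (1, 0, 0, 1) u w) (mob_den (1, 0, 0, 1) u w) = (1) * U u w \<and>
      V (mob_num (1, 0, 0, 1) u w) (mob_den (1, 0, 0, 1) u w) = (1) * V u w" for u w
    by simp
  have inv1: "U (mob_num (1, e, d * e, 1) u w) (mob_den (1, e, d * e, 1) u w) = (176 - 80 * d) * U u w \<and>
      V (mob_num (1, e, d * e, 1) u w) (mob_den (1, e, d * e, 1) u w) = (176 - 80 * d) * V u w" for u w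
    unfolding U_def V_def mob_num.simps mob_den.simps by (intro conjI; use d2 e2 in \<open>Groebner_Basis.algebra\<close>)
  have inv2: "U (mob_num (1, - e, - d * e, 1) u w) (mob_den (1, - e, - d * e, 1) u w) = (176 - 80 * d) * U u w \<and>
      V (mob_num (1, - e, - d * e, 1) u w) (mob_den (1, - e, - d * e, 1) u w) = (176 - 80 * d) * V u w" for u w
    unfolding U_def V_def mob_num.simps mob_den.simps by (intro conjI; use d2 e2 in \<open>Groebner_Basis.algebra\<close>)
  have inv3: "U (mob_num (e, - 1, - d, e) u w) (mob_den (e, - 1, - d, e) u w) = (16 * e * (d - 1)) * U u w \<and>
      V (mob_num (e, - 1, - d, e) u w) (mob_den (e, - 1, - d, e) u w) = (16 * e * (d - 1)) * V u w" for u w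
    unfolding U_def V_def mob_num.simps mob_den.simps by (intro conjI; use d2 e2 in \<open>Groebner_Basis.algebra\<close>)
  have inv4: "U (mob_num (e, 1, d, e) u w) (mob_den (e, 1, d, e) u w) = (16 * e * (d - 1)) * U u w \<and>
      V (mob_num (e, 1, d, e) u w) (mob_den (e, 1, d, e) u w) = (16 * e * (d - 1)) * V u w" for u w
    unfolding U_def V_def mob_num.simps mob_den.simps by (intro conjI; use d2 e2 in \<open>Groebner_Basis.algebra\<close>)
  have det0: "mob_det ((1, 0, 0, 1) :: 'a moebius) \<noteq> 0"
    by simp
  have det1: "mob_det ((1, e, d * e, 1) :: 'a moebius) \<noteq> 0"
    proof -
    \<comment> \<open>The determinant is 6 - 2 d; its product with 6 + 2 d is 16.\<close>
    have "mob_det ((1, e, d * e, 1) :: 'a moebius) * (6 + 2 * d) - 16 = 0" unfolding mob_det.simps using d2 e2 by Groebner_Basis.algebra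
    then show ?thesis using num by auto
  qed
  have det2: "mob_det ((1, - e, - d * e, 1) :: 'a moebius) \<noteq> 0"
    proof -
    have "mob_det ((1, - e, - d * e, 1) :: 'a moebius) * (6 + 2 * d) - 16 = 0" unfolding mob_det.simps using d2 e2 by Groebner_Basis.algebra
    then show ?thesis using num by auto
  qed
  have det3: "mob_det ((e, - 1, - d, e) :: 'a moebius) \<noteq> 0"
    proof -
    have "mob_det ((e, - 1, - d, e) :: 'a moebius) * (2 + 2 * d) + 16 = 0" unfolding mob_det.simps using d2 e2 by Groebner_Basis.algebra
    then show ?thesis using num by auto
  qed
  have det4: "mob_det ((e, 1, d, e) :: 'a moebius) \<noteq> 0"
    proof -
    have "mob_det ((e, 1, d, e) :: 'a moebius) * (2 + 2 * d) + 16 = 0" unfolding mob_det.simps using d2 e2 by Groebner_Basis.algebra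
    then show ?thesis using num by auto
  qed
  have first: "moebius_invariant 5 U V Ms"
  proof
    show "(0::nat) < 5" "length Ms = 5" by (simp_all add: Ms_def)
    show "binary_form 5 U"
      by (rule binary_form_eq[where g = "\<lambda>u w. 1 * (u ^ 0 * w ^ 5) + (10 * d) * (u ^ 2 * w ^ 3) + 25 * (u ^ 4 * w ^ 1)"],
        (rule binary_form_add | rule binary_form_monomial, simp)+, unfold U_def, Groebner_Basis.algebra)
    show "binary_form 5 V"
      by (rule binary_form_eq[where g = "\<lambda>u w. 1 * (u ^ 1 * w ^ 4) + (2 * d) * (u ^ 3 * w ^ 2) + 1 * (u ^ 5 * w ^ 0)"],
        (rule binary_form_add | rule binary_form_monomial, simp)+, unfold V_def, Groebner_Basis.algebra)
    show "u = 0 \<and> w = 0" if 0: "U u w = 0" "V u w = 0" for u w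
    proof -
      have "w = 0"
      proof (rule ccontr)
        assume "w \<noteq> 0"
        then have 1: "25 * u ^ 4 + 10 * d * u ^ 2 * w ^ 2 + w ^ 4 = 0" using 0 by (simp add: U_def)
        show False
        proof (cases "u = 0")
          case True
          with 1 \<open>w \<noteq> 0\<close> show False by simp
        next
          case False
          then have 2: "u ^ 4 + 2 * d * u ^ 2 * w ^ 2 + w ^ 4 = 0" using 0 by (simp add: V_def)
          \<comment> \<open>The difference of the two quartics. Inserting 3 u^2 = - d w^2 into nine
            times the second quartic then leaves -16 w^4.\<close>
          have "8 * (u ^ 2 * (3 * u ^ 2 + d * w ^ 2)) = 0" using 1 2 by Groebner_Basis.algebra
          then have 3: "3 * u ^ 2 + d * w ^ 2 = 0" using num False by simp
          have "16 * w ^ 4 = 0" using 2 3 d2 by Groebner_Basis.algebra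
          then show False using num \<open>w \<noteq> 0\<close> by simp
        qed
      qed
      moreover from this have "u = 0" using 0 by (simp add: V_def)
      ultimately show ?thesis by simp
    qed
    have cases: "M = (1, 0, 0, 1) \<or> M = (1, e, d * e, 1) \<or> M = (1, - e, - d * e, 1) \<or> M = (e, - 1, - d, e) \<or> M = (e, 1, d, e)" if "M \<in> set Ms" for M
      using that by (simp add: Ms_def)
    show "mob_det M \<noteq> 0" if "M \<in> set Ms" for M
      using cases[OF that] det0 det1 det2 det3 det4 by blast
    show "\<exists>\<rho>. \<forall>u w. U (mob_num M u w) (mob_den M u w) = \<rho> * U u w \<and>
        V (mob_num M u w) (mob_den M u w) = \<rho> * V u w" if "M \<in> set Ms" for M
      using cases[OF that] inv0 inv1 inv2 inv3 inv4 by blast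
    show "sorted_wrt (\<lambda>M M'. \<not> mob_eq M M') Ms"
      unfolding Ms_def by (simp add: e e(2,4)[symmetric] two)
  qed
  have inv0: "W (mob_num (1, 0, 0, 1) u w) (mob_den (1, 0, 0, 1) u w) = (1) * W u w \<and>
      V' (mob_num (1, 0, 0, 1) u w) (mob_den (1, 0, 0, 1) u w) = (1) * V' u w" for u w
    by simp
  have inv1: "W (mob_num (1, d * e, e, 1) u w) (mob_den (1, d * e, e, 1) u w) = (176 - 80 * d) * W u w \<and>
      V' (mob_num (1, d * e, e, 1) u w) (mob_den (1, d * e, e, 1) u w) = (176 - 80 * d) * V' u w" for u w
    unfolding W_def V'_def mob_num.simps mob_den.simps by (intro conjI; use d2 e2 in \<open>Groebner_Basis.algebra\<close>)
  have inv2: "W (mob_num (1, - d * e, - e, 1) u w) (mob_den (1, - d * e, - e, 1) u w) = (176 - 80 * d) * W u w \<and>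
      V' (mob_num (1, - d * e, - e, 1) u w) (mob_den (1, - d * e, - e, 1) u w) = (176 - 80 * d) * V' u w" for u w
    unfolding W_def V'_def mob_num.simps mob_den.simps by (intro conjI; use d2 e2 in \<open>Groebner_Basis.algebra\<close>)
  have inv3: "W (mob_num (e, - d, - 1, e) u w) (mob_den (e, - d, - 1, e) u w) = (16 * e * (d - 1)) * W u w \<and>
      V' (mob_num (e, - d, - 1, e) u w) (mob_den (e, - d, - 1, e) u w) = (16 * e * (d - 1)) * V' u w" for u w
    unfolding W_def V'_def mob_num.simps mob_den.simps by (intro conjI; use d2 e2 in \<open>Groebner_Basis.algebra\<close>)
  have inv4: "W (mob_num (e, d, 1, e) u w) (mob_den (e, d, 1, e) u w) = (16 * e * (d - 1)) * W u w \<and>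
      V' (mob_num (e, d, 1, e) u w) (mob_den (e, d, 1, e) u w) = (16 * e * (d - 1)) * V' u w" for u w
    unfolding W_def V'_def mob_num.simps mob_den.simps by (intro conjI; use d2 e2 in \<open>Groebner_Basis.algebra\<close>)
  have det0: "mob_det ((1, 0, 0, 1) :: 'a moebius) \<noteq> 0"
    by simp
  have det1: "mob_det ((1, d * e, e, 1) :: 'a moebius) \<noteq> 0"
    proof -
    have "mob_det ((1, d * e, e, 1) :: 'a moebius) * (6 + 2 * d) - 16 = 0" unfolding mob_det.simps using d2 e2 by Groebner_Basis.algebra
    then show ?thesis using num by auto
  qed
  have det2: "mob_det ((1, - d * e, - e, 1) :: 'a moebius) \<noteq> 0"
    proof -
    have "mob_det ((1, - d * e, - e, 1) :: 'a moebius) * (6 + 2 * d) - 16 = 0" unfolding mob_det.simps using d2 e2 by Groebner_Basis.algebra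
    then show ?thesis using num by auto
  qed
  have det3: "mob_det ((e, - d, - 1, e) :: 'a moebius) \<noteq> 0"
    proof -
    have "mob_det ((e, - d, - 1, e) :: 'a moebius) * (2 + 2 * d) + 16 = 0" unfolding mob_det.simps using d2 e2 by Groebner_Basis.algebra
    then show ?thesis using num by auto
  qed
  have det4: "mob_det ((e, d, 1, e) :: 'a moebius) \<noteq> 0"
    proof -
    have "mob_det ((e, d, 1, e) :: 'a moebius) * (2 + 2 * d) + 16 = 0" unfolding mob_det.simps using d2 e2 by Groebner_Basis.algebra
    then show ?thesis using num by auto
  qed
  have second: "moebius_invariant 5 W V' Ms'"
  proof
    show "(0::nat) < 5" "length Ms' = 5" by (simp_all add: Ms'_def)
    show "binary_form 5 W"
      by (rule binary_form_eq[where g = "\<lambda>u w. 25 * (u ^ 1 * w ^ 4) + (10 * d) * (u ^ 3 * w ^ 2) + 1 * (u ^ 5 * w ^ 0)"],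
        (rule binary_form_add | rule binary_form_monomial, simp)+, unfold W_def, Groebner_Basis.algebra)
    show "binary_form 5 V'"
      by (rule binary_form_eq[where g = "\<lambda>u w. 1 * (u ^ 0 * w ^ 5) + (2 * d) * (u ^ 2 * w ^ 3) + 1 * (u ^ 4 * w ^ 1)"],
        (rule binary_form_add | rule binary_form_monomial, simp)+, unfold V'_def, Groebner_Basis.algebra)
    show "u = 0 \<and> w = 0" if 0: "W u w = 0" "V' u w = 0" for u w
    proof -
      have "u = 0"
      proof (rule ccontr)
        assume "u \<noteq> 0"
        then have 1: "u ^ 4 + 10 * d * u ^ 2 * w ^ 2 + 25 * w ^ 4 = 0" using 0 by (simp add: W_def)
        show False
        proof (cases "w = 0")
          case True
          with 1 \<open>u \<noteq> 0\<close> show False by simp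
        next
          case False
          then have 2: "u ^ 4 + 2 * d * u ^ 2 * w ^ 2 + w ^ 4 = 0" using 0 by (simp add: V'_def)
          have "8 * (w ^ 2 * (3 * w ^ 2 + d * u ^ 2)) = 0" using 1 2 by Groebner_Basis.algebra
          then have 3: "3 * w ^ 2 + d * u ^ 2 = 0" using num False by simp
          have "16 * u ^ 4 = 0" using 2 3 d2 by Groebner_Basis.algebra
          then show False using num \<open>u \<noteq> 0\<close> by simp
        qed
      qed
      moreover from this have "w = 0" using 0 by (simp add: V'_def)
      ultimately show ?thesis by simp
    qed
    have cases: "M = (1, 0, 0, 1) \<or> M = (1, d * e, e, 1) \<or> M = (1, - d * e, - e, 1) \<or> M = (e, - d, - 1, e) \<or> M = (e, d, 1, e)" if "M \<in> set Ms'" for M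
      using that by (simp add: Ms'_def)
    show "mob_det M \<noteq> 0" if "M \<in> set Ms'" for M
      using cases[OF that] det0 det1 det2 det3 det4 by blast
    show "\<exists>\<rho>. \<forall>u w. W (mob_num M u w) (mob_den M u w) = \<rho> * W u w \<and>
        V' (mob_num M u w) (mob_den M u w) = \<rho> * V' u w" if "M \<in> set Ms'" for M
      using cases[OF that] inv0 inv1 inv2 inv3 inv4 by blast
    show "sorted_wrt (\<lambda>M M'. \<not> mob_eq M M') Ms'"
      unfolding Ms'_def by (simp add: e e(2,4)[symmetric] two)
  qed
  have U_prod: "(2 - d) * U u w = (\<Prod>M\<leftarrow>Ms. l (mob_num M u w) (mob_den M u w))" for u w
    unfolding Ms_def list.map prod_list.Cons prod_list.Nil mob_num.simps mob_den.simps U_def l_def using d2 e2 by Groebner_Basis.algebra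
  have kappa: "((2 - d) :: 'a) \<noteq> 0" using e(1) e2 by auto
  interpret M: moebius_invariant 5 U V Ms by (rule first)
  have form_m: "binary_form (Suc 5) m" unfolding m_def[abs_def]
    using binary_form_mult[OF moebius_invariant.form_U[OF second] form_l'] by simp
  have curve: "galois_curve 5 U V l m Ms H1 H2 4 F (1 / (2 - d)) c"
  proof (intro galois_curve.intro galois_curve_axioms.intro plane_param.intro first)
    have "binary_form (Suc 5) (\<lambda>u w. U u w * l u w)" "binary_form (Suc 5) (\<lambda>u w. V u w * l u w)"
      using binary_form_mult[OF M.form_U form_l] binary_form_mult[OF M.form_V form_l] by simp_all
    with form_m show "binary_form (Suc 5) (\<lambda>u w. vector [U u w * l u w, V u w * l u w, m u w] $ k)" for k :: 3
      using exhaust_3[of k] by auto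
    show "vector [U u w * l u w, V u w * l u w, m u w] \<noteq> (0 :: 'a^3)" if uw: "u \<noteq> 0 \<or> w \<noteq> 0" for u w
    proof
      assume "vector [U u w * l u w, V u w * l u w, m u w] = (0 :: 'a^3)"
      then have 0: "U u w * l u w = 0" "V u w * l u w = 0" "m u w = 0" by (simp_all add: vec_eq_iff forall_3)
      have "l u w = 0" using 0 M.no_common_zero[of u w] uw by auto
      then show False
      proof -
        from \<open>l u w = 0\<close> have "w = 0" by (simp add: l_def)
        with 0(3) uw show False by (simp add: m_def W_def l'_def)
      qed
    qed
    show "form3 4 H1" "form3 4 H2" unfolding H1_def H2_def
      by (simp_all only: form_list)
    show "w * eval3 H1 (vector [U u w * l u w, V u w * l u w, m u w])
        = u * eval3 H2 (vector [U u w * l u w, V u w * l u w, m u w])" for u w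
      unfolding U_def V_def l_def m_def W_def l'_def H1_def H2_def using d2
      by (simp only: eval3_list) Groebner_Basis.algebra
    show "\<exists>u w. eval3 H2 (vector [U u w * l u w, V u w * l u w, m u w]) \<noteq> 0"
    proof (rule ccontr)
      assume "\<not> ?thesis"
      then have 0: "eval3 H2 (vector [U t 1 * l t 1, V t 1 * l t 1, m t 1]) = 0" for t by blast
      define p :: "'a poly" where "p = [:0, 0, 4, 0, 84 * d, 0, 84, 0, -592 * d, 0, 4264, 0, -2568 * d, 0, 4264, 0, -592 * d, 0, 84, 0, 84 * d, 0, 4:]"
      have "poly p t = eval3 H2 (vector [U t 1 * l t 1, V t 1 * l t 1, m t 1])" for t
        unfolding U_def V_def l_def m_def W_def l'_def H2_def p_def using d2
        by (simp only: eval3_list power_one mult_1_right mult_1_left) Groebner_Basis.algebra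
      then have "p = 0" using 0 by (intro poly_eqI_all) simp
      then show False unfolding p_def using num by simp
    qed
    show "binary_form 1 l" by (rule form_l)
    show "U u w = (1 / (2 - d)) * (\<Prod>M\<leftarrow>Ms. l (mob_num M u w) (mob_den M u w))" for u w
      unfolding U_prod[symmetric] using kappa by simp
    show "form3 (Suc 5) F" unfolding F_def by (simp only: form_list)
    show "Polynomial.degree F = 5" unfolding F_def using c by (simp add: c_def)
    show "Polynomial.coeff F 5 = [:[:0, c:]:]" unfolding F_def c_def by (simp only: eval_nat_numeral BitM.simps numeral_One One_nat_def coeff_pCons_Suc coeff_pCons_0)
    show "eval3 F (vector [U u w * l u w, V u w * l u w, m u w]) = 0" for u w
      unfolding U_def V_def l_def m_def W_def l'_def F_def using d2
      by (simp only: eval3_list) Groebner_Basis.algebra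
    show "\<exists>y z. eval3 F (vector [0, z, y]) \<noteq> 0"
    proof (rule ccontr)
      assume "\<not> ?thesis"
      then have 0: "eval3 F (vector [0, 1, y]) = 0" for y by blast
      have "[:- 9801, 0, - 585 * d, 0, - 25:] = (0 :: 'a poly)"
      proof (rule poly_eqI_all)
        show "poly [:- 9801, 0, - 585 * d, 0, - 25:] y = poly 0 y" for y :: 'a
          using 0[of y] unfolding F_def by (simp only: eval3_list) Groebner_Basis.algebra
      qed
      then have 5: "(9801 :: 'a) = 0" "(25 :: 'a) = 0" by simp_all
      have "(1 :: 'a) = 9801 - 392 * 25" by simp
      then have "(1 :: 'a) = 0" unfolding 5 by simp
      then show False by simp
    qed
  qed
  have mV: "V u w * l u w = V' u w * l' u w" for u w
    unfolding V_def V'_def l_def l'_def by Groebner_Basis.algebra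
  have G1: "comp_monoid M.Gal \<cong> integer_mod_group 5" by (rule M.Gal_Z5) simp
  have G2: "comp_monoid (moebius_invariant.Gal 5 W V') \<cong> integer_mod_group 5"
    by (rule moebius_invariant.Gal_Z5[OF second]) simp
  have "has_galois_points (param_map (\<lambda>u w. vector [U u w * l u w, V u w * l u w, m u w])) (Suc 5)
      (integer_mod_group 5) (integer_mod_group 5)"
    by (rule has_galois_points_galois_curve[OF curve second m_def mV form_l' _ _ _ _ G1 G2,
          of 1 0 0 1]) (simp_all add: l_def l'_def)
  then show ?thesis by auto
qed

theorem theorem2:
  assumes "CHAR('a::alg_closed_field) \<noteq> 2"
  shows
    "(CHAR('a) \<noteq> 3 \<longrightarrow>
      (\<exists>f :: 'a P1 \<Rightarrow> 'a P2.
        morphism_P1_P2 f \<and> birational_onto_image f \<and> plane_curve_of_degree (range f) 5 \<and>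
        (\<exists>P\<^sub>1 P\<^sub>2. f P\<^sub>1 \<noteq> f P\<^sub>2 \<and>
          galois_point (range f) (f P\<^sub>1) \<and> galois_point (range f) (f P\<^sub>2) \<and>
          galois_group_at (range f) (f P\<^sub>1) \<cong> integer_mod_group 4 \<and>
          galois_group_at (range f) (f P\<^sub>2) \<cong> integer_mod_group 4))) \<and>
     (\<exists>f :: 'a P1 \<Rightarrow> 'a P2.
        morphism_P1_P2 f \<and> birational_onto_image f \<and> plane_curve_of_degree (range f) 5 \<and>
        (\<exists>P\<^sub>1 P\<^sub>2. f P\<^sub>1 \<noteq> f P\<^sub>2 \<and>
          galois_point (range f) (f P\<^sub>1) \<and> galois_point (range f) (f P\<^sub>2) \<and>
          galois_group_at (range f) (f P\<^sub>1) \<cong> integer_mod_group 2 \<times>\<times> integer_mod_group 2 \<and>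
          galois_group_at (range f) (f P\<^sub>2) \<cong> integer_mod_group 2 \<times>\<times> integer_mod_group 2)) \<and>
     (\<exists>f :: 'a P1 \<Rightarrow> 'a P2.
        morphism_P1_P2 f \<and> birational_onto_image f \<and> plane_curve_of_degree (range f) 5 \<and>
        (\<exists>P\<^sub>1 P\<^sub>2. f P\<^sub>1 \<noteq> f P\<^sub>2 \<and>
          galois_point (range f) (f P\<^sub>1) \<and> galois_point (range f) (f P\<^sub>2) \<and>
          galois_group_at (range f) (f P\<^sub>1) \<cong> integer_mod_group 4 \<and>
          galois_group_at (range f) (f P\<^sub>2) \<cong> integer_mod_group 2 \<times>\<times> integer_mod_group 2)) \<and>
     (\<exists>f :: 'a P1 \<Rightarrow> 'a P2.
        morphism_P1_P2 f \<and> birational_onto_image f \<and> plane_curve_of_degree (range f) 6 \<and>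
        (\<exists>P\<^sub>1 P\<^sub>2. f P\<^sub>1 \<noteq> f P\<^sub>2 \<and>
          galois_point (range f) (f P\<^sub>1) \<and> galois_point (range f) (f P\<^sub>2) \<and>
          galois_group_at (range f) (f P\<^sub>1) \<cong> integer_mod_group 5 \<and>
          galois_group_at (range f) (f P\<^sub>2) \<cong> integer_mod_group 5))"
proof -
  have two: "(2 :: 'a) \<noteq> 0"
    using numeral_neq_0_of_CHAR[of 2, where 'a = 'a] assms by simp
  have three: "(3 :: 'a) \<noteq> 0" if "CHAR('a) \<noteq> 3"
    using numeral_neq_0_of_CHAR[of 3, where 'a = 'a] that by simp
  show ?thesis
    using galois_points_Z4_Z4[OF two three] galois_points_V4_V4[OF two]
      galois_points_Z4_V4[OF two] galois_points_Z5_Z5[OF two]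
    unfolding has_galois_points_def by blast
qed

end
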